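(* Let $\mathcal{F}$ be a family of holomorphic functions in a domain $D\subset\mathbb{C}$. Let $d,k,m$ be positive integers such that $\frac{k+1}{d}+\frac{1}{m}<1$, and let $n$ be a positive integer. Let $a(z)$ and $\psi(z)$ be holomorphic functions in $D$, with $\psi(z)\neq 0$ for all $z\in D$. Suppose that for each $f\in\mathcal{F}$: all zeros of $f$ are of multiplicity at least $d$; and all zeros in $D$ of $f^{(k)}(z)-a(z)f^n(z)-\psi(z)$ are of multiplicity at least $m$. Then $\mathcal{F}$ is normal in $D$.
   Context: A family of holomorphic functions on a domain $D\subset\mathbb{C}$ is normal in $D$ if every sequence in the family has a subsequence which converges (spherically) uniformly on compact subsets of $D$ to a holomorphic function or to $\infty$. Here $f^n$ denotes the $n$-th power of $f$ and $f^{(k)}$ its $k$-th derivative. *)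

theory Defs
  imports "HOL-Complex_Analysis.Complex_Analysis"
begin

definition complex_domain :: "complex set \<Rightarrow> bool" where
  "complex_domain D \<longleftrightarrow> open D \<and> connected D \<and> D \<noteq> {}"

text \<open>
  Points of the Riemann sphere are encoded as \<^typ>\<open>complex option\<close>, with \<^term>\<open>None\<close> as the
  point at infinity. The distance is the chordal one (Euclidean distance of the stereographic
  images on the unit sphere); it is uniformly equivalent to the arc-length metric on the sphere,
  so both give the same notion of spherically uniform convergence.
\<close>

fun chordal_dist :: "complex option \<Rightarrow> complex option \<Rightarrow> real" where
  "chordal_dist (Some z) (Some w) =
     2 * cmod (z - w) / (sqrt (1 + (cmod z)\<^sup>2) * sqrt (1 + (cmod w)\<^sup>2))"
| "chordal_dist (Some z) None = 2 / sqrt (1 + (cmod z)\<^sup>2)"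
| "chordal_dist None (Some w) = 2 / sqrt (1 + (cmod w)\<^sup>2)"
| "chordal_dist None None = 0"

definition spherically_converges_on_compacts ::
  "complex set \<Rightarrow> (nat \<Rightarrow> complex \<Rightarrow> complex) \<Rightarrow> (complex \<Rightarrow> complex option) \<Rightarrow> bool" where
  "spherically_converges_on_compacts D h g \<longleftrightarrow>
     (\<forall>K. compact K \<and> K \<subseteq> D \<longrightarrow>
        (\<forall>\<epsilon>>0. \<exists>N. \<forall>j\<ge>N. \<forall>z\<in>K. chordal_dist (Some (h j z)) (g z) < \<epsilon>))"

definition normal_family :: "complex set \<Rightarrow> (complex \<Rightarrow> complex) set \<Rightarrow> bool" where
  "normal_family D F \<longleftrightarrow>
     (\<forall>h :: nat \<Rightarrow> complex \<Rightarrow> complex. (\<forall>j. h j \<in> F) \<longrightarrow>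
        (\<exists>r. strict_mono r \<and>
           ((\<exists>g. g holomorphic_on D \<and>
               spherically_converges_on_compacts D (h \<circ> r) (\<lambda>z. Some (g z))) \<or>
            spherically_converges_on_compacts D (h \<circ> r) (\<lambda>z. None))))"

text \<open>
  The value of \<^const>\<open>zorder\<close> is unspecified where a function vanishes identically near the
  point; there the multiplicity is infinite, hence at least \<open>m\<close> for every \<open>m\<close>.
\<close>

definition zeros_mult_ge :: "complex set \<Rightarrow> (complex \<Rightarrow> complex) \<Rightarrow> nat \<Rightarrow> bool" where
  "zeros_mult_ge D f m \<longleftrightarrow>
     (\<forall>z\<in>D. f z = 0 \<longrightarrow> (\<forall>\<^sub>F w in nhds z. f w = 0) \<or> zorder f z \<ge> int m)"

end

(*
If the family is not normal, rescaling at well chosen points (Zalcman, Pang) produces functions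
g i (z) = f i (z i + rho i z) / rho i ^ k converging to a non-constant entire function G of
exponential type whose zeros have multiplicity at least d, while those of K = G^(k) - psi c have
multiplicity at least m; the term a f^n dies in the limit. The points are chosen by maximising a
density that is homogeneous under this rescaling: with phi = f^(1/k) it measures |phi'| against
1 + |phi|^(k+1), so that a bounded density bounds the spherical derivative.

Such a G does not exist. By the multiplicities, H = (G^(k+1))^(d m) / (G^(m(d-k-1)) K^(d(m-1))) is
entire. On a sequence of circles all logarithmic derivatives of G, ..., G^(k), K grow at most
polynomially, and since (k+1)/d + 1/m < 1 this bounds both H and H G polynomially there. Hence H and G
are polynomials, and comparing degrees in the definition of H is a contradiction.

The growth estimates come from Harnack's inequality for log |g|, together with a Hopf lemma at the
boundary of {|g| > 1}; no Nevanlinna theory is needed.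
*)
theory Submission
  imports Defs "HOL-Computational_Algebra.Fundamental_Theorem_Algebra"
begin

subsection \<open>Harnack inequalities\<close>

text \<open>Scaling by rho^k is forced by the equation: it leaves the \<open>k\<close>-th derivative
  unchanged, so \<open>\<psi>\<close> survives as the constant \<open>\<psi> c\<close>. In terms of
  phi = f^(1/k), which need not exist globally, the density is the positive part of (|k phi'|^k - 1)
  / |phi|^(k (k + 1)). Subtracting 1 in the numerator, where Marty's quotient adds it in the
  denominator, makes the scaling law exact; the price is that continuity at the zeros of f has to be
  proved, from multiplicities above \<open>k\<close>.

  The exponents of H come from orders of zeros. With P = G^(k+1) = K', a zero of G of order q >= d
  is a zero of P of order q - k - 1 >= q (d - k - 1) / d, and a zero of K of order q >= m is one of
  P of order q - 1 >= q (m - 1) / m; the power d m clears both denominators. G and K have no common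
  zero because \<open>\<psi> c\<close> is not 0. The hypothesis says that the exponents in the
  denominator of H add up to more than d m. The surplus m (d - k - 1) - d pays for the factor G in H
  G, and the bound on H G is what makes G a polynomial once H is known to be one.\<close>

lemma halfplane_schwarz:
  fixes \<phi> :: "complex \<Rightarrow> complex"
  assumes hol: "\<phi> holomorphic_on ball z r" and r: "r > 0"
    and pos: "\<And>w. w \<in> ball z r \<Longrightarrow> Re (\<phi> w) > 0"
  shows "cmod (deriv \<phi> z) \<le> 2 * Re (\<phi> z) / r"
    and "\<And>w. w \<in> ball z r \<Longrightarrow> r * cmod (\<phi> w - \<phi> z) \<le> cmod (w - z) * cmod (\<phi> w + cnj (\<phi> z))"
proof -
  \<comment> \<open>The Cayley transform of the right half-plane that sends \<open>\<phi> z\<close>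
    to 0, precomposed with the affine map of the unit disc onto \<open>ball z r\<close>; both claims
    are the Schwarz lemma for it.\<close>
  define W where "W \<zeta> = (\<phi> (z + of_real r * \<zeta>) - \<phi> z) / (\<phi> (z + of_real r * \<zeta>) + cnj (\<phi> z))" for \<zeta>
  have inb: "z + of_real r * \<zeta> \<in> ball z r" if "\<zeta> \<in> ball 0 1" for \<zeta>
    using that r by (simp add: dist_norm norm_mult)
  have nz: "a + cnj b \<noteq> 0" if "Re a > 0" "Re b > 0" for a b
    using that by (auto simp: complex_eq_iff)
  have lt: "cmod (a - b) < cmod (a + cnj b)" if "Re a > 0" "Re b > 0" for a b
  proof -
    have "(Re a - Re b)\<^sup>2 < (Re a + Re b)\<^sup>2"
      using mult_pos_pos[OF that] by (simp add: power2_eq_square algebra_simps)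
    then show ?thesis by (simp add: cmod_def)
  qed
  have "z \<in> ball z r" using r by simp
  note posz = pos[OF this]
  have d: "(\<phi> has_field_derivative deriv \<phi> z) (at z)"
    by (rule holomorphic_derivI[OF hol]) (use r in auto)
  have comp: "(\<lambda>\<zeta>. \<phi> (z + of_real r * \<zeta>)) holomorphic_on ball 0 1"
    by (rule holomorphic_on_compose_gen[OF _ hol, unfolded o_def])
       (use inb in \<open>auto intro!: holomorphic_intros\<close>)
  have holW: "W holomorphic_on ball 0 1"
    unfolding W_def using nz pos inb posz by (intro holomorphic_intros comp) auto
  have Wlt: "cmod (W \<zeta>) < 1" if "cmod \<zeta> < 1" for \<zeta>
  proof -
    have "Re (\<phi> (z + of_real r * \<zeta>)) > 0" using pos inb that by simp
    from lt[OF this posz] nz[OF this posz] show ?thesis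
      unfolding W_def by (simp add: norm_divide)
  qed
  have W0: "W 0 = 0" by (simp add: W_def)
  have S: "\<And>\<zeta>. cmod \<zeta> < 1 \<Longrightarrow> cmod (W \<zeta>) \<le> cmod \<zeta>" "cmod (deriv W 0) \<le> 1"
    using Schwarz_Lemma'[OF holW W0 Wlt] by blast+
  have "(W has_field_derivative (of_real r * deriv \<phi> z) / (2 * of_real (Re (\<phi> z)))) (at 0)"
  proof -
    have d': "((\<lambda>\<zeta>. \<phi> (z + of_real r * \<zeta>)) has_field_derivative deriv \<phi> z * of_real r) (at 0)"
      by (rule DERIV_chain2[where f = \<phi>]) (use d in \<open>auto intro!: derivative_eq_intros\<close>)
    have s: "\<phi> z + cnj (\<phi> z) = 2 * of_real (Re (\<phi> z))" by (simp add: complex_add_cnj)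
    have nz0: "\<phi> (z + of_real r * 0) + cnj (\<phi> z) \<noteq> 0" using nz[OF posz posz] by simp
    have "(W has_field_derivative
        ((deriv \<phi> z * of_real r - 0) * (\<phi> (z + of_real r * 0) + cnj (\<phi> z)) -
         (\<phi> (z + of_real r * 0) - \<phi> z) * (deriv \<phi> z * of_real r + 0)) /
        ((\<phi> (z + of_real r * 0) + cnj (\<phi> z)) * (\<phi> (z + of_real r * 0) + cnj (\<phi> z)))) (at 0)"
      unfolding W_def
      by (intro DERIV_divide DERIV_add DERIV_diff d' DERIV_const nz0)
    moreover have "of_real (Re (\<phi> z)) \<noteq> (0::complex)" using posz by simp
    ultimately show ?thesis by (simp add: s)
  qed
  then have "deriv W 0 = (of_real r * deriv \<phi> z) / (2 * of_real (Re (\<phi> z)))"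
    by (rule DERIV_imp_deriv)
  moreover have "cmod (deriv W 0) \<le> 1" using S(2) .
  ultimately have "r * cmod (deriv \<phi> z) / (2 * Re (\<phi> z)) \<le> 1"
    using r posz by (simp add: norm_mult norm_divide)
  then show "cmod (deriv \<phi> z) \<le> 2 * Re (\<phi> z) / r"
    using r posz by (simp add: field_simps)
  fix w assume w: "w \<in> ball z r"
  define \<zeta> where "\<zeta> = (w - z) / of_real r"
  have w_eq: "w = z + of_real r * \<zeta>" using r by (simp add: \<zeta>_def)
  have n\<zeta>: "cmod \<zeta> = cmod (w - z) / r" using r by (simp add: \<zeta>_def norm_divide)
  then have "cmod \<zeta> < 1" using w r by (simp add: dist_norm norm_minus_commute)
  from S(1)[OF this] have "cmod (W \<zeta>) \<le> cmod (w - z) / r" using n\<zeta> by simp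
  moreover have "cmod (W \<zeta>) = cmod (\<phi> w - \<phi> z) / cmod (\<phi> w + cnj (\<phi> z))"
    unfolding W_def using w_eq by (simp add: norm_divide)
  moreover have "cmod (\<phi> w + cnj (\<phi> z)) > 0" using nz[OF pos[OF w] posz] by simp
  ultimately show "r * cmod (\<phi> w - \<phi> z) \<le> cmod (w - z) * cmod (\<phi> w + cnj (\<phi> z))"
    using r by (simp add: field_simps)
qed

text \<open>The second estimate of \<open>halfplane_schwarz\<close> is squared. The difference of
  imaginary parts enters both sides as y^2 and can be discarded because t <= r; what remains is r |X
  - b| <= t (X + b), which contains both Harnack bounds.\<close>

lemma halfplane_harnack:
  fixes \<phi> :: "complex \<Rightarrow> complex"
  assumes hol: "\<phi> holomorphic_on ball z r" and r: "r > 0"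
    and pos: "\<And>w. w \<in> ball z r \<Longrightarrow> Re (\<phi> w) > 0" and w: "w \<in> ball z r"
  shows "(r - cmod (w - z)) * Re (\<phi> z) \<le> (r + cmod (w - z)) * Re (\<phi> w)"
    and "(r - cmod (w - z)) * Re (\<phi> w) \<le> (r + cmod (w - z)) * Re (\<phi> z)"
proof -
  define t where "t = cmod (w - z)"
  have t: "0 \<le> t" "t < r" using w by (auto simp: t_def dist_norm norm_minus_commute)
  have p: "Re (\<phi> w) > 0" "Re (\<phi> z) > 0" using pos w r by auto
  define X b y where "X = Re (\<phi> w)" and "b = Re (\<phi> z)" and "y = Im (\<phi> w) - Im (\<phi> z)"
  have "r * cmod (\<phi> w - \<phi> z) \<le> t * cmod (\<phi> w + cnj (\<phi> z))"
    using halfplane_schwarz(2)[OF assms] by (simp add: t_def)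
  then have "(r * cmod (\<phi> w - \<phi> z))\<^sup>2 \<le> (t * cmod (\<phi> w + cnj (\<phi> z)))\<^sup>2"
    using r by (intro power_mono) auto
  then have "r\<^sup>2 * ((X - b)\<^sup>2 + y\<^sup>2) \<le> t\<^sup>2 * ((X + b)\<^sup>2 + y\<^sup>2)"
    by (simp add: power_mult_distrib cmod_power2 X_def b_def y_def)
  moreover have "t\<^sup>2 * y\<^sup>2 \<le> r\<^sup>2 * y\<^sup>2" using t by (intro mult_right_mono power_mono) auto
  ultimately have "r\<^sup>2 * (X - b)\<^sup>2 \<le> t\<^sup>2 * (X + b)\<^sup>2"
    by (simp add: distrib_left)
  then have "(r * \<bar>X - b\<bar>)\<^sup>2 \<le> (t * (X + b))\<^sup>2"
    by (simp add: power_mult_distrib)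
  then have "r * \<bar>X - b\<bar> \<le> t * (X + b)"
    by (rule power2_le_imp_le) (use t p in \<open>auto simp: X_def b_def\<close>)
  moreover have "r * (X - b) \<le> r * \<bar>X - b\<bar>" "r * (b - X) \<le> r * \<bar>X - b\<bar>" using r by auto
  ultimately show "(r - cmod (w - z)) * Re (\<phi> z) \<le> (r + cmod (w - z)) * Re (\<phi> w)"
    and "(r - cmod (w - z)) * Re (\<phi> w) \<le> (r + cmod (w - z)) * Re (\<phi> z)"
    by (auto simp: algebra_simps X_def b_def t_def)
qed

text \<open>A branch of - log f maps the disc into the right half-plane, which transfers the
  half-plane estimates to zero-free functions.\<close>

lemma nonvanishing_neg_log:
  assumes hol: "f holomorphic_on ball z r" and r: "r > 0"
    and nz: "\<And>w. w \<in> ball z r \<Longrightarrow> f w \<noteq> 0" and lt: "\<And>w. w \<in> ball z r \<Longrightarrow> cmod (f w) < 1"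
  shows "\<exists>\<phi>. \<phi> holomorphic_on ball z r \<and> deriv \<phi> z = - deriv f z / f z \<and>
    (\<forall>w\<in>ball z r. Re (\<phi> w) = - ln (cmod (f w)) \<and> Re (\<phi> w) > 0)"
proof -
  obtain g where g: "g holomorphic_on ball z r" "\<And>w. w \<in> ball z r \<Longrightarrow> exp (g w) = f w"
    using holomorphic_logarithm_exists[OF convex_ball open_ball hol nz, of z] r by auto
  have "Re (g w) = ln (cmod (f w))" if "w \<in> ball z r" for w
    using g(2)[OF that] by (metis ln_exp norm_exp_eq_Re)
  moreover have "ln (cmod (f w)) < 0" if "w \<in> ball z r" for w
    using nz[OF that] lt[OF that] by simp
  moreover have "deriv (\<lambda>w. - g w) z = - deriv f z / f z"
  proof -
    have dg: "(g has_field_derivative deriv g z) (at z)"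
      by (rule holomorphic_derivI[OF g(1)]) (use r in auto)
    have "((\<lambda>w. exp (g w)) has_field_derivative exp (g z) * deriv g z) (at z)"
      using dg by (auto intro!: derivative_eq_intros)
    moreover have "eventually (\<lambda>w. w \<in> ball z r) (nhds z)"
      using r by (intro eventually_nhds_in_open) auto
    then have "eventually (\<lambda>w. exp (g w) = f w) (nhds z)"
      by eventually_elim (rule g(2))
    ultimately have "(f has_field_derivative exp (g z) * deriv g z) (at z)"
      using DERIV_cong_ev[OF refl, of "\<lambda>w. exp (g w)" f z "exp (g z) * deriv g z"] by simp
    then have "deriv f z = f z * deriv g z" using g(2)[of z] r by (simp add: DERIV_imp_deriv)
    then have "deriv g z = deriv f z / f z" using nz[of z] r by simp
    moreover have "deriv (\<lambda>w. - g w) z = - deriv g z"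
      using dg by (intro DERIV_imp_deriv) (auto intro!: derivative_eq_intros)
    ultimately show ?thesis by simp
  qed
  ultimately show ?thesis using g(1) by (intro exI[of _ "\<lambda>w. - g w"]) (auto intro: holomorphic_intros)
qed

text \<open>The Schwarz estimate at the centre for - log f. Its strength lies in the factor |f z| ln
  (1 / |f z|), which is small together with f z.\<close>

lemma nonvanishing_deriv_le:
  assumes "f holomorphic_on ball z r" and r: "r > 0"
    and "\<And>w. w \<in> ball z r \<Longrightarrow> f w \<noteq> 0" and "\<And>w. w \<in> ball z r \<Longrightarrow> cmod (f w) < 1"
  shows "cmod (deriv f z) \<le> 2 / r * cmod (f z) * - ln (cmod (f z))"
proof -
  obtain \<phi> where \<phi>: "\<phi> holomorphic_on ball z r"
    "\<And>w. w \<in> ball z r \<Longrightarrow> Re (\<phi> w) = - ln (cmod (f w))"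
    "\<And>w. w \<in> ball z r \<Longrightarrow> Re (\<phi> w) > 0"
    "deriv \<phi> z = - deriv f z / f z"
    using nonvanishing_neg_log[of f z r] assms by metis
  have "cmod (deriv f z) / cmod (f z) \<le> 2 * - ln (cmod (f z)) / r"
    using halfplane_schwarz(1)[OF \<phi>(1) r \<phi>(3)] \<phi>(4) \<phi>(2)[of z] r by (simp add: norm_divide)
  moreover have "cmod (f z) > 0" using assms by auto
  ultimately show ?thesis by (simp add: field_simps)
qed

lemma nonvanishing_harnack:
  assumes "f holomorphic_on ball z r" and r: "r > 0"
    and "\<And>w. w \<in> ball z r \<Longrightarrow> f w \<noteq> 0" and "\<And>w. w \<in> ball z r \<Longrightarrow> cmod (f w) < 1"
    and w: "w \<in> ball z r"
  shows "(r - cmod (w - z)) * - ln (cmod (f z)) \<le> (r + cmod (w - z)) * - ln (cmod (f w))"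
    and "(r - cmod (w - z)) * - ln (cmod (f w)) \<le> (r + cmod (w - z)) * - ln (cmod (f z))"
proof -
  obtain \<phi> where \<phi>: "\<phi> holomorphic_on ball z r"
    "\<And>w. w \<in> ball z r \<Longrightarrow> Re (\<phi> w) = - ln (cmod (f w))"
    "\<And>w. w \<in> ball z r \<Longrightarrow> Re (\<phi> w) > 0"
    using nonvanishing_neg_log[of f z r] assms by metis
  have "z \<in> ball z r" using r by simp
  then show "(r - cmod (w - z)) * - ln (cmod (f z)) \<le> (r + cmod (w - z)) * - ln (cmod (f w))"
    and "(r - cmod (w - z)) * - ln (cmod (f w)) \<le> (r + cmod (w - z)) * - ln (cmod (f z))"
    using halfplane_harnack[OF \<phi>(1) r \<phi>(3) w] \<phi>(2) w by auto
qed

lemma nonvanishing_harnack_large: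
  assumes "g holomorphic_on ball z r" and r: "r > 0"
    and gt: "\<And>w. w \<in> ball z r \<Longrightarrow> cmod (g w) > 1"
    and w: "w \<in> ball z r"
  shows "(r - cmod (w - z)) * ln (cmod (g z)) \<le> (r + cmod (w - z)) * ln (cmod (g w))"
proof -
  have nz: "g v \<noteq> 0" if "v \<in> ball z r" for v using gt[OF that] by auto
  have "(\<lambda>w. inverse (g w)) holomorphic_on ball z r"
    using assms(1) nz by (auto intro: holomorphic_intros)
  moreover have "cmod (inverse (g v)) < 1" if "v \<in> ball z r" for v
    using gt[OF that] by (simp add: norm_inverse inverse_less_1_iff)
  ultimately have "(r - cmod (w - z)) * - ln (cmod (inverse (g z))) \<le> (r + cmod (w - z)) * - ln (cmod (inverse (g w)))"
    using nonvanishing_harnack(1)[of "\<lambda>w. inverse (g w)" z r w] nz w r by auto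
  moreover have "g z \<noteq> 0" "g w \<noteq> 0" using nz w r by auto
  ultimately show ?thesis by (simp add: norm_inverse ln_inverse)
qed

text \<open>A Hopf lemma at the point nearest to \<open>z0\<close> where \<open>\<bar>g\<bar> \<le> 1\<close>: the positive harmonic function
  \<open>ln \<bar>g\<bar>\<close> vanishes there, so its inner normal derivative is at least \<open>ln \<bar>g z0\<bar> / 2r\<close>.\<close>
lemma spherical_harnack:
  assumes hol: "g holomorphic_on ball z0 R" and R: "R > 0" and M: "M \<ge> 0"
    and sph: "\<And>z. z \<in> ball z0 R \<Longrightarrow> cmod (deriv g z) \<le> M * (1 + (cmod (g z))\<^sup>2)"
  shows "ln (cmod (g z0)) \<le> 4 * M * R \<or>
    (\<forall>v\<in>ball z0 R. cmod (g v) > 1) \<and>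
    (\<forall>w. cmod (w - z0) \<le> R / 2 \<longrightarrow> ln (cmod (g z0)) \<le> 3 * ln (cmod (g w)))"
proof (cases "\<forall>v\<in>ball z0 R. cmod (g v) > 1")
  case True
  have "ln (cmod (g z0)) \<le> 3 * ln (cmod (g w))" if w: "cmod (w - z0) \<le> R / 2" for w
  proof -
    have wb: "w \<in> ball z0 R" using w R by (simp add: dist_norm norm_minus_commute)
    have l: "ln (cmod (g z0)) \<ge> 0" "ln (cmod (g w)) \<ge> 0"
      using True wb R by (auto intro!: ln_ge_zero less_imp_le[of 1])
    \<comment> \<open>Within half the radius the Harnack ratio (R + t) / (R - t) is at most
      3.\<close>
    have "R / 2 * ln (cmod (g z0)) \<le> (R - cmod (w - z0)) * ln (cmod (g z0))"
      using w l by (intro mult_right_mono) auto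
    also have "\<dots> \<le> (R + cmod (w - z0)) * ln (cmod (g w))"
      using nonvanishing_harnack_large[OF hol R _ wb] True by auto
    also have "\<dots> \<le> (3 * R / 2) * ln (cmod (g w))" using w l by (intro mult_right_mono) auto
    finally show ?thesis using R by simp
  qed
  with True show ?thesis by auto
next
  case False
  then obtain v0 where v0: "v0 \<in> ball z0 R" "cmod (g v0) \<le> 1" by force
  show ?thesis
  proof (cases "cmod (g z0) \<le> 1")
    case True
    then have "ln (cmod (g z0)) \<le> 0" by (cases "g z0 = 0") (auto simp: ln_le_zero_iff)
    also have "0 \<le> 4 * M * R" using R M by simp
    finally show ?thesis by simp
  next
    case gz0: False
    define A where "A = {v \<in> cball z0 (dist z0 v0). cmod (g v) \<le> 1}"
    have sub: "cball z0 (dist z0 v0) \<subseteq> ball z0 R" using v0 by auto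
    have cont: "continuous_on (cball z0 (dist z0 v0)) g"
      using hol sub holomorphic_on_imp_continuous_on continuous_on_subset by blast
    have "closed A"
      unfolding A_def by (intro continuous_on_closed_Collect_le continuous_intros cont closed_cball)
    moreover have "bounded A"
      by (rule bounded_subset[OF bounded_cball[of z0 "dist z0 v0"]]) (auto simp: A_def)
    ultimately have "compact A" by (simp add: compact_eq_bounded_closed)
    moreover have "A \<noteq> {}" using v0 by (auto simp: A_def)
    moreover have "continuous_on A (dist z0)" by (intro continuous_intros)
    ultimately obtain z1 where z1: "z1 \<in> A" "\<And>v. v \<in> A \<Longrightarrow> dist z0 z1 \<le> dist z0 v"
      using continuous_attains_inf[of A "dist z0"] by blast
    define r where "r = dist z0 z1"
    have z1': "cmod (g z1) \<le> 1" "r \<le> dist z0 v0" using z1 by (auto simp: A_def r_def)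
    have rR: "r < R" using z1' v0 by auto
    have "z1 \<noteq> z0" using z1' gz0 by auto
    then have r: "r > 0" by (simp add: r_def)
    have gt: "cmod (g v) > 1" if "v \<in> ball z0 r" for v
    proof (rule ccontr)
      assume "\<not> ?thesis"
      then have "v \<in> A" using that z1' by (auto simp: A_def)
      from z1(2)[OF this] that show False by (simp add: r_def)
    qed
    \<comment> \<open>The outward unit vector at \<open>z1\<close>; \<open>v x\<close> moves a
      distance \<open>x\<close> from \<open>z1\<close> towards \<open>z0\<close>.\<close>
    define e where "e = (z1 - z0) / of_real r"
    have ne: "cmod e = 1" using r by (simp add: e_def norm_divide r_def dist_norm norm_minus_commute)
    define v where "v x = z1 - of_real x * e" for x
    have vz0: "v x - z0 = of_real (r - x) * e" for x
      using r by (simp add: v_def e_def field_simps)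
    have z1b: "z1 \<in> ball z0 R" using rR by (simp add: r_def)
    have holr: "g holomorphic_on ball z0 r" using hol rR by (meson holomorphic_on_subset less_imp_le subset_ball)
    define L where "L = ln (cmod (g z0))"
    \<comment> \<open>Since \<open>v x\<close> has distance r - x from the centre, Harnack leaves a
      factor x on the left. By ln t <= t - 1 and |g z1| <= 1, ln |g (v x)| is at most the increment
      of g from \<open>z1\<close>, so a difference quotient is bounded below.\<close>
    have key: "L / (2 * r) \<le> cmod ((g (v x) - g z1) / (v x - z1)) \<and> 1 < cmod (g (v x))" if x: "0 < x" "x < r" for x
    proof -
      have n: "cmod (v x - z0) = r - x" using x ne by (simp add: vz0 norm_mult del: of_real_diff)
      have vb: "v x \<in> ball z0 r" using n x by (simp add: dist_norm norm_minus_commute)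
      have "(r - (r - x)) * L \<le> (r + (r - x)) * ln (cmod (g (v x)))"
        using nonvanishing_harnack_large[OF holr r gt vb] n by (simp add: L_def)
      also have "\<dots> \<le> (2 * r) * ln (cmod (g (v x)))"
        using x gt[OF vb] by (intro mult_right_mono) auto
      finally have "x * L \<le> 2 * r * ln (cmod (g (v x)))" by simp
      also have "\<dots> \<le> 2 * r * (cmod (g (v x)) - 1)"
        using r gt[OF vb] by (intro mult_left_mono ln_le_minus_one) auto
      also have "\<dots> \<le> 2 * r * cmod (g (v x) - g z1)"
        using r z1' norm_triangle_ineq2[of "g (v x)" "g z1"] by (intro mult_left_mono) auto
      finally have "x * L \<le> 2 * r * cmod (g (v x) - g z1)" .
      moreover have "cmod (v x - z1) = x" using x ne by (simp add: v_def norm_mult)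
      ultimately show ?thesis using r x gt[OF vb] by (simp add: norm_divide field_simps)
    qed
    have ev: "eventually (\<lambda>x. 0 < x \<and> x < r) (at_right 0)"
      using r by (auto simp: eventually_at_right_field)
    have "(g has_field_derivative deriv g z1) (at z1)"
      by (rule holomorphic_derivI[OF hol]) (use z1b in auto)
    then have lim: "((\<lambda>y. (g y - g z1) / (y - z1)) \<longlongrightarrow> deriv g z1) (at z1)"
      by (simp add: has_field_derivative_iff)
    have vlim: "filterlim v (at z1) (at_right 0)"
    proof (rule filterlim_atI)
      show "(v \<longlongrightarrow> z1) (at_right 0)" unfolding v_def
        by (rule tendsto_eq_intros refl | simp)+
      show "\<forall>\<^sub>F x in at_right 0. v x \<noteq> z1" using ev
        by eventually_elim (use ne in \<open>auto simp: v_def\<close>)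
    qed
    have "((\<lambda>x. cmod ((g (v x) - g z1) / (v x - z1))) \<longlongrightarrow> cmod (deriv g z1)) (at_right 0)"
      by (intro tendsto_norm filterlim_compose[OF lim vlim])
    then have "L / (2 * r) \<le> cmod (deriv g z1)"
      by (rule tendsto_lowerbound) (use ev key in \<open>auto elim!: eventually_mono\<close>)
    also have "\<dots> \<le> M * (1 + (cmod (g z1))\<^sup>2)" using sph z1b by auto
    \<comment> \<open>Here |g z1| <= 1 gives |g' z1| <= 2 M, and L / (2 r) <= 2 M is the source of
      the constant 4.\<close>
    also have "\<dots> \<le> M * (1 + 1)" using z1' M by (intro mult_left_mono add_left_mono) (auto simp: power_le_one)
    finally have "L \<le> 4 * M * r" using r by (simp add: field_simps)
    also have "\<dots> \<le> 4 * M * R" using rR M by (intro mult_left_mono) auto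
    finally show ?thesis by (simp add: L_def)
  qed
qed

subsection \<open>Orders of vanishing\<close>

text \<open>Derivatives instead of \<open>zorder\<close>: functions vanishing identically near the
  point qualify for every \<open>m\<close>, and the condition passes through rescaling by the chain
  rule and through limits by Hurwitz.\<close>

definition vanishes_to_order :: "(complex \<Rightarrow> complex) \<Rightarrow> complex \<Rightarrow> nat \<Rightarrow> bool" where
  "vanishes_to_order f z m \<longleftrightarrow> (\<forall>l<m. (deriv ^^ l) f z = 0)"

lemma zeros_mult_ge_imp_vanishes:
  assumes "zeros_mult_ge D f m" and D: "open D" and hol: "f holomorphic_on D"
    and z: "z \<in> D" "f z = 0"
  shows "vanishes_to_order f z m"
proof (cases "\<exists>l. (deriv ^^ l) f z \<noteq> 0")
  case False
  then show ?thesis by (simp add: vanishes_to_order_def)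
next
  case True
  define l0 where "l0 = (LEAST l. (deriv ^^ l) f z \<noteq> 0)"
  have l0: "(deriv ^^ l0) f z \<noteq> 0" unfolding l0_def using True by (rule LeastI_ex)
  have less: "(deriv ^^ l) f z = 0" if "l < l0" for l
    using not_less_Least that unfolding l0_def by blast
  have "\<not> (\<forall>\<^sub>F w in nhds z. f w = 0)"
  proof
    assume "\<forall>\<^sub>F w in nhds z. f w = 0"
    then have "(deriv ^^ l0) f z = (deriv ^^ l0) (\<lambda>_. 0) z"
      by (intro higher_deriv_cong_ev) auto
    with l0 show False by simp
  qed
  then have "zorder f z \<ge> int m" using assms by (auto simp: zeros_mult_ge_def)
  moreover have "zorder f z = int l0"
    by (rule zorder_zero_eqI[OF hol D z(1)]) (use l0 less in auto)
  ultimately show ?thesis using less by (auto simp: vanishes_to_order_def)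
qed

text \<open>The Taylor series starts at degree \<open>d\<close>, and Cauchy's inequality bounds its
  n-th term by B q^n. As q <= 1/2, the geometric tail costs only a factor 2.\<close>

lemma vanishing_bound:
  assumes hol: "f holomorphic_on S" and S: "cball a r \<subseteq> S" and r: "r > 0"
    and B: "\<And>w. w \<in> cball a r \<Longrightarrow> cmod (f w) \<le> B"
    and van: "vanishes_to_order f a d" and w: "cmod (w - a) \<le> r / 2"
  shows "cmod (f w) \<le> 2 * B * (cmod (w - a) / r) ^ d"
proof -
  define q where "q = cmod (w - a) / r"
  have q: "0 \<le> q" "q \<le> 1 / 2" using w r by (auto simp: q_def field_simps)
  have B0: "B \<ge> 0" using B[of a] r by (smt (verit) centre_in_cball norm_ge_zero)
  have holb: "f holomorphic_on ball a r" using hol S by (meson ball_subset_cball holomorphic_on_subset subset_trans)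
  have cont: "continuous_on (cball a r) f" using hol S by (meson holomorphic_on_imp_continuous_on holomorphic_on_subset)
  define T where "T n = (deriv ^^ n) f a / fact n * (w - a) ^ n" for n
  have "w \<in> ball a r" using w r by (simp add: dist_norm norm_minus_commute)
  then have sT: "T sums f w" unfolding T_def by (rule holomorphic_power_series[OF holb])
  have T0: "T n = 0" if "n < d" for n using van that by (simp add: T_def vanishes_to_order_def)
  have "(\<lambda>n. T (n + d)) sums (f w - (\<Sum>i<d. T i))" using sT by (simp add: sums_iff_shift')
  then have sT': "(\<lambda>n. T (n + d)) sums f w" using T0 by simp
  have bT: "cmod (T (n + d)) \<le> B * q ^ d * q ^ n" for n
  proof -
    have "cmod ((deriv ^^ (n + d)) f a) \<le> fact (n + d) * B / r ^ (n + d)"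
      by (rule Cauchy_inequality[OF holb cont r]) (use B in \<open>auto simp: dist_norm\<close>)
    then have "cmod ((deriv ^^ (n + d)) f a) / fact (n + d) \<le> B / r ^ (n + d)"
      by (simp add: field_simps)
    then have "cmod ((deriv ^^ (n + d)) f a) / fact (n + d) * cmod (w - a) ^ (n + d) \<le> B / r ^ (n + d) * cmod (w - a) ^ (n + d)"
      by (intro mult_right_mono) auto
    then show ?thesis
      by (simp add: T_def norm_mult norm_divide norm_power q_def power_divide power_add field_simps)
  qed
  have geo: "(\<lambda>n. B * q ^ d * q ^ n) sums (B * q ^ d * (1 / (1 - q)))"
    using q by (intro sums_mult geometric_sums) auto
  have "cmod (f w) \<le> B * q ^ d * (1 / (1 - q))"
    using norm_sums_le[OF sT' geo bT] .
  also have "\<dots> \<le> B * q ^ d * 2"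
    using q B0 by (intro mult_left_mono) (auto simp: field_simps)
  finally show ?thesis by (simp add: q_def mult_ac)
qed

lemma higher_deriv_rescale:
  assumes hol: "f holomorphic_on T" and T: "open T" and x: "u * x + z \<in> T"
  shows "(deriv ^^ n) (\<lambda>w. c * f (u * w + z)) x = c * u ^ n * (deriv ^^ n) f (u * x + z)"
proof -
  define S where "S = (\<lambda>w. u * w + z) -` T"
  have S: "open S" unfolding S_def
    by (intro open_vimage T continuous_intros)
  have xS: "x \<in> S" and ST: "\<And>w. w \<in> S \<Longrightarrow> u * w + z \<in> T" using x by (auto simp: S_def)
  have "(\<lambda>w. f (u * w + z)) holomorphic_on S"
    by (rule holomorphic_on_compose_gen[OF _ hol, unfolded o_def])
       (use ST in \<open>auto intro!: holomorphic_intros\<close>)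
  then have "(deriv ^^ n) (\<lambda>w. c * f (u * w + z)) x = c * (deriv ^^ n) (\<lambda>w. f (u * w + z)) x"
    using S xS by (intro higher_deriv_cmult) auto
  also have "(deriv ^^ n) (\<lambda>w. f (u * w + z)) x = u ^ n * (deriv ^^ n) f (u * x + z)"
    by (rule higher_deriv_compose_linear'[OF hol S T xS ST])
  finally show ?thesis by simp
qed

section \<open>Derivative bounds near multiple zeros and the scale-invariant density\<close>

lemma ln_power_small:
  fixes c :: real
  assumes "c > 0"
  obtains \<tau> where "\<tau> > 0" "\<And>t. 0 < t \<Longrightarrow> t < \<tau> \<Longrightarrow> t * (- ln t) ^ k \<le> c"
proof -
  have "((\<lambda>x::real. x ^ k / exp x) \<longlongrightarrow> 0) at_top" by (rule tendsto_power_div_exp_0)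
  then have "eventually (\<lambda>x::real. x ^ k / exp x < c) at_top"
    using assms by (rule order_tendstoD)
  then obtain X where X: "\<And>x::real. x \<ge> X \<Longrightarrow> x ^ k / exp x < c"
    by (auto simp: eventually_at_top_linorder)
  have "t * (- ln t) ^ k \<le> c" if t: "0 < t" "t < exp (- X)" for t
  proof -
    have "ln t < - X" using t by (metis exp_less_cancel_iff exp_ln)
    then have "(- ln t) ^ k / exp (- ln t) < c" by (intro X) simp
    moreover have "exp (- ln t) = 1 / t" using t by (simp add: exp_minus inverse_eq_divide)
    ultimately show ?thesis by (simp add: mult.commute)
  qed
  then show ?thesis by (intro that[of "exp (- X)"]) auto
qed

text \<open>By \<open>vanishing_bound\<close> a zero of order \<open>d\<close> cannot be closer to \<open>z\<close> than about
  \<open>t = \<bar>f z\<bar> ^ (1/d)\<close>, and \<open>nonvanishing_deriv_le\<close> on the zero-free disc gives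
  \<open>\<bar>f' z\<bar> \<le> 4 d t ^ (d - 1) ln (1/t)\<close>; since \<open>k < d\<close> this beats \<open>\<bar>f z\<bar> ^ (1 - 1/k)\<close>.\<close>
lemma small_deriv_bound_unit:
  assumes k: "0 < k" "k < d"
  obtains \<epsilon> :: real where "\<epsilon> > 0"
    "\<And>f z. f holomorphic_on ball z 2 \<Longrightarrow> (\<And>w. w \<in> ball z 2 \<Longrightarrow> cmod (f w) < \<epsilon>) \<Longrightarrow>
       (\<And>w. w \<in> ball z 2 \<Longrightarrow> f w = 0 \<Longrightarrow> vanishes_to_order f w d) \<Longrightarrow> f z \<noteq> 0 \<Longrightarrow>
       cmod (deriv f z) ^ k \<le> cmod (f z) ^ (k - 1)"
proof -
  have d: "d > 0" using k by simp
  \<comment> \<open>Cancels the factor (4 d)^k that arises below: 2 / (t / 2) = 4 / t from the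
    radius, and d from ln s = d ln t.\<close>
  define c where "c = 1 / (4 * real d) ^ k"
  have c: "c > 0" using d by (simp add: c_def)
  obtain \<tau> where \<tau>: "\<tau> > 0" "\<And>t. 0 < t \<Longrightarrow> t < \<tau> \<Longrightarrow> t * (- ln t) ^ k \<le> c"
    using ln_power_small[OF c] by blast
  \<comment> \<open>The power \<open>d\<close> makes |f z| < \<open>\<epsilon>\<close> put the root
    t below both 1 and \<open>\<tau>\<close>.\<close>
  define \<epsilon> where "\<epsilon> = min 1 \<tau> ^ d"
  have e: "\<epsilon> > 0" "\<epsilon> \<le> 1" using \<tau>(1) by (auto simp: \<epsilon>_def power_le_one)
  show ?thesis
  proof (rule that[OF e(1)])
    fix f z
    assume hol: "f holomorphic_on ball z 2" and small: "\<And>w. w \<in> ball z 2 \<Longrightarrow> cmod (f w) < \<epsilon>"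
      and van: "\<And>w. w \<in> ball z 2 \<Longrightarrow> f w = 0 \<Longrightarrow> vanishes_to_order f w d" and fz: "f z \<noteq> 0"
    define s where "s = cmod (f z)"
    define t where "t = root d s"
    have s: "0 < s" "s < \<epsilon>" using fz small[of z] by (auto simp: s_def)
    have t0: "0 < t" using s d by (simp add: t_def)
    have td: "t ^ d = s" using s d by (simp add: t_def)
    have "t ^ d < min 1 \<tau> ^ d" using s td by (simp add: \<epsilon>_def)
    then have t1: "t < 1" "t < \<tau>" using power_less_imp_less_base[of t d "min 1 \<tau>"] \<tau>(1) by auto
    have nz: "f a \<noteq> 0" if a: "a \<in> ball z (t / 2)" for a
    proof
      assume fa: "f a = 0"
      have az: "cmod (z - a) < t / 2" using a by (simp add: dist_norm)
      have sub: "cball a 1 \<subseteq> ball z 2"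
      proof
        fix w assume "w \<in> cball a 1"
        then have "dist z w < 2" using az t1 dist_triangle[of z w a] by (simp add: dist_norm)
        then show "w \<in> ball z 2" by simp
      qed
      have a2: "a \<in> ball z 2" using subsetD[OF sub, of a] by simp
      have "cmod (f z) \<le> 2 * 1 * (cmod (z - a) / 1) ^ d"
      proof (rule vanishing_bound[OF hol sub])
        show "vanishes_to_order f a d" using van[OF a2 fa] .
        show "cmod (f w) \<le> 1" if "w \<in> cball a 1" for w using small[of w] sub that e by force
        show "cmod (z - a) \<le> 1 / 2" using az t1 by simp
      qed simp
      then have "s \<le> 2 * cmod (z - a) ^ d" by (simp add: s_def)
      also have "\<dots> < 2 * (t / 2) ^ d" using az d by (simp add: power_strict_mono)
      also have "\<dots> \<le> 2 * (t ^ d / 2)"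
        using d t0 power_increasing[of 1 d "2::real"] by (simp add: power_divide field_simps)
      finally show False using td by simp
    qed
    have "cmod (deriv f z) \<le> 2 / (t / 2) * cmod (f z) * - ln (cmod (f z))"
    proof (rule nonvanishing_deriv_le)
      have sub: "ball z (t / 2) \<subseteq> ball z 2" using t1 by (intro subset_ball) simp
      then show "f holomorphic_on ball z (t / 2)" using hol holomorphic_on_subset by blast
      show "cmod (f w) < 1" if "w \<in> ball z (t / 2)" for w using small[of w] that sub e by force
    qed (use nz t0 in auto)
    also have "\<dots> = 4 * real d * (t ^ (d - 1) * - ln t)"
    proof -
      have "ln s = real d * ln t" using t0 td by (metis ln_realpow)
      moreover have "s = t * t ^ (d - 1)" using td d by (metis power_minus_mult mult.commute)
      ultimately show ?thesis using t0 by (simp add: s_def[symmetric])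
    qed
    finally have "cmod (deriv f z) ^ k \<le> (4 * real d * (t ^ (d - 1) * - ln t)) ^ k"
      by (intro power_mono) auto
    also have "\<dots> = (4 * real d) ^ k * (t ^ ((d - 1) * k) * (- ln t) ^ k)"
      by (simp only: power_mult_distrib power_mult)
    \<comment> \<open>The first factor is the target s^(k - 1); the other has exponent d - k >= 1,
      so at least one power of t is left to absorb the logarithms.\<close>
    also have "t ^ ((d - 1) * k) = t ^ (d * (k - 1)) * t ^ (d - k)"
    proof -
      have "(d - 1) * k = d * (k - 1) + (d - k)"
        using k by (cases d; cases k) (auto simp: algebra_simps)
      then show ?thesis by (simp add: power_add)
    qed
    also have "(4 * real d) ^ k * (t ^ (d * (k - 1)) * t ^ (d - k) * (- ln t) ^ k)
        \<le> (4 * real d) ^ k * (t ^ (d * (k - 1)) * t * (- ln t) ^ k)"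
    proof -
      have "t ^ (d - k) \<le> t ^ 1" using t0 t1 k by (intro power_decreasing) auto
      moreover have "- ln t \<ge> 0" using t0 t1 by simp
      ultimately show ?thesis using t0 by (intro mult_left_mono mult_right_mono) auto
    qed
    also have "\<dots> = t ^ (d * (k - 1)) * ((4 * real d) ^ k * (t * (- ln t) ^ k))" by (simp add: mult_ac)
    also have "\<dots> \<le> t ^ (d * (k - 1)) * ((4 * real d) ^ k * c)"
      using \<tau>(2)[OF t0 t1(2)] t0 by (intro mult_left_mono) auto
    also have "\<dots> = s ^ (k - 1)" using d td by (simp add: c_def power_mult)
    finally show "cmod (deriv f z) ^ k \<le> cmod (f z) ^ (k - 1)" by (simp add: s_def)
  qed
qed

text \<open>Passing from f to f(\<delta> w + z) / \<delta>^k multiplies both |f'|^k and |f|^(k - 1)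
  by \<delta>^(- k (k - 1)). The inequality is therefore invariant, and the unit case suffices; the
  smallness condition carries \<delta>^k for the same reason.\<close>

lemma small_deriv_bound:
  assumes k: "0 < k" "k < d"
  obtains \<epsilon> :: real where "\<epsilon> > 0"
    "\<And>f z \<delta>. \<delta> > 0 \<Longrightarrow> f holomorphic_on ball z (2 * \<delta>) \<Longrightarrow>
       (\<And>w. w \<in> ball z (2 * \<delta>) \<Longrightarrow> cmod (f w) < \<epsilon> * \<delta> ^ k) \<Longrightarrow>
       (\<And>w. w \<in> ball z (2 * \<delta>) \<Longrightarrow> f w = 0 \<Longrightarrow> vanishes_to_order f w d) \<Longrightarrow> f z \<noteq> 0 \<Longrightarrow>
       cmod (deriv f z) ^ k \<le> cmod (f z) ^ (k - 1)"
proof -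
  obtain \<epsilon> :: real where e: "\<epsilon> > 0"
    "\<And>f z. f holomorphic_on ball z 2 \<Longrightarrow> (\<And>w. w \<in> ball z 2 \<Longrightarrow> cmod (f w) < \<epsilon>) \<Longrightarrow>
       (\<And>w. w \<in> ball z 2 \<Longrightarrow> f w = 0 \<Longrightarrow> vanishes_to_order f w d) \<Longrightarrow> f z \<noteq> 0 \<Longrightarrow>
       cmod (deriv f z) ^ k \<le> cmod (f z) ^ (k - 1)"
    using small_deriv_bound_unit[OF k] by blast
  show ?thesis
  proof (rule that[OF e(1)])
    fix f z and \<delta> :: real
    assume \<delta>: "\<delta> > 0" and hol: "f holomorphic_on ball z (2 * \<delta>)"
      and small: "\<And>w. w \<in> ball z (2 * \<delta>) \<Longrightarrow> cmod (f w) < \<epsilon> * \<delta> ^ k"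
      and van: "\<And>w. w \<in> ball z (2 * \<delta>) \<Longrightarrow> f w = 0 \<Longrightarrow> vanishes_to_order f w d" and fz: "f z \<noteq> 0"
    define c where "c = complex_of_real (1 / \<delta> ^ k)"
    define g where "g = (\<lambda>\<zeta>. c * f (of_real \<delta> * \<zeta> + z))"
    have c: "c \<noteq> 0" "cmod c = 1 / \<delta> ^ k" using \<delta> by (auto simp: c_def norm_divide norm_power)
    have inb: "of_real \<delta> * \<zeta> + z \<in> ball z (2 * \<delta>)" if "\<zeta> \<in> ball 0 2" for \<zeta>
      using that \<delta> by (simp add: dist_norm norm_mult)
    have hd: "(deriv ^^ n) g x = c * of_real \<delta> ^ n * (deriv ^^ n) f (of_real \<delta> * x + z)"
      if "x \<in> ball 0 2" for n x
      unfolding g_def by (rule higher_deriv_rescale[OF hol open_ball inb[OF that]])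
    have "cmod (deriv g 0) ^ k \<le> cmod (g 0) ^ (k - 1)"
    proof (rule e(2))
      show "g holomorphic_on ball 0 2" unfolding g_def
        by (intro holomorphic_intros holomorphic_on_compose_gen[OF _ hol, unfolded o_def])
           (use inb in auto)
      show "cmod (g w) < \<epsilon>" if "w \<in> ball 0 2" for w
        using small[OF inb[OF that]] \<delta> by (simp add: g_def norm_mult c field_simps)
      show "vanishes_to_order g w d" if "w \<in> ball 0 2" "g w = 0" for w
        using van[OF inb[OF that(1)]] that c unfolding vanishes_to_order_def
        by (auto simp: hd[OF that(1)]) (auto simp: g_def)
      show "g 0 \<noteq> 0" using fz c by (simp add: g_def)
    qed
    moreover have "deriv g 0 = c * of_real \<delta> * deriv f z" using hd[of 0 1] by simp
    ultimately have "(\<delta> / \<delta> ^ k * cmod (deriv f z)) ^ k \<le> (cmod (f z) / \<delta> ^ k) ^ (k - 1)"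
      using c \<delta> by (simp add: g_def norm_mult)
    then have "(\<delta> / \<delta> ^ k) ^ k * cmod (deriv f z) ^ k \<le> cmod (f z) ^ (k - 1) / (\<delta> ^ k) ^ (k - 1)"
      by (simp add: power_mult_distrib power_divide)
    moreover have "(\<delta> / \<delta> ^ k) ^ k = 1 / (\<delta> ^ k) ^ (k - 1)"
      using k \<delta> by (cases k) (auto simp: power_divide power_mult_distrib field_simps)
    ultimately show "cmod (deriv f z) ^ k \<le> cmod (f z) ^ (k - 1)"
      using \<delta> by (simp add: field_simps)
  qed
qed

text \<open>Division by zero makes the density vanish at the zeros of \<open>f\<close>; if these have multiplicity above \<open>k\<close>
  it also vanishes near them, so that it is continuous there.\<close>
definition scale_density :: "nat \<Rightarrow> (complex \<Rightarrow> complex) \<Rightarrow> complex \<Rightarrow> real" where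
  "scale_density k f z = max 0 ((cmod (deriv f z) ^ k - cmod (f z) ^ (k - 1)) / cmod (f z) ^ (2 * k))"

lemma scale_density_nonneg: "scale_density k f z \<ge> 0"
  by (simp add: scale_density_def)

lemma scale_density_zero: "k > 0 \<Longrightarrow> f z = 0 \<Longrightarrow> scale_density k f z = 0"
  by (simp add: scale_density_def power_0_left)

text \<open>With phi = f^(1/k) the rescaling is phi(\<rho> w + z) / \<rho>: phi' keeps its size
  while |phi|^(k (k + 1)) in the denominator is divided by \<rho>^(k (k + 1)).\<close>

lemma scale_density_rescale:
  assumes hol: "f holomorphic_on T" and T: "open T" and x: "of_real \<rho> * x + z \<in> T"
    and \<rho>: "\<rho> > 0" and k: "k > 0"
  shows "scale_density k (\<lambda>\<zeta>. of_real (1 / \<rho> ^ k) * f (of_real \<rho> * \<zeta> + z)) x =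
     \<rho> ^ (k * (k + 1)) * scale_density k f (of_real \<rho> * x + z)"
proof -
  let ?w = "of_real \<rho> * x + z"
  let ?g = "\<lambda>\<zeta>. of_real (1 / \<rho> ^ k) * f (of_real \<rho> * \<zeta> + z)"
  obtain j where j: "k = Suc j" using k by (cases k) auto
  have d: "deriv ?g x = of_real (1 / \<rho> ^ k) * of_real \<rho> * deriv f ?w"
    using higher_deriv_rescale[OF hol T x, of 1 "of_real (1 / \<rho> ^ k)"] by simp
  define A B where "A = cmod (deriv f ?w)" and "B = cmod (f ?w)"
  have nd: "cmod (deriv ?g x) = A / \<rho> ^ j"
    using \<rho> by (simp only: d norm_mult norm_of_real A_def) (simp add: j field_simps)
  have ng: "cmod (?g x) = B / \<rho> ^ k"
    using \<rho> by (simp only: norm_mult norm_of_real B_def) simp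
  define X Y where "X = \<rho> ^ (j * k)" and "Y = \<rho> ^ (k * (2 * k))"
  have XY: "(A / \<rho> ^ j) ^ k = A ^ k / X" "(B / \<rho> ^ k) ^ (k - 1) = B ^ j / X"
    "(B / \<rho> ^ k) ^ (2 * k) = B ^ (2 * k) / Y"
    unfolding X_def Y_def by (simp_all only: power_divide power_mult j diff_Suc_1)
      (simp only: power_mult[symmetric] mult.commute)
  have "(cmod (deriv ?g x) ^ k - cmod (?g x) ^ (k - 1)) / cmod (?g x) ^ (2 * k)
      = (Y / X) * ((A ^ k - B ^ j) / B ^ (2 * k))"
    unfolding nd ng XY by (simp add: diff_divide_distrib[symmetric])
  also have "Y / X = \<rho> ^ (k * (k + 1))"
  proof -
    have e: "k * (2 * k) = k * (k + 1) + j * k" by (simp add: j algebra_simps)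
    show ?thesis unfolding X_def Y_def e power_add[of _ "k * (k + 1)" "j * k"] using \<rho> by simp
  qed
  finally have eq: "(cmod (deriv ?g x) ^ k - cmod (?g x) ^ (k - 1)) / cmod (?g x) ^ (2 * k)
      = \<rho> ^ (k * (k + 1)) * ((A ^ k - B ^ (k - 1)) / B ^ (2 * k))" by (simp add: j)
  have mx: "max 0 (\<rho> ^ (k * (k + 1)) * X) = \<rho> ^ (k * (k + 1)) * max 0 X" for X :: real
    using less_imp_le[OF zero_less_power[OF \<rho>]] by (simp only: max_mult_distrib_left) simp
  show ?thesis unfolding scale_density_def eq mx by (simp only: A_def B_def)
qed

text \<open>At a zero of f the density is 0 by convention and carries no information, hence the
  separate assumption there. Elsewhere it says |f'|^k <= |f|^(k - 1) + C |f|^(2 k); both powers are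
  at most (1 + |f|^2)^k, and a \<open>k\<close>-th root is taken.\<close>

lemma scale_density_bound:
  assumes C: "scale_density k f z \<le> C" and k: "k > 0" and z: "f z = 0 \<Longrightarrow> deriv f z = 0"
  shows "cmod (deriv f z) \<le> (1 + C) * (1 + (cmod (f z))\<^sup>2)"
proof -
  have C0: "C \<ge> 0" using C scale_density_nonneg[of k f z] by simp
  show ?thesis
  proof (cases "f z = 0")
    case True
    then show ?thesis using z C0 by simp
  next
    case False
    define s where "s = cmod (f z)"
    have s: "s > 0" using False by (simp add: s_def)
    have s1: "s \<le> 1 + s\<^sup>2" "s\<^sup>2 \<le> 1 + s\<^sup>2" "1 \<le> 1 + s\<^sup>2"
      using zero_le_power2[of "s - 1"] s unfolding power2_diff by auto
    have "(cmod (deriv f z) ^ k - s ^ (k - 1)) / s ^ (2 * k) \<le> C"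
      using C by (simp add: scale_density_def s_def)
    then have "cmod (deriv f z) ^ k \<le> s ^ (k - 1) + C * s ^ (2 * k)"
      using s by (simp add: field_simps)
    also have "\<dots> \<le> (1 + s\<^sup>2) ^ k + C * (1 + s\<^sup>2) ^ k"
    proof (intro add_mono mult_left_mono C0)
      have "s ^ (k - 1) \<le> (1 + s\<^sup>2) ^ (k - 1)" using s s1 by (intro power_mono) auto
      also have "\<dots> \<le> (1 + s\<^sup>2) ^ k" using s1 by (intro power_increasing) auto
      finally show "s ^ (k - 1) \<le> (1 + s\<^sup>2) ^ k" .
      show "s ^ (2 * k) \<le> (1 + s\<^sup>2) ^ k" unfolding power_mult using s1 by (intro power_mono) auto
    qed
    also have "\<dots> = (1 + C) ^ 1 * (1 + s\<^sup>2) ^ k" by (simp add: algebra_simps)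
    also have "\<dots> \<le> (1 + C) ^ k * (1 + s\<^sup>2) ^ k"
      using C0 k s1 by (intro mult_right_mono power_increasing) auto
    also have "\<dots> = ((1 + C) * (1 + s\<^sup>2)) ^ k" by (simp add: power_mult_distrib)
    finally have "cmod (deriv f z) ^ k \<le> ((1 + C) * (1 + s\<^sup>2)) ^ k" .
    moreover have "0 \<le> (1 + C) * (1 + s\<^sup>2)" using C0 s1 by simp
    ultimately have "cmod (deriv f z) \<le> (1 + C) * (1 + s\<^sup>2)"
      using k power_mono_iff[of "cmod (deriv f z)" "(1 + C) * (1 + s\<^sup>2)" k] by simp
    then show ?thesis by (simp add: s_def)
  qed
qed

text \<open>Only zeros are in question. At distance \<delta> from a zero \<open>a\<close>, f is
  O(\<delta>^d) on \<open>ball z (2 * \<delta>)\<close>, which is below \<epsilon> \<delta>^k for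
  small \<delta> because d > k. Then \<open>small_deriv_bound\<close> makes the numerator
  non-positive, so the truncated density is 0 on a whole neighbourhood of \<open>a\<close>.\<close>

lemma continuous_on_scale_density:
  assumes D: "open D" and hol: "f holomorphic_on D" and k: "0 < k" "k < d"
    and van: "\<And>w. w \<in> D \<Longrightarrow> f w = 0 \<Longrightarrow> vanishes_to_order f w d"
  shows "continuous_on D (scale_density k f)"
proof -
  have contf: "continuous_on D f" and contd: "continuous_on D (deriv f)"
    using hol D by (auto intro!: holomorphic_on_imp_continuous_on holomorphic_deriv)
  have "isCont (scale_density k f) a" if a: "a \<in> D" for a
  proof (cases "f a = 0")
    case False
    have "isCont f a" "isCont (deriv f) a" using contf contd a D by (auto simp: continuous_on_eq_continuous_at)
    then show ?thesis unfolding scale_density_def[abs_def]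
      using False by (intro continuous_intros) auto
  next
    case True
    obtain r where r: "r > 0" "cball a r \<subseteq> D" using D a by (meson open_contains_cball)
    have "compact (f ` cball a r)"
      using contf r by (intro compact_continuous_image) (auto intro: continuous_on_subset)
    then obtain B where B: "B > 0" "\<And>w. w \<in> cball a r \<Longrightarrow> cmod (f w) \<le> B"
      using compact_imp_bounded bounded_pos by (metis imageI)
    obtain \<epsilon> :: real where e: "\<epsilon> > 0"
      "\<And>f z \<delta>. \<delta> > 0 \<Longrightarrow> f holomorphic_on ball z (2 * \<delta>) \<Longrightarrow>
       (\<And>w. w \<in> ball z (2 * \<delta>) \<Longrightarrow> cmod (f w) < \<epsilon> * \<delta> ^ k) \<Longrightarrow>
       (\<And>w. w \<in> ball z (2 * \<delta>) \<Longrightarrow> f w = 0 \<Longrightarrow> vanishes_to_order f w d) \<Longrightarrow> f z \<noteq> 0 \<Longrightarrow>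
       cmod (deriv f z) ^ k \<le> cmod (f z) ^ (k - 1)"
      using small_deriv_bound[OF k] by blast
    \<comment> \<open>The constant of \<open>vanishing_bound\<close> at distance at most 3 \<delta>,
      the farthest that points of \<open>ball z (2 * \<delta>)\<close> lie from
      \<open>a\<close>.\<close>
    define A where "A = 2 * B * (3 / r) ^ d"
    have A: "A > 0" using B r by (simp add: A_def)
    define \<delta>0 where "\<delta>0 = min (min 1 (r / 6)) (\<epsilon> / (2 * A))"
    have \<delta>0: "\<delta>0 > 0" "\<delta>0 \<le> 1" "\<delta>0 \<le> r / 6" "A * \<delta>0 < \<epsilon>"
    proof -
      show "\<delta>0 > 0" "\<delta>0 \<le> 1" "\<delta>0 \<le> r / 6" using r e A by (auto simp: \<delta>0_def)
      have "A * \<delta>0 \<le> A * (\<epsilon> / (2 * A))" using A by (intro mult_left_mono) (auto simp: \<delta>0_def)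
      also have "\<dots> < \<epsilon>" using A e by simp
      finally show "A * \<delta>0 < \<epsilon>" .
    qed
    have zero: "scale_density k f z = 0" if z: "z \<in> ball a \<delta>0" for z
    proof (cases "f z = 0")
      case True
      then show ?thesis using k scale_density_zero by blast
    next
      case False
      define \<delta> where "\<delta> = dist a z"
      have d0: "\<delta> > 0" "\<delta> < \<delta>0" using z False \<open>f a = 0\<close> by (auto simp: \<delta>_def)
      have near: "cmod (w - a) \<le> 3 * \<delta>" if "w \<in> ball z (2 * \<delta>)" for w
      proof -
        have "dist z w < 2 * \<delta>" using that by simp
        then have "dist a w \<le> 3 * \<delta>" using dist_triangle[of a w z] by (simp add: \<delta>_def)
        then show ?thesis by (simp add: dist_norm norm_minus_commute)
      qed
      have sub: "ball z (2 * \<delta>) \<subseteq> cball a r"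
        using near d0 \<delta>0 by (fastforce simp: dist_norm norm_minus_commute)
      have "cmod (deriv f z) ^ k \<le> cmod (f z) ^ (k - 1)"
      proof (rule e(2)[OF d0(1)])
        show "f holomorphic_on ball z (2 * \<delta>)" using hol sub r by (meson holomorphic_on_subset)
        show "vanishes_to_order f w d" if "w \<in> ball z (2 * \<delta>)" "f w = 0" for w
          using van that sub r by blast
        show "cmod (f w) < \<epsilon> * \<delta> ^ k" if w: "w \<in> ball z (2 * \<delta>)" for w
        proof -
          have "cmod (f w) \<le> 2 * B * (cmod (w - a) / r) ^ d"
          proof (rule vanishing_bound[OF hol r(2,1) B(2) van[OF a True]])
            show "cmod (w - a) \<le> r / 2" using near[OF w] d0 \<delta>0 by linarith
          qed auto
          also have "\<dots> \<le> 2 * B * (3 * \<delta> / r) ^ d"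
            using B near[OF w] r by (intro mult_left_mono power_mono divide_right_mono) auto
          also have "\<dots> = A * \<delta> ^ d" by (simp add: A_def power_mult_distrib power_divide)
          also have "\<dots> = A * \<delta> ^ (d - k) * \<delta> ^ k" using k by (simp flip: power_add)
          also have "\<dots> \<le> A * \<delta> ^ 1 * \<delta> ^ k"
            using A d0 \<delta>0 k by (intro mult_right_mono mult_left_mono power_decreasing) auto
          also have "\<dots> < \<epsilon> * \<delta> ^ k"
          proof (intro mult_strict_right_mono)
            have "A * \<delta> < A * \<delta>0" using A d0 by simp
            then show "A * \<delta> ^ 1 < \<epsilon>" using \<delta>0 by simp
          qed (use d0 in simp)
          finally show ?thesis .
        qed
      qed fact
      then show ?thesis by (simp add: scale_density_def divide_nonpos_nonneg)
    qed
    have "\<forall>\<^sub>F z in nhds a. z \<in> ball a \<delta>0" using \<delta>0 by (intro eventually_nhds_in_open) auto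
    then have "\<forall>\<^sub>F z in nhds a. scale_density k f z = 0" by eventually_elim (rule zero)
    then have "isCont (scale_density k f) a \<longleftrightarrow> isCont (\<lambda>_. 0 :: real) a"
      by (rule isCont_cong)
    then show ?thesis by simp
  qed
  then show ?thesis using D by (simp add: continuous_on_eq_continuous_at)
qed

text \<open>Marty's criterion; \<open>spherical_harnack\<close> makes \<open>ln \<bar>h j\<bar>\<close> at nearby points comparable, so
  that boundedness and divergence to infinity each propagate through the connected set \<open>D\<close>.\<close>
lemma spherical_normal:
  fixes h :: "nat \<Rightarrow> complex \<Rightarrow> complex"
  assumes D: "open D" "connected D" "D \<noteq> {}" and hol: "\<And>j. h j holomorphic_on D"
    and sph: "\<And>z0. z0 \<in> D \<Longrightarrow> \<exists>r C. r > 0 \<and> ball z0 r \<subseteq> D \<and>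
       (\<forall>j. \<forall>z\<in>ball z0 r. cmod (deriv (h j) z) \<le> C * (1 + (cmod (h j z))\<^sup>2))"
  shows "\<exists>r. strict_mono r \<and>
           ((\<exists>g. g holomorphic_on D \<and>
               (\<forall>K. compact K \<longrightarrow> K \<subseteq> D \<longrightarrow> uniform_limit K (h \<circ> r) g sequentially)) \<or>
            (\<forall>K B. compact K \<longrightarrow> K \<subseteq> D \<longrightarrow> (\<forall>\<^sub>F j in sequentially. \<forall>z\<in>K. cmod (h (r j) z) > B)))"
proof -
  \<comment> \<open>The positive part of log |h j|: unlike the logarithm it stays finite and
    continuous at zeros, and it is bounded or divergent together with |h j|.\<close>
  define l where "l j z = max 0 (ln (cmod (h j z)))" for j z
  have l0: "l j z \<ge> 0" for j z by (simp add: l_def)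
  have lD: "cmod (h j z) \<le> exp (l j z)" for j z
  proof (cases "h j z = 0")
    case False
    then have "cmod (h j z) = exp (ln (cmod (h j z)))" by simp
    also have "\<dots> \<le> exp (l j z)" unfolding l_def by (subst exp_le_cancel_iff) simp
    finally show ?thesis .
  qed simp
  have lE: "l j z \<le> b" if "cmod (h j z) \<le> exp b" "b \<ge> 0" for j z b
  proof (cases "h j z = 0")
    case False
    then have "ln (cmod (h j z)) \<le> ln (exp b)" using that by (subst ln_le_cancel_iff) auto
    then show ?thesis using that by (simp add: l_def)
  qed (use that in \<open>simp add: l_def\<close>)
  have lF: "exp (l j z) = cmod (h j z)" if "l j z > 0" for j z
    using that by (cases "h j z = 0") (auto simp: l_def max_def split: if_splits)
  \<comment> \<open>The comparison is symmetric in \<open>z\<close> and \<open>w\<close>, so it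
    carries upper bounds and divergence in both directions.\<close>
  have loc: "\<exists>\<delta>>0. ball z0 \<delta> \<subseteq> D \<and> (\<exists>B\<ge>0. \<forall>j. \<forall>z\<in>ball z0 \<delta>. \<forall>w\<in>ball z0 \<delta>. l j z \<le> B + 3 * l j w)"
    if "z0 \<in> D" for z0
  proof -
    obtain r C where r: "r > 0" "ball z0 r \<subseteq> D"
      and C: "\<And>j z. z \<in> ball z0 r \<Longrightarrow> cmod (deriv (h j) z) \<le> C * (1 + (cmod (h j z))\<^sup>2)"
      using sph[OF \<open>z0 \<in> D\<close>] by blast
    have C0: "C \<ge> 0"
    proof (rule ccontr)
      assume "\<not> C \<ge> 0"
      then have "C * (1 + (cmod (h 0 z0))\<^sup>2) < 0" by (intro mult_neg_pos) (auto simp: add_pos_nonneg)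
      with C[of z0 0] r norm_ge_zero[of "deriv (h 0) z0"] show False by simp
    qed
    have "l j z \<le> 4 * C * r + 3 * l j w" if zw: "z \<in> ball z0 (r / 6)" "w \<in> ball z0 (r / 6)" for j z w
    proof -
      \<comment> \<open>The radius r / 6 is chosen so that this disc fits (1/6 + 2/3 < 1) while
        \<open>w\<close>, at distance below r / 3, lies within half its radius, as
        \<open>spherical_harnack\<close> requires.\<close>
      have sub: "ball z (2 * r / 3) \<subseteq> ball z0 r"
      proof
        fix v assume "v \<in> ball z (2 * r / 3)"
        then show "v \<in> ball z0 r" using zw(1) dist_triangle[of z0 v z] r by simp
      qed
      have "cmod (w - z) \<le> 2 * r / 3 / 2"
        using zw dist_triangle[of w z z0] r by (simp add: dist_norm norm_minus_commute)
      moreover have "h j holomorphic_on ball z (2 * r / 3)"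
        using hol sub r by (meson holomorphic_on_subset)
      ultimately have "ln (cmod (h j z)) \<le> 4 * C * (2 * r / 3) \<or> ln (cmod (h j z)) \<le> 3 * ln (cmod (h j w))"
        using spherical_harnack[of "h j" z "2 * r / 3" C] C sub r C0 by (auto simp: subset_iff)
      moreover have "4 * C * (2 * r / 3) \<le> 4 * C * r" using C0 r by (simp add: mult_left_mono)
      moreover have "ln (cmod (h j w)) \<le> l j w" by (simp add: l_def)
      ultimately have "ln (cmod (h j z)) \<le> 4 * C * r \<or> ln (cmod (h j z)) \<le> 3 * l j w" by linarith
      moreover have "0 \<le> 4 * C * r" using C0 r by simp
      ultimately show ?thesis using l0[of j w] unfolding l_def[of j z] by (simp add: max_def) linarith
    qed
    moreover have "ball z0 (r / 6) \<subseteq> D" using subset_trans[OF subset_ball r(2), of "r / 6"] r(1) by simp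
    moreover have "0 \<le> 4 * C * r" using C0 r by simp
    ultimately show ?thesis using r(1)
      by (intro exI[of _ "r / 6"] exI[of _ "4 * C * r"] conjI) auto
  qed
  obtain \<delta> B where \<delta>: "\<And>z. z \<in> D \<Longrightarrow> \<delta> z > 0" "\<And>z. z \<in> D \<Longrightarrow> ball z (\<delta> z) \<subseteq> D"
    and B: "\<And>z. z \<in> D \<Longrightarrow> B z \<ge> 0"
    "\<And>z j u w. z \<in> D \<Longrightarrow> u \<in> ball z (\<delta> z) \<Longrightarrow> w \<in> ball z (\<delta> z) \<Longrightarrow> l j u \<le> B z + 3 * l j w"
  proof -
    define R where "R z \<delta> B \<longleftrightarrow> \<delta> > 0 \<and> ball z \<delta> \<subseteq> D \<and> B \<ge> 0 \<and>
      (\<forall>j. \<forall>u\<in>ball z \<delta>. \<forall>w\<in>ball z \<delta>. l j u \<le> B + 3 * l j w)" for z \<delta> B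
    have "\<forall>z\<in>D. \<exists>\<delta> B. R z \<delta> B" using loc unfolding R_def by blast
    then obtain \<delta> B where "\<And>z. z \<in> D \<Longrightarrow> R z (\<delta> z) (B z)" by metis
    then show ?thesis by (intro that[of \<delta> B]) (simp_all add: R_def)
  qed
  have cov: "\<exists>Z. finite Z \<and> Z \<subseteq> D \<and> K \<subseteq> (\<Union>z\<in>Z. ball z (\<delta> z))" if K: "compact K" "K \<subseteq> D" for K
  proof -
    have "K \<subseteq> (\<Union>z\<in>D. ball z (\<delta> z))"
    proof
      fix x assume "x \<in> K"
      then have "x \<in> D" using K(2) by auto
      with \<delta>(1)[OF this] show "x \<in> (\<Union>z\<in>D. ball z (\<delta> z))" by (intro UN_I[of x]) auto
    qed
    then obtain Z where "Z \<subseteq> D" "finite Z" "K \<subseteq> (\<Union>z\<in>Z. ball z (\<delta> z))"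
      by (rule compactE_image[OF K(1) open_ball])
    then show ?thesis by blast
  qed
  have spread: "\<forall>z\<in>D. P z" if "\<exists>z\<in>D. P z"
    and P: "\<And>z u w. z \<in> D \<Longrightarrow> u \<in> ball z (\<delta> z) \<Longrightarrow> w \<in> ball z (\<delta> z) \<Longrightarrow> P u \<Longrightarrow> P w" for P
    using that(1)
  proof
    fix p assume p: "p \<in> D" "P p"
    show ?thesis
    proof
      fix b assume b: "b \<in> D"
      show "P b"
      proof (rule connected_induction_simple[where P = P, OF D(2) p(1) b p(2)])
        fix a assume a: "a \<in> D"
        show "\<exists>T. openin (top_of_set D) T \<and> a \<in> T \<and> (\<forall>x\<in>T. \<forall>y\<in>T. P x \<longrightarrow> P y)"
        proof (intro exI conjI ballI impI)
          show "openin (top_of_set D) (ball a (\<delta> a))"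
            by (rule open_subset[OF \<delta>(2)[OF a] open_ball])
          show "a \<in> ball a (\<delta> a)" using \<delta>(1)[OF a] by simp
          show "P y" if "x \<in> ball a (\<delta> a)" "y \<in> ball a (\<delta> a)" "P x" for x y
            using P[OF a that] .
        qed
      qed
    qed
  qed
  obtain p where p: "p \<in> D" using D by blast
  show ?thesis
  proof (cases "filterlim (\<lambda>j. l j p) at_top sequentially")
    case True
    have all: "\<forall>z\<in>D. filterlim (\<lambda>j. l j z) at_top sequentially"
    proof (rule spread)
      show "\<exists>z\<in>D. filterlim (\<lambda>j. l j z) at_top sequentially" using True p by blast
      fix z u w assume z: "z \<in> D" "u \<in> ball z (\<delta> z)" "w \<in> ball z (\<delta> z)"
        and u: "filterlim (\<lambda>j. l j u) at_top sequentially"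
      show "filterlim (\<lambda>j. l j w) at_top sequentially"
        unfolding filterlim_at_top
      proof
        fix Y
        have "\<forall>\<^sub>F j in sequentially. B z + 3 * Y \<le> l j u"
          using u unfolding filterlim_at_top by blast
        then show "\<forall>\<^sub>F j in sequentially. Y \<le> l j w"
          by eventually_elim (use B(2)[OF z] in \<open>smt (verit)\<close>)
      qed
    qed
    have "\<forall>\<^sub>F j in sequentially. \<forall>z\<in>K. cmod (h j z) > b" if K: "compact K" "K \<subseteq> D" for K b
    proof -
      obtain Z where Z: "finite Z" "Z \<subseteq> D" "K \<subseteq> (\<Union>z\<in>Z. ball z (\<delta> z))" using cov[OF K] by blast
      \<comment> \<open>At least 1, so that \<open>l j w > Y\<close> is positive and therefore
        equals the logarithm of |h j w|.\<close>
      define Y where "Y = max b 1"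
      have "\<forall>\<^sub>F j in sequentially. \<forall>z\<in>Z. B z + 3 * Y < l j z"
        using Z all by (intro eventually_ball_finite) (auto simp: filterlim_at_top_dense)
      then show ?thesis
      proof eventually_elim
        case (elim j)
        show ?case
        proof
          fix w assume "w \<in> K"
          then obtain z where z: "z \<in> Z" "w \<in> ball z (\<delta> z)" using Z by blast
          then have zD: "z \<in> D" using Z by auto
          have "l j z \<le> B z + 3 * l j w" using B(2)[OF zD _ z(2)] \<delta>(1)[OF zD] by simp
          with elim z have lw: "l j w > Y" by force
          then have "cmod (h j w) = exp (l j w)" using lF by (simp add: Y_def)
          also have "\<dots> > Y" using lw exp_ge_add_one_self[of "l j w"] by linarith
          finally show "cmod (h j w) > b" by (simp add: Y_def)
        qed
      qed
    qed
    then show ?thesis by (intro exI[of _ id] conjI disjI2) (auto simp: strict_mono_def)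
  next
    case False
    \<comment> \<open>Failure to diverge at the single point \<open>p\<close> yields a subsequence
      bounded at \<open>p\<close>. Connectedness bounds it at every point, finite covers on compact
      sets, and Montel's theorem applies.\<close>
    then obtain Y where "\<not> (\<forall>\<^sub>F j in sequentially. Y \<le> l j p)" unfolding filterlim_at_top by blast
    then have "\<exists>\<^sub>F j in sequentially. l j p < Y" by (simp add: frequently_def not_less)
    then have "infinite {j. l j p < Y}" by (simp add: frequently_sequentially infinite_nat_iff_unbounded_le)
    then obtain r :: "nat \<Rightarrow> nat" where r: "strict_mono r" "\<And>n. l (r n) p < Y"
      using infinite_enumerate[of "{j. l j p < Y}"] by auto
    have all: "\<forall>z\<in>D. \<exists>C. \<forall>j. l (r j) z \<le> C"
    proof (rule spread)
      show "\<exists>z\<in>D. \<exists>C. \<forall>j. l (r j) z \<le> C" using r(2) p less_imp_le by blast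
      fix z u w assume z: "z \<in> D" "u \<in> ball z (\<delta> z)" "w \<in> ball z (\<delta> z)"
        and u: "\<exists>C. \<forall>j. l (r j) u \<le> C"
      then obtain C where C: "\<And>j. l (r j) u \<le> C" by blast
      have "l (r j) w \<le> B z + 3 * C" for j
        using B(2)[OF z(1,3,2), of "r j"] C[of j] by linarith
      then show "\<exists>C. \<forall>j. l (r j) w \<le> C" by blast
    qed
    then obtain C where C: "\<And>z j. z \<in> D \<Longrightarrow> l (r j) z \<le> C z" by metis
    have bdd: "\<exists>b. \<forall>f\<in>range (h \<circ> r). \<forall>z\<in>K. cmod (f z) \<le> b" if K: "compact K" "K \<subseteq> D" for K
    proof -
      obtain Z where Z: "finite Z" "Z \<subseteq> D" "K \<subseteq> (\<Union>z\<in>Z. ball z (\<delta> z))" using cov[OF K] by blast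
      have C0: "C z \<ge> 0" if "z \<in> D" for z using C[OF that, of 0] l0[of "r 0" z] by linarith
      define b where "b = (\<Sum>z\<in>Z. B z + 3 * C z)"
      have "cmod (h (r j) w) \<le> exp b" if "w \<in> K" for j w
      proof -
        obtain z where z: "z \<in> Z" "w \<in> ball z (\<delta> z)" using Z \<open>w \<in> K\<close> by blast
        then have zD: "z \<in> D" using Z by auto
        have "l (r j) w \<le> B z + 3 * l (r j) z" using B(2)[OF zD z(2)] \<delta>(1)[OF zD] by simp
        also have "\<dots> \<le> B z + 3 * C z" using C[OF zD] by simp
        also have "\<dots> \<le> b" unfolding b_def
          using Z z C0 B(1) by (intro member_le_sum) auto
        finally have "exp (l (r j) w) \<le> exp b" by simp
        with lD[of "r j" w] show ?thesis by linarith
      qed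
      then show ?thesis by auto
    qed
    obtain g r' where g: "g holomorphic_on D" "strict_mono (r' :: nat \<Rightarrow> nat)"
      "\<And>x. x \<in> D \<Longrightarrow> ((\<lambda>n. (h \<circ> r) (r' n) x) \<longlongrightarrow> g x) sequentially"
      "\<And>K. \<lbrakk>compact K; K \<subseteq> D\<rbrakk> \<Longrightarrow> uniform_limit K ((h \<circ> r) \<circ> r') g sequentially"
      by (rule Montel[OF D(1), of "range (h \<circ> r)" "h \<circ> r"]) (use hol bdd in \<open>auto 4 3\<close>)
    then show ?thesis using r(1) strict_mono_o[OF r(1) g(2)]
      by (intro exI[of _ "r \<circ> r'"] conjI disjI1) (auto simp: o_assoc)
  qed
qed

subsection \<open>Limits of functions with multiple zeros\<close>

lemma holomorphic_on_ball_uniform_limit: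
  assumes ul: "uniform_limit (ball a R) u v sequentially"
    and hol: "\<And>n. u n holomorphic_on ball a R"
  shows "v holomorphic_on ball a R"
proof (rule holomorphic_uniform_sequence[OF open_ball hol])
  fix x assume "x \<in> ball a R"
  then obtain d where "d > 0" "cball x d \<subseteq> ball a R"
    using open_ball open_contains_cball by blast
  then show "\<exists>d>0. cball x d \<subseteq> ball a R \<and> uniform_limit (cball x d) u v sequentially"
    using uniform_limit_on_subset[OF ul] by blast
qed

text \<open>Cauchy's inequality on discs of radius (R - r) / 2; shrinking the ball makes room for
  them.\<close>

lemma uniform_limit_higher_deriv:
  assumes ul: "uniform_limit (ball a R) u v sequentially"
    and hol: "\<And>n. u n holomorphic_on ball a R" and r: "r < R"
  shows "uniform_limit (ball a r) (\<lambda>n. (deriv ^^ l) (u n)) ((deriv ^^ l) v) sequentially"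
proof (cases "R > 0")
  case False
  then have e: "ball a r = {}" using r by simp
  show ?thesis unfolding e by (simp add: uniform_limit_iff)
next
  case True
  have holv: "v holomorphic_on ball a R" by (rule holomorphic_on_ball_uniform_limit[OF ul hol])
  define s where "s = (R - r) / 2"
  have s: "s > 0" using r by (simp add: s_def)
  show ?thesis
  proof (rule uniform_limitI)
    fix e :: real assume e: "e > 0"
    define e' where "e' = e * s ^ l / (2 * fact l)"
    have e': "e' > 0" using e s by (simp add: e'_def)
    have "\<forall>\<^sub>F n in sequentially. \<forall>x\<in>ball a R. dist (u n x) (v x) < e'"
      using ul e' by (rule uniform_limitD)
    then show "\<forall>\<^sub>F n in sequentially. \<forall>x\<in>ball a r. dist ((deriv ^^ l) (u n) x) ((deriv ^^ l) v x) < e"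
    proof eventually_elim
      case (elim n)
      show ?case
      proof
        fix x assume x: "x \<in> ball a r"
        have sub: "cball x s \<subseteq> ball a R"
        proof
          fix y assume "y \<in> cball x s"
          then show "y \<in> ball a R" using x dist_triangle[of a y x] r by (simp add: s_def field_simps)
        qed
        have xb: "x \<in> ball a R" using sub s by (simp add: subset_iff)
        have h: "(\<lambda>w. u n w - v w) holomorphic_on ball a R" by (intro holomorphic_intros hol holv)
        have "cmod ((deriv ^^ l) (\<lambda>w. u n w - v w) x) \<le> fact l * e' / s ^ l"
        proof (rule Cauchy_inequality)
          show "(\<lambda>w. u n w - v w) holomorphic_on ball x s"
            using h sub ball_subset_cball by (meson holomorphic_on_subset subset_trans)
          show "continuous_on (cball x s) (\<lambda>w. u n w - v w)"
            using holomorphic_on_imp_continuous_on[OF h] sub continuous_on_subset by blast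
          show "cmod (u n y - v y) \<le> e'" if "cmod (x - y) = s" for y
          proof -
            have "y \<in> ball a R" using that sub by (auto simp: dist_norm)
            then show ?thesis using elim by (simp add: dist_norm less_imp_le)
          qed
        qed (rule s)
        also have "(deriv ^^ l) (\<lambda>w. u n w - v w) x = (deriv ^^ l) (u n) x - (deriv ^^ l) v x"
          by (rule higher_deriv_diff[OF hol holv open_ball xb])
        also have "fact l * e' / s ^ l = e / 2" using s by (simp add: e'_def)
        finally show "dist ((deriv ^^ l) (u n) x) ((deriv ^^ l) v x) < e"
          using e by (simp add: dist_norm)
      qed
    qed
  qed
qed

text \<open>If some derivative of order below \<open>m\<close> of the limit were non-zero at \<open>a\<close>, the same derivative of
  \<open>u n\<close> would have no zeros near \<open>a\<close>, so \<open>u n\<close> would have none either, and Hurwitz applies.\<close>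
lemma vanishes_to_order_limit:
  assumes ul: "uniform_limit (ball a R) u v sequentially" and R: "R > 0"
    and hol: "\<And>n. u n holomorphic_on ball a R"
    and van: "\<And>n z. z \<in> ball a R \<Longrightarrow> u n z = 0 \<Longrightarrow> vanishes_to_order (u n) z m"
    and va: "v a = 0"
  shows "vanishes_to_order v a m"
  unfolding vanishes_to_order_def
proof (intro allI impI, rule ccontr)
  fix l assume l: "l < m" and nz: "(deriv ^^ l) v a \<noteq> 0"
  have holv: "v holomorphic_on ball a R" by (rule holomorphic_on_ball_uniform_limit[OF ul hol])
  define c where "c = cmod ((deriv ^^ l) v a)"
  have c: "c > 0" using nz by (simp add: c_def)
  have "(deriv ^^ l) v holomorphic_on ball a R" by (rule holomorphic_higher_deriv[OF holv open_ball])
  then have "isCont ((deriv ^^ l) v) a"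
    using R by (auto simp: holomorphic_on_imp_continuous_on continuous_on_eq_continuous_at
        dest!: holomorphic_on_imp_continuous_on)
  then obtain \<delta> where \<delta>: "\<delta> > 0" "\<And>x. dist x a < \<delta> \<Longrightarrow> dist ((deriv ^^ l) v x) ((deriv ^^ l) v a) < c / 2"
    using c unfolding continuous_at_eps_delta by (metis half_gt_zero)
  define r where "r = min \<delta> (R / 2)"
  have r: "r > 0" "r < R" "r \<le> \<delta>" using \<delta> R by (auto simp: r_def)
  have "uniform_limit (ball a r) (\<lambda>n. (deriv ^^ l) (u n)) ((deriv ^^ l) v) sequentially"
    by (rule uniform_limit_higher_deriv[OF ul hol r(2)])
  then have "\<forall>\<^sub>F n in sequentially. \<forall>x\<in>ball a r. dist ((deriv ^^ l) (u n) x) ((deriv ^^ l) v x) < c / 2"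
    using c by (intro uniform_limitD) auto
  then obtain N where N: "\<And>n x. n \<ge> N \<Longrightarrow> x \<in> ball a r \<Longrightarrow> dist ((deriv ^^ l) (u n) x) ((deriv ^^ l) v x) < c / 2"
    unfolding eventually_sequentially by blast
  have nz': "u n x \<noteq> 0" if n: "n \<ge> N" and x: "x \<in> ball a r" for n x
  proof
    assume "u n x = 0"
    then have "vanishes_to_order (u n) x m" using van x r by (intro van) auto
    then have "(deriv ^^ l) (u n) x = 0" using l by (simp add: vanishes_to_order_def)
    then have "cmod ((deriv ^^ l) v x) < c / 2" using N[OF n x] by (simp add: dist_norm)
    moreover have "dist ((deriv ^^ l) v x) ((deriv ^^ l) v a) < c / 2"
      using x r by (intro \<delta>(2)) (simp add: dist_commute)
    ultimately show False
      using norm_triangle_ineq2[of "(deriv ^^ l) v a" "(deriv ^^ l) v x"]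
      by (simp add: c_def dist_norm norm_minus_commute)
  qed
  show False
  \<comment> \<open>Hurwitz's theorem does not cover constant limits; a constant \<open>v\<close>
    would be 0 near \<open>a\<close>, against the non-zero derivative.\<close>
  proof (cases "v constant_on ball a r")
    case True
    then have "\<And>x. x \<in> ball a r \<Longrightarrow> v x = 0" using va r by (metis centre_in_ball constant_on_def)
    then have "\<forall>\<^sub>F x in nhds a. v x = 0"
      using r eventually_nhds_in_open[of "ball a r" a] by (auto elim: eventually_mono)
    then have "(deriv ^^ l) v a = (deriv ^^ l) (\<lambda>_. 0) a" by (intro higher_deriv_cong_ev) auto
    with nz show False by simp
  next
    case False
    have "v a \<noteq> 0"
    proof (rule Hurwitz_no_zeros[of "ball a r" "\<lambda>n. u (n + N)" v])
      show "v holomorphic_on ball a r" "u (n + N) holomorphic_on ball a r" for n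
        using holv hol r by (meson holomorphic_on_subset less_imp_le subset_ball)+
      fix K assume "compact K" "K \<subseteq> ball a r"
      then have "K \<subseteq> ball a R" using r by auto
      then have "uniform_limit K u v sequentially" using ul uniform_limit_on_subset by blast
      then show "uniform_limit K (\<lambda>n. u (n + N)) v sequentially"
        by (rule filterlim_compose[OF _ filterlim_add_const_nat_at_top])
    qed (use False nz' r in auto)
    with va show False by simp
  qed
qed

section \<open>The Zalcman-Pang rescaling\<close>

text \<open>The exponent \<open>k\<close> makes the \<open>k\<close>-th derivative at \<zeta> equal
  to that of \<open>f\<close> at the original point, with no power of \<rho>.\<close>

definition rescale :: "nat \<Rightarrow> (complex \<Rightarrow> complex) \<Rightarrow> complex \<Rightarrow> real \<Rightarrow> complex \<Rightarrow> complex" where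
  "rescale k f z \<rho> = (\<lambda>\<zeta>. of_real (1 / \<rho> ^ k) * f (of_real \<rho> * \<zeta> + z))"

text \<open>The point \<open>z\<close> maximises \<open>scale_density k f w * (R - dist z0 w) ^ (k * (k + 1))\<close>.\<close>
lemma zalcman_step:
  assumes D: "open D" and hol: "\<And>f. f \<in> F \<Longrightarrow> f holomorphic_on D" and k: "0 < k" "k < d"
    and van: "\<And>f w. f \<in> F \<Longrightarrow> w \<in> D \<Longrightarrow> f w = 0 \<Longrightarrow> vanishes_to_order f w d"
    and R: "R > 0" "cball z0 R \<subseteq> D" and N: "N > 0"
    and unb: "\<And>r C. r > 0 \<Longrightarrow> ball z0 r \<subseteq> D \<Longrightarrow> \<exists>f\<in>F. \<exists>z\<in>ball z0 r. scale_density k f z > C"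
  shows "\<exists>f\<in>F. \<exists>z\<in>cball z0 R. \<exists>\<rho>. 0 < \<rho> \<and> \<rho> \<le> R / N \<and>
      (\<forall>\<zeta>\<in>ball 0 N. of_real \<rho> * \<zeta> + z \<in> D \<and> scale_density k (rescale k f z \<rho>) \<zeta> \<le> 2 ^ (k * (k + 1))) \<and>
      scale_density k (rescale k f z \<rho>) 0 = 1"
proof -
  \<comment> \<open>The degree of homogeneity of the density; the weight gets the same degree, so
    that a length 1 / q can be compared with \<tau>.\<close>
  define s where "s = k * (k + 1)"
  have s: "s > 0" using k by (simp add: s_def)
  have "ball z0 (R / 2) \<subseteq> cball z0 R" using R(1) by auto
  then have "ball z0 (R / 2) \<subseteq> D" using R(2) by (rule subset_trans)
  then obtain f p where f: "f \<in> F" and p: "p \<in> ball z0 (R / 2)" and big: "scale_density k f p > (4 * N / R) ^ s"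
    using unb[of "R / 2" "(4 * N / R) ^ s"] half_gt_zero[OF R(1)] by blast
  define Q where "Q = scale_density k f"
  have Q0: "Q z \<ge> 0" for z by (simp add: Q_def scale_density_nonneg)
  have "continuous_on D Q" unfolding Q_def
    by (rule continuous_on_scale_density[OF D hol[OF f] k van[OF f]])
  then have cont: "continuous_on (cball z0 R) (\<lambda>w. Q w * (R - dist z0 w) ^ s)"
    using R by (intro continuous_intros) (auto intro: continuous_on_subset)
  have "cball z0 R \<noteq> {}" using R(1) by simp
  from continuous_attains_sup[OF compact_cball this cont]
  obtain z1 where z1: "z1 \<in> cball z0 R"
    and max: "\<And>w. w \<in> cball z0 R \<Longrightarrow> Q w * (R - dist z0 w) ^ s \<le> Q z1 * (R - dist z0 z1) ^ s"
    by blast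
  define \<tau> where "\<tau> = R - dist z0 z1"
  \<comment> \<open>The weight at \<open>p\<close> is at least (R / 2)^s, so the threshold (4 N /
    R)^s makes the maximum at least (2 N)^s.\<close>
  have "(2 * N) ^ s = (4 * N / R) ^ s * (R / 2) ^ s"
    unfolding power_mult_distrib[symmetric] using R(1) by simp
  also have "\<dots> \<le> Q p * (R - dist z0 p) ^ s"
    using big p R(1) N by (intro mult_mono power_mono) (auto simp: Q_def scale_density_nonneg)
  also have "\<dots> \<le> Q z1 * \<tau> ^ s" unfolding \<tau>_def using p R(1) by (intro max) auto
  finally have W: "(2 * N) ^ s \<le> Q z1 * \<tau> ^ s" .
  moreover have "(2 * N) ^ s > 0" using N by simp
  ultimately have pos: "Q z1 * \<tau> ^ s > 0" by linarith
  have \<tau>0: "\<tau> > 0" 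
  proof (rule ccontr)
    assume "\<not> \<tau> > 0"
    then have "\<tau> = 0" using z1 by (simp add: \<tau>_def)
    with pos s show False by (simp add: power_0_left)
  qed
  have Qp: "Q z1 > 0" using pos Q0[of z1] by (cases "Q z1 = 0") auto
  define q where "q = root s (Q z1)"
  have q: "q > 0" "q ^ s = Q z1" using Qp s by (auto simp: q_def)
  have "(2 * N) ^ s \<le> (q * \<tau>) ^ s" using W by (simp add: power_mult_distrib q)
  then have qt: "2 * N \<le> q * \<tau>"
    using s q \<tau>0 N power_mono_iff[of "2 * N" "q * \<tau>" s] by simp
  \<comment> \<open>Chosen so that \<rho>^s times the density at \<open>z1\<close> is 1.\<close>
  define \<rho> where "\<rho> = 1 / q"
  have \<rho>: "\<rho> > 0" "\<rho> ^ s * Q z1 = 1" using q Qp by (auto simp: \<rho>_def power_divide)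
  have \<rho>N: "\<rho> * N \<le> \<tau> / 2" using qt q by (simp add: \<rho>_def field_simps)
  have "\<rho> * N \<le> R" using \<rho>N \<tau>0 zero_le_dist[of z0 z1] \<tau>_def by linarith
  then have \<rho>R: "\<rho> \<le> R / N" using N by (simp add: field_simps)
  have near: "of_real \<rho> * \<zeta> + z1 \<in> D \<and> scale_density k (rescale k f z1 \<rho>) \<zeta> = \<rho> ^ s * Q (of_real \<rho> * \<zeta> + z1) \<and>
     Q (of_real \<rho> * \<zeta> + z1) \<le> 2 ^ s * Q z1" if \<zeta>: "\<zeta> \<in> ball 0 N" for \<zeta>
  proof -
    define w where "w = of_real \<rho> * \<zeta> + z1"
    have "dist z1 w = \<rho> * cmod \<zeta>" using \<rho> by (simp add: w_def dist_norm norm_mult)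
    also have "\<dots> \<le> \<rho> * N" using \<zeta> \<rho> by (intro mult_left_mono) auto
    finally have "dist z1 w \<le> \<tau> / 2" using \<rho>N by simp
    \<comment> \<open>The rescaled disc stays within \<tau> / 2 of \<open>z1\<close>, so the weight
      is at least 2^(-s) times its value there; maximality then lets the density grow by at most
      2^s.\<close>
    then have dw: "\<tau> / 2 \<le> R - dist z0 w" using dist_triangle[of z0 w z1] by (simp add: \<tau>_def)
    then have wR: "w \<in> cball z0 R" using \<tau>0 by simp
    then have wD: "w \<in> D" using R by auto
    have "Q w * (\<tau> / 2) ^ s \<le> Q w * (R - dist z0 w) ^ s"
      using dw \<tau>0 Q0 by (intro mult_left_mono power_mono) auto
    also have "\<dots> \<le> Q z1 * \<tau> ^ s" unfolding \<tau>_def by (rule max[OF wR])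
    finally have "Q w \<le> 2 ^ s * Q z1" using \<tau>0 by (simp add: power_divide field_simps)
    moreover have "scale_density k (rescale k f z1 \<rho>) \<zeta> = \<rho> ^ s * Q w"
      unfolding rescale_def s_def Q_def w_def
      by (rule scale_density_rescale[OF hol[OF f] D]) (use wD \<rho> k in \<open>auto simp: w_def\<close>)
    ultimately show ?thesis using wD by (simp add: w_def)
  qed
  have "scale_density k (rescale k f z1 \<rho>) \<zeta> \<le> 2 ^ s" if \<zeta>: "\<zeta> \<in> ball 0 N" for \<zeta>
  proof -
    have "\<rho> ^ s * Q (of_real \<rho> * \<zeta> + z1) \<le> \<rho> ^ s * (2 ^ s * Q z1)"
      using near[OF \<zeta>] \<rho> by (intro mult_left_mono) auto
    also have "\<dots> = 2 ^ s" using \<rho> by (simp add: mult_ac)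
    finally show ?thesis using near[OF \<zeta>] by simp
  qed
  moreover have "scale_density k (rescale k f z1 \<rho>) 0 = 1" using near[of 0] \<rho> N by simp
  ultimately show ?thesis using f z1 \<rho> \<rho>R near unfolding s_def[symmetric] by blast
qed

text \<open>\<open>zalcman_step\<close> is applied with radius i + 1 for each i; compactness of the
  closed disc around \<open>z0\<close> makes the centres converge along a subsequence.\<close>

lemma zalcman_rescaling:
  assumes D: "open D" and hol: "\<And>f. f \<in> F \<Longrightarrow> f holomorphic_on D" and k: "0 < k" "k < d"
    and van: "\<And>f w. f \<in> F \<Longrightarrow> w \<in> D \<Longrightarrow> f w = 0 \<Longrightarrow> vanishes_to_order f w d"
    and z0: "z0 \<in> D"
    and unb: "\<And>r C. r > 0 \<Longrightarrow> ball z0 r \<subseteq> D \<Longrightarrow> \<exists>f\<in>F. \<exists>z\<in>ball z0 r. scale_density k f z > C"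
  shows "\<exists>f z c \<rho>. (\<forall>i. f i \<in> F) \<and> z \<longlonglongrightarrow> c \<and> c \<in> D \<and> (\<forall>i. \<rho> i > 0) \<and> \<rho> \<longlonglongrightarrow> 0 \<and>
    (\<forall>i. \<forall>\<zeta>\<in>ball 0 (real i). of_real (\<rho> i) * \<zeta> + z i \<in> D \<and>
       scale_density k (rescale k (f i) (z i) (\<rho> i)) \<zeta> \<le> 2 ^ (k * (k + 1))) \<and>
    (\<forall>i. scale_density k (rescale k (f i) (z i) (\<rho> i)) 0 = 1)"
proof -
  obtain R where R: "R > 0" "cball z0 R \<subseteq> D" using D z0 by (meson open_contains_cball)
  define P where "P i f z \<rho> \<longleftrightarrow> f \<in> F \<and> z \<in> cball z0 R \<and> 0 < \<rho> \<and> \<rho> \<le> R / real (Suc i) \<and>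
      (\<forall>\<zeta>\<in>ball 0 (real (Suc i)). of_real \<rho> * \<zeta> + z \<in> D \<and> scale_density k (rescale k f z \<rho>) \<zeta> \<le> 2 ^ (k * (k + 1))) \<and>
      scale_density k (rescale k f z \<rho>) 0 = 1" for i f z \<rho>
  have "\<exists>f z \<rho>. P i f z \<rho>" for i
  proof -
    have "real (Suc i) > 0" by simp
    from zalcman_step[OF D hol k van R this unb] show ?thesis unfolding P_def by blast
  qed
  then obtain f z \<rho> where P: "\<And>i. P i (f i) (z i) (\<rho> i)" by metis
  have zb: "\<forall>i. z i \<in> cball z0 R" using P by (simp add: P_def)
  obtain c r where r: "c \<in> cball z0 R" "strict_mono (r :: nat \<Rightarrow> nat)" "(z \<circ> r) \<longlonglongrightarrow> c"
    using compact_cball[of z0 R] zb unfolding compact_def by blast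
  have "\<rho> \<longlonglongrightarrow> 0"
  proof (rule tendsto_sandwich)
    show "\<forall>\<^sub>F i in sequentially. 0 \<le> \<rho> i" "\<forall>\<^sub>F i in sequentially. \<rho> i \<le> R / real (Suc i)"
      using P by (auto simp: P_def less_imp_le)
    show "(\<lambda>i. R / real (Suc i)) \<longlonglongrightarrow> 0" by (rule LIMSEQ_Suc[OF lim_const_over_n])
  qed simp
  then have "(\<rho> \<circ> r) \<longlonglongrightarrow> 0" using r(2) by (rule LIMSEQ_subseq_LIMSEQ)
  \<comment> \<open>A subsequence satisfies r i >= i, so the disc of index r i still contains the
    one required at index i.\<close>
  moreover have sub: "ball (0::complex) (real i) \<subseteq> ball 0 (real (Suc (r i)))" for i
    using seq_suble[OF r(2), of i] by (intro subset_ball) linarith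
  ultimately show ?thesis using P r R
    by (intro exI[of _ "f \<circ> r"] exI[of _ "z \<circ> r"] exI[of _ c] exI[of _ "\<rho> \<circ> r"]) (auto simp: P_def subset_iff simp del: of_nat_Suc)
qed

text \<open>A value \<open>x = \<bar>g 0\<bar>\<close> with \<open>ln x > 8 M\<close> would force \<open>\<bar>g\<bar> > 1\<close> on the disc of radius 2, hence
  \<open>\<bar>(1/g)' 0\<bar> \<le> ln x / x < 1\<close>, whereas the normalisation gives \<open>\<bar>(1/g)' 0\<bar> \<ge> 1\<close>.\<close>
lemma normalised_value_bound:
  assumes hol: "g holomorphic_on ball 0 2" and k: "k > 0" and M: "M \<ge> 0"
    and sph: "\<And>z. z \<in> ball 0 2 \<Longrightarrow> cmod (deriv g z) \<le> M * (1 + (cmod (g z))\<^sup>2)"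
    and one: "scale_density k g 0 = 1"
  shows "ln (cmod (g 0)) \<le> 8 * M"
proof (rule ccontr)
  assume "\<not> ?thesis"
  then have gt: "cmod (g v) > 1" if "v \<in> ball 0 2" for v
    using spherical_harnack[OF hol _ M sph] that by auto
  define x where "x = cmod (g 0)"
  have x: "x > 1" using gt[of 0] by (simp add: x_def)
  have "(cmod (deriv g 0) ^ k - x ^ (k - 1)) / x ^ (2 * k) = 1"
    using one by (auto simp: scale_density_def x_def max_def split: if_splits)
  then have "cmod (deriv g 0) ^ k = x ^ (k - 1) + x ^ (2 * k)" using x by (simp add: field_simps)
  moreover have "x ^ (k - 1) \<ge> 0" using x by simp
  ultimately have "(x\<^sup>2) ^ k \<le> cmod (deriv g 0) ^ k" by (simp add: power_mult)
  then have dg: "x\<^sup>2 \<le> cmod (deriv g 0)" using k power_mono_iff[of "x\<^sup>2" "cmod (deriv g 0)" k] by simp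
  have nz: "g v \<noteq> 0" if "v \<in> ball 0 2" for v using gt[OF that] by auto
  have "cmod (deriv (\<lambda>w. inverse (g w)) 0) \<le> 2 / 2 * cmod (inverse (g 0)) * - ln (cmod (inverse (g 0)))"
  proof (rule nonvanishing_deriv_le)
    show "(\<lambda>w. inverse (g w)) holomorphic_on ball 0 2" using hol nz by (auto intro: holomorphic_intros)
    show "cmod (inverse (g w)) < 1" if "w \<in> ball 0 2" for w
      using gt[OF that] by (simp add: norm_inverse inverse_less_1_iff)
  qed (use nz in auto)
  also have "\<dots> = ln x / x"
    using x by (simp only: norm_inverse x_def[symmetric]) (simp add: ln_inverse divide_inverse)
  also have "deriv (\<lambda>w. inverse (g w)) 0 = - (deriv g 0 / (g 0)\<^sup>2)"
  proof -
    have "(g has_field_derivative deriv g 0) (at 0)" by (rule holomorphic_derivI[OF hol]) auto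
    from DERIV_inverse'[OF this] nz[of 0] show ?thesis
      by (intro DERIV_imp_deriv) (simp add: power2_eq_square field_simps)
  qed
  finally have "cmod (deriv g 0) / x\<^sup>2 \<le> ln x / x" by (simp add: norm_divide norm_power x_def)
  moreover have "1 \<le> cmod (deriv g 0) / x\<^sup>2" using dg x by simp
  ultimately have "1 \<le> ln x / x" by linarith
  then have "x \<le> ln x" using x by (simp add: field_simps)
  moreover have "ln x \<le> x - 1" using x by (intro ln_le_minus_one) simp
  ultimately show False by simp
qed

section \<open>Growth and convergence of the rescaled functions\<close>

text \<open>The source of exponential type. The disc about \<open>z\<close> of radius 2 |z| + 2
  contains 0 within half its radius, so \<open>spherical_harnack\<close> either bounds ln |g z|
  linearly in that radius or compares it with ln |g 0|. The condition on \<open>T\<close> makes this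
  disc fit into the domain.\<close>

lemma spherical_growth:
  assumes hol: "g holomorphic_on ball 0 T" and M: "M \<ge> 0" and T: "3 * cmod z + 2 \<le> T"
    and sph: "\<And>z. z \<in> ball 0 T \<Longrightarrow> cmod (deriv g z) \<le> M * (1 + (cmod (g z))\<^sup>2)"
    and g0: "ln (cmod (g 0)) \<le> 8 * M"
  shows "cmod (g z) \<le> exp (24 * M * (1 + cmod z))"
proof -
  let ?R = "2 * cmod z + 2"
  have sub: "ball z ?R \<subseteq> ball 0 T"
  proof
    fix w assume w: "w \<in> ball z ?R"
    have "dist 0 w \<le> dist 0 z + dist z w" by (rule dist_triangle)
    then show "w \<in> ball 0 T" using w T by simp
  qed
  have holz: "g holomorphic_on ball z ?R" using hol sub by (rule holomorphic_on_subset)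
  have R0: "?R > 0" using norm_ge_zero[of z] by linarith
  have "ln (cmod (g z)) \<le> 4 * M * ?R \<or> ln (cmod (g z)) \<le> 3 * ln (cmod (g 0))"
  proof -
    have "cmod (deriv g w) \<le> M * (1 + (cmod (g w))\<^sup>2)" if "w \<in> ball z ?R" for w
      using sph sub that by blast
    with spherical_harnack[OF holz R0 M]
    have "ln (cmod (g z)) \<le> 4 * M * ?R \<or>
      (\<forall>w. cmod (w - z) \<le> ?R / 2 \<longrightarrow> ln (cmod (g z)) \<le> 3 * ln (cmod (g w)))"
      by blast
    moreover have "cmod (0 - z) \<le> ?R / 2" by simp
    ultimately show ?thesis by blast
  qed
  moreover have "4 * M * ?R \<le> 24 * M * (1 + cmod z)" using M by (simp add: algebra_simps)
  moreover have "3 * ln (cmod (g 0)) \<le> 24 * M * (1 + cmod z)"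
  proof -
    have "0 \<le> 24 * M * cmod z" using M by simp
    then show ?thesis using g0 by (simp add: algebra_simps)
  qed
  ultimately have "ln (cmod (g z)) \<le> 24 * M * (1 + cmod z)" by linarith
  then show ?thesis by (cases "g z = 0") (auto simp: ln_le_cancel_iff[symmetric] ln_exp simp del: ln_le_cancel_iff)
qed

lemma Montel_seq:
  fixes u :: "nat \<Rightarrow> complex \<Rightarrow> complex"
  assumes S: "open S" and hol: "\<And>n. u n holomorphic_on S"
    and bdd: "\<forall>K. compact K \<longrightarrow> K \<subseteq> S \<longrightarrow> (\<exists>B. \<forall>n. \<forall>z\<in>K. cmod (u n z) \<le> B)"
  shows "\<exists>v r. strict_mono (r :: nat \<Rightarrow> nat) \<and> v holomorphic_on S \<and>
    (\<forall>K. compact K \<longrightarrow> K \<subseteq> S \<longrightarrow> uniform_limit K (u \<circ> r) v sequentially)"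
proof (rule Montel[of S "range u" u])
  show "\<exists>B. \<forall>h\<in>range u. \<forall>z\<in>K. cmod (h z) \<le> B" if "compact K" "K \<subseteq> S" for K
    using bdd[rule_format, OF that] by auto
  show "h holomorphic_on S" if "h \<in> range u" for h using that hol by auto
  fix v and r :: "nat \<Rightarrow> nat"
  assume "v holomorphic_on S" "strict_mono r"
    and ul: "\<And>K. compact K \<Longrightarrow> K \<subseteq> S \<Longrightarrow> uniform_limit K (u \<circ> r) v sequentially"
  then show ?thesis by (intro exI[of _ v] exI[of _ r]) simp
qed (simp_all add: S)

text \<open>Montel's theorem on each ball, followed by a diagonal subsequence; monotonicity of
  \<open>b\<close> turns the pointwise growth bound into a uniform one on the ball.\<close>

lemma entire_limit_of_growing_discs:
  fixes g :: "nat \<Rightarrow> complex \<Rightarrow> complex"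
  assumes hol: "\<And>i. g i holomorphic_on ball 0 (real i)"
    and growth: "\<And>i z. 3 * cmod z + 2 \<le> real i \<Longrightarrow> cmod (g i z) \<le> b (cmod z)"
    and b: "mono b"
  obtains r G where "strict_mono (r :: nat \<Rightarrow> nat)" "G holomorphic_on UNIV"
    "\<And>R. uniform_limit (ball 0 R) (g \<circ> r) G sequentially"
proof -
  \<comment> \<open>Early functions are not controlled on the \<open>N\<close>-th ball and are
    replaced by 0, so that all indices satisfy the hypotheses of Montel's theorem without affecting
    limits.\<close>
  define u where "u N i z = (if 3 * (real N + 1) + 2 \<le> real i then g i z else 0)" for N i z
  have uhol: "u N i holomorphic_on ball 0 (real N + 1)" for N i
  proof (cases "3 * (real N + 1) + 2 \<le> real i")
    case True
    then have "u N i = g i" by (simp add: u_def fun_eq_iff)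
    moreover have "ball (0::complex) (real N + 1) \<subseteq> ball 0 (real i)" using True by (intro subset_ball) (simp add: algebra_simps)
    ultimately show ?thesis using hol by (metis holomorphic_on_subset)
  next
    case False
    then have "u N i = (\<lambda>_. 0)" by (simp add: u_def fun_eq_iff)
    then show ?thesis by simp
  qed
  have ubd: "cmod (u N i z) \<le> max 0 (b (real N + 1))" if "z \<in> ball 0 (real N + 1)" for N i z
  proof (cases "3 * (real N + 1) + 2 \<le> real i")
    case True
    then have "cmod (u N i z) \<le> b (cmod z)" using growth[of z i] that by (simp add: u_def)
    also have "\<dots> \<le> b (real N + 1)" using monoD[OF b, of "cmod z" "real N + 1"] that by simp
    finally show ?thesis by simp
  qed (simp add: u_def)
  define P where "P N s \<longleftrightarrow> (\<exists>v. uniform_limit (cball 0 (real N)) (\<lambda>n. u N (s n)) v sequentially)"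
    for N :: nat and s :: "nat \<Rightarrow> nat"
  obtain r :: "nat \<Rightarrow> nat" where r: "strict_mono r" "\<And>N. P N (id \<circ> r)"
  proof (rule subsequence_diagonalization_lemma[of P id])
    fix N and s :: "nat \<Rightarrow> nat"
    have bdd: "\<forall>K. compact K \<longrightarrow> K \<subseteq> ball 0 (real N + 1) \<longrightarrow> (\<exists>B. \<forall>n. \<forall>z\<in>K. cmod (u N (s n) z) \<le> B)"
      by (intro allI impI exI[of _ "max 0 (b (real N + 1))"] ballI ubd) auto
    obtain v and r :: "nat \<Rightarrow> nat" where vr: "strict_mono r"
      "\<forall>K. compact K \<longrightarrow> K \<subseteq> ball 0 (real N + 1) \<longrightarrow> uniform_limit K ((\<lambda>n. u N (s n)) \<circ> r) v sequentially"
      using Montel_seq[OF open_ball uhol bdd] by blast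
    have sub: "cball (0::complex) (real N) \<subseteq> ball 0 (real N + 1)" by auto
    have "uniform_limit (cball 0 (real N)) ((\<lambda>n. u N (s n)) \<circ> r) v sequentially"
      using vr(2) sub compact_cball by blast
    then have "P N (s \<circ> r)" unfolding P_def by (auto simp: o_def)
    then show "\<exists>k. strict_mono k \<and> P N (s \<circ> k)" using vr(1) by blast
  next
    \<comment> \<open>The closure condition of the diagonal argument: convergence survives when a
      tail of \<open>k2\<close> consists of equally late or later terms of
      \<open>k1\<close>.\<close>
    fix i and s k1 k2 :: "nat \<Rightarrow> nat" and N :: nat
    assume "P i (s \<circ> k1)" and k2: "\<And>j. N \<le> j \<Longrightarrow> \<exists>j'\<ge>j. k2 j = k1 j'"
    then obtain v where v: "uniform_limit (cball 0 (real i)) (\<lambda>n. u i (s (k1 n))) v sequentially"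
      by (auto simp: P_def)
    have "uniform_limit (cball 0 (real i)) (\<lambda>n. u i (s (k2 n))) v sequentially"
      unfolding uniform_limit_sequentially_iff
    proof (intro allI impI)
      fix e :: real assume "e > 0"
      then obtain M where M: "\<And>n x. n \<ge> M \<Longrightarrow> x \<in> cball 0 (real i) \<Longrightarrow> dist (u i (s (k1 n)) x) (v x) < e"
        using v unfolding uniform_limit_sequentially_iff by blast
      have "dist (u i (s (k2 n)) x) (v x) < e" if n: "n \<ge> max M N" and x: "x \<in> cball 0 (real i)" for n x
      proof -
        obtain j' where "j' \<ge> n" "k2 n = k1 j'" using k2[of n] n by auto
        then show ?thesis using M[of j' x] n x by simp
      qed
      then show "\<exists>M. \<forall>n\<ge>M. \<forall>x\<in>cball 0 (real i). dist (u i (s (k2 n)) x) (v x) < e" by blast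
    qed
    then show "P i (s \<circ> k2)" by (auto simp: P_def)
  qed (rule that)
  have "\<exists>v. uniform_limit (cball 0 (real N)) (g \<circ> r) v sequentially" for N
  proof -
    obtain v where v: "uniform_limit (cball 0 (real N)) (\<lambda>n. u N (r n)) v sequentially"
      using r(2)[of N] by (auto simp: P_def)
    have "\<forall>\<^sub>F n in sequentially. \<forall>x\<in>cball 0 (real N). u N (r n) x = (g \<circ> r) n x"
      using eventually_ge_at_top[of "3 * (N + 1) + 2"]
    proof eventually_elim
      case (elim n)
      then have "3 * (N + 1) + 2 \<le> r n" using seq_suble[OF r(1), of n] by linarith
      then have "real (3 * (N + 1) + 2) \<le> real (r n)" by (simp only: of_nat_le_iff)
      then have "3 * (real N + 1) + 2 \<le> real (r n)" by (simp add: algebra_simps)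
      then show ?case by (simp add: u_def)
    qed
    from uniform_limit_cong[OF this, of v v] v show ?thesis by blast
  qed
  then obtain v where v: "\<And>N. uniform_limit (cball 0 (real N)) (g \<circ> r) (v N) sequentially" by metis
  define G where "G z = lim (\<lambda>n. g (r n) z)" for z
  have "v N z = G z" if "z \<in> cball 0 (real N)" for N z
    using tendsto_uniform_limitI[OF v that] by (auto simp: G_def limI)
  then have ulN: "uniform_limit (cball 0 (real N)) (g \<circ> r) G sequentially" for N
    using v[of N] by (auto intro: uniform_limit_cong'[THEN iffD1, rotated 2])
  have ul: "uniform_limit (ball 0 R) (g \<circ> r) G sequentially" for R
  proof -
    obtain N :: nat where "R \<le> real N" using real_arch_simple by blast
    then have "ball (0::complex) R \<subseteq> cball 0 (real N)" by auto
    then show ?thesis using ulN uniform_limit_on_subset by blast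
  qed
  have "G holomorphic_on ball 0 (real N)" for N :: nat
  proof (rule holomorphic_on_ball_uniform_limit[where u = "\<lambda>n. (g \<circ> r) (n + N)"])
    show "uniform_limit (ball 0 (real N)) (\<lambda>n. (g \<circ> r) (n + N)) G sequentially"
      by (rule filterlim_compose[OF ul filterlim_add_const_nat_at_top])
    fix n
    have "N \<le> r (n + N)" using seq_suble[OF r(1), of "n + N"] by linarith
    then have "ball (0::complex) (real N) \<subseteq> ball 0 (real (r (n + N)))" by (intro subset_ball) simp
    then show "(g \<circ> r) (n + N) holomorphic_on ball 0 (real N)"
      using hol[of "r (n + N)"] by (auto intro: holomorphic_on_subset)
  qed
  then have "G holomorphic_on (\<Union>N. ball 0 (real N))"
    by (intro holomorphic_on_UN_open) auto
  moreover have "(\<Union>N. ball 0 (real N)) = (UNIV :: complex set)"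
    using reals_Archimedean2 by (auto simp: dist_norm)
  ultimately have "G holomorphic_on UNIV" by simp
  then show ?thesis using that r(1) ul by blast
qed

text \<open>The density bound gives a spherical bound, hence growth and a limit; Hurwitz carries
  over the multiplicities. The normalisation at 0 is what excludes constants.\<close>

lemma rescaled_limit:
  fixes g :: "nat \<Rightarrow> complex \<Rightarrow> complex"
  assumes hol: "\<And>i. g i holomorphic_on ball 0 (real i)" and k: "0 < k" "k < d"
    and van: "\<And>i z. z \<in> ball 0 (real i) \<Longrightarrow> g i z = 0 \<Longrightarrow> vanishes_to_order (g i) z d"
    and bnd: "\<And>i z. z \<in> ball 0 (real i) \<Longrightarrow> scale_density k (g i) z \<le> A"
    and one: "\<And>i. scale_density k (g i) 0 = 1"
  shows "\<exists>r G B. strict_mono (r :: nat \<Rightarrow> nat) \<and> G holomorphic_on UNIV \<and>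
    (\<forall>R. uniform_limit (ball 0 R) (g \<circ> r) G sequentially) \<and>
    (\<forall>z. cmod (G z) \<le> exp (B * (1 + cmod z))) \<and> \<not> G constant_on UNIV \<and>
    (\<forall>z. G z = 0 \<longrightarrow> vanishes_to_order G z d)"
proof -
  \<comment> \<open>Index 1 is used because the disc of index 0 is empty.\<close>
  have A: "A \<ge> 0" using bnd[of 0 1] one[of 1] by simp
  define M where "M = 1 + A"
  have M: "M \<ge> 0" using A by (simp add: M_def)
  have sph: "cmod (deriv (g i) z) \<le> M * (1 + (cmod (g i z))\<^sup>2)" if "z \<in> ball 0 (real i)" for i z
    unfolding M_def
  proof (rule scale_density_bound[OF bnd[OF that] k(1)])
    assume "g i z = 0"
    then have "\<forall>l<d. (deriv ^^ l) (g i) z = 0" using van[OF that] unfolding vanishes_to_order_def by blast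
    moreover have "1 < d" using k by simp
    ultimately have "(deriv ^^ 1) (g i) z = 0" by blast
    then show "deriv (g i) z = 0" by simp
  qed
  have g0: "ln (cmod (g i 0)) \<le> 8 * M" if "i \<ge> 2" for i
  proof -
    have "ball (0::complex) 2 \<subseteq> ball 0 (real i)" using that by (intro subset_ball) simp
    then show ?thesis using hol[of i] sph[of _ i] that
      by (intro normalised_value_bound[OF _ k(1) M _ one]) (auto intro: holomorphic_on_subset)
  qed
  have growth: "cmod (g i z) \<le> exp (24 * M * (1 + cmod z))" if "3 * cmod z + 2 \<le> real i" for i z
  proof -
    have "real i \<ge> 2" using that norm_ge_zero[of z] by linarith
    then show ?thesis using g0[of i] by (intro spherical_growth[OF hol M that sph]) auto
  qed
  have "mono (\<lambda>x. exp (24 * M * (1 + x)))" using M by (intro monoI) (simp add: mult_left_mono)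
  from entire_limit_of_growing_discs[OF hol growth this]
  obtain r G where r: "strict_mono (r :: nat \<Rightarrow> nat)" and G: "G holomorphic_on UNIV"
    and ul: "\<And>R. uniform_limit (ball 0 R) (g \<circ> r) G sequentially" by metis
  have lim: "(\<lambda>n. g (r n) z) \<longlonglongrightarrow> G z" for z
    using tendsto_uniform_limitI[OF ul[of "cmod z + 1"], of z] by simp
  have large: "\<forall>\<^sub>F n in sequentially. x \<le> real (r n)" for x
    using filterlim_compose[OF filterlim_real_sequentially filterlim_subseq[OF r]]
    by (auto simp: filterlim_at_top)
  have "cmod (G z) \<le> exp (24 * M * (1 + cmod z))" for z
  proof (rule tendsto_upperbound[OF tendsto_norm[OF lim]])
    show "\<forall>\<^sub>F n in sequentially. cmod (g (r n) z) \<le> exp (24 * M * (1 + cmod z))"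
      using large[of "3 * cmod z + 2"] by eventually_elim (rule growth)
  qed simp
  moreover have shift: "\<exists>N. (\<forall>n. ball 0 R \<subseteq> ball (0::complex) (real (r (n + N))))" for R
  proof -
    obtain N where "\<And>n. n \<ge> N \<Longrightarrow> R \<le> real (r n)" using large[of R] unfolding eventually_sequentially by blast
    then show ?thesis by (intro exI[of _ N] allI subset_ball) simp
  qed
  moreover have "vanishes_to_order G z d" if "G z = 0" for z
  proof -
    obtain N where N: "\<And>n. ball 0 (cmod z + 1) \<subseteq> ball (0::complex) (real (r (n + N)))"
      using shift[of "cmod z + 1"] by blast
    have sub: "ball z 1 \<subseteq> ball 0 (cmod z + 1)"
    proof
      fix w assume "w \<in> ball z 1"
      then show "w \<in> ball 0 (cmod z + 1)" using dist_triangle[of 0 w z] by simp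
    qed
    show ?thesis
    proof (rule vanishes_to_order_limit[where u = "\<lambda>n. (g \<circ> r) (n + N)" and R = 1])
      show "uniform_limit (ball z 1) (\<lambda>n. (g \<circ> r) (n + N)) G sequentially"
        by (rule filterlim_compose[OF uniform_limit_on_subset[OF ul sub] filterlim_add_const_nat_at_top])
      fix n
      have s: "ball z 1 \<subseteq> ball 0 (real (r (n + N)))" using sub N by blast
      then show "(g \<circ> r) (n + N) holomorphic_on ball z 1"
        using hol[of "r (n + N)"] by (auto intro: holomorphic_on_subset)
      show "vanishes_to_order ((g \<circ> r) (n + N)) w d" if "w \<in> ball z 1" "(g \<circ> r) (n + N) w = 0" for w
        using van that s by auto
    qed (use that in auto)
  qed
  \<comment> \<open>Density 1 means |u'|^k = |u|^(k - 1) + |u|^(2 k) at 0. For a constant limit c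
    the left side tends to 0, which forces c = 0. Then u n is uniformly small on
    \<open>ball 0 2\<close>, and \<open>small_deriv_bound\<close> gives |u'|^k <= |u|^(k - 1),
    contradicting the strictly positive last term.\<close>
  moreover have "\<not> G constant_on UNIV"
  proof
    assume "G constant_on UNIV"
    then obtain c where c: "\<And>z. G z = c" by (auto simp: constant_on_def)
    obtain N where N: "\<And>n. ball 0 2 \<subseteq> ball (0::complex) (real (r (n + N)))"
      using shift[of 2] by blast
    define u where "u n = g (r (n + N))" for n
    have uhol: "u n holomorphic_on ball 0 2" for n
      using hol[of "r (n + N)"] N[of n] unfolding u_def by (rule holomorphic_on_subset)
    have "uniform_limit (ball 0 2) (\<lambda>n. (g \<circ> r) (n + N)) G sequentially"
      by (rule filterlim_compose[OF ul filterlim_add_const_nat_at_top])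
    then have ulu: "uniform_limit (ball 0 2) u G sequentially" by (simp add: u_def[abs_def])
    have one': "cmod (deriv (u n) 0) ^ k = cmod (u n 0) ^ (k - 1) + cmod (u n 0) ^ (2 * k) \<and> u n 0 \<noteq> 0" for n
    proof -
      have q: "(cmod (deriv (u n) 0) ^ k - cmod (u n 0) ^ (k - 1)) / cmod (u n 0) ^ (2 * k) = 1"
        using one[of "r (n + N)"] by (auto simp: scale_density_def u_def max_def split: if_splits)
      then have "u n 0 \<noteq> 0" using k by (auto simp: power_0_left)
      with q show ?thesis by (simp add: field_simps)
    qed
    have "(\<lambda>n. deriv (u n) 0) \<longlonglongrightarrow> deriv G 0"
      by (rule deriv_complex_uniform_limit[OF ulu]) (use uhol in auto)
    also have "deriv G 0 = 0" using c by (simp add: fun_eq_iff[symmetric] ext[of G "\<lambda>_. c"])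
    finally have "(\<lambda>n. cmod (deriv (u n) 0) ^ k) \<longlonglongrightarrow> cmod 0 ^ k" by (intro tendsto_intros)
    moreover have "(\<lambda>n. cmod (u n 0) ^ (k - 1) + cmod (u n 0) ^ (2 * k)) \<longlonglongrightarrow> cmod c ^ (k - 1) + cmod c ^ (2 * k)"
      using tendsto_uniform_limitI[OF ulu, of 0] c by (intro tendsto_intros) auto
    ultimately have "cmod 0 ^ k = cmod c ^ (k - 1) + cmod c ^ (2 * k)"
      using one' LIMSEQ_unique by simp
    then have "cmod c ^ (k - 1) + cmod c ^ (2 * k) = 0" using k by (simp add: power_0_left)
    then have "cmod c ^ (2 * k) = 0"
      by (smt (verit) norm_ge_zero zero_le_power)
    then have c0: "c = 0" using k by simp
    obtain \<epsilon> :: real where e: "\<epsilon> > 0"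
      "\<And>f z \<delta>. \<delta> > 0 \<Longrightarrow> f holomorphic_on ball z (2 * \<delta>) \<Longrightarrow>
       (\<And>w. w \<in> ball z (2 * \<delta>) \<Longrightarrow> cmod (f w) < \<epsilon> * \<delta> ^ k) \<Longrightarrow>
       (\<And>w. w \<in> ball z (2 * \<delta>) \<Longrightarrow> f w = 0 \<Longrightarrow> vanishes_to_order f w d) \<Longrightarrow> f z \<noteq> 0 \<Longrightarrow>
       cmod (deriv f z) ^ k \<le> cmod (f z) ^ (k - 1)"
      using small_deriv_bound[OF k] by blast
    obtain n where "\<forall>w\<in>ball 0 2. dist (u n w) (G w) < \<epsilon>"
      using uniform_limitD[OF ulu e(1)] unfolding eventually_sequentially by blast
    then have n: "cmod (u n w) < \<epsilon>" if "w \<in> ball 0 2" for w using that c c0 by (simp add: dist_norm)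
    have "cmod (deriv (u n) 0) ^ k \<le> cmod (u n 0) ^ (k - 1)"
    proof (rule e(2)[of 1])
      show "vanishes_to_order (u n) w d" if "w \<in> ball 0 (2 * 1)" "u n w = 0" for w
        using van[of w "r (n + N)"] that N[of n] by (auto simp: u_def)
    qed (use uhol n one' in auto)
    moreover have "cmod (u n 0) ^ (2 * k) > 0" using one'[of n] by simp
    ultimately show False using one'[of n] by linarith
  qed
  ultimately show ?thesis using r G ul by blast
qed

subsection \<open>Logarithmic derivatives on circles\<close>

text \<open>An elementary substitute for a Blaschke product. For zeros in \<open>cball 0 S\<close>
  the scaling by \<open>S\<close> makes each factor at most 1 in modulus at the origin and at least
  2 on |z| = 3 S.\<close>

definition linear_factors :: "real \<Rightarrow> complex list \<Rightarrow> complex \<Rightarrow> complex" where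
  "linear_factors S xs z = prod_list (map (\<lambda>a. (z - a) / of_real S) xs)"

lemma linear_factors_deriv:
  assumes F: "(F has_field_derivative F') (at z)" "F z \<noteq> 0" and S: "S > 0" and z: "z \<notin> set xs"
  shows "((\<lambda>w. linear_factors S xs w * F w) has_field_derivative
    linear_factors S xs z * F z * ((\<Sum>a\<leftarrow>xs. 1 / (z - a)) + F' / F z)) (at z)"
  using z
proof (induction xs)
  case Nil
  then show ?case using F by (simp add: linear_factors_def[abs_def])
next
  case (Cons a xs)
  have eq: "(\<lambda>w. linear_factors S (a # xs) w * F w) = (\<lambda>w. (w - a) / of_real S * (linear_factors S xs w * F w))"
    by (simp add: linear_factors_def fun_eq_iff)
  have d: "((\<lambda>w. (w - a) / of_real S) has_field_derivative 1 / of_real S) (at z)"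
    using S by (auto intro!: derivative_eq_intros)
  have IH: "((\<lambda>w. linear_factors S xs w * F w) has_field_derivative
    linear_factors S xs z * F z * ((\<Sum>a\<leftarrow>xs. 1 / (z - a)) + F' / F z)) (at z)"
    using Cons by simp
  have za: "z - a \<noteq> 0" using Cons.prems by auto
  show ?case unfolding eq
    by (rule DERIV_cong[OF DERIV_mult[OF d IH]])
       (use za S F in \<open>simp add: linear_factors_def field_simps\<close>)
qed

lemma linear_factors_lower:
  assumes S: "S > 0" and xs: "set xs \<subseteq> cball 0 S" and z: "cmod z = 3 * S"
  shows "2 ^ length xs \<le> cmod (linear_factors S xs z)"
  using xs
proof (induction xs)
  case (Cons a xs)
  have "2 * S \<le> cmod (z - a)" using norm_triangle_ineq2[of z a] Cons.prems z by simp
  then have "2 \<le> cmod ((z - a) / of_real S)" using S by (simp add: norm_divide field_simps)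
  then have "2 * 2 ^ length xs \<le> cmod ((z - a) / of_real S) * cmod (linear_factors S xs z)"
    using Cons by (intro mult_mono) auto
  then show ?case by (simp only: linear_factors_def list.map prod_list.Cons norm_mult list.size add_0_right add_Suc_right power_Suc)
qed (simp add: linear_factors_def)

lemma linear_factors_upper:
  assumes S: "S > 0" and xs: "set xs \<subseteq> cball 0 S"
  shows "cmod (linear_factors S xs 0) \<le> 1"
  using xs
proof (induction xs)
  case (Cons a xs)
  have "cmod ((0 - a) / of_real S) \<le> 1" using Cons.prems S by (simp add: norm_divide)
  then have "cmod ((0 - a) / of_real S) * cmod (linear_factors S xs 0) \<le> 1 * 1"
    using Cons by (intro mult_mono) auto
  then show ?case by (simp only: linear_factors_def list.map prod_list.Cons norm_mult mult_1)
qed (simp add: linear_factors_def)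

lemma maximum_modulus_cball:
  assumes hol: "f holomorphic_on UNIV" and bd: "\<And>w. cmod w = R \<Longrightarrow> cmod (f w) \<le> B" and z: "cmod z \<le> R" and R: "R > 0"
  shows "cmod (f z) \<le> B"
proof (rule maximum_modulus_frontier[of f "cball 0 R"])
  show "f holomorphic_on interior (cball 0 R)" using hol holomorphic_on_subset by blast
  show "continuous_on (closure (cball 0 R)) f"
    using holomorphic_on_imp_continuous_on[OF hol] continuous_on_subset by blast
  show "cmod (f w) \<le> B" if "w \<in> frontier (cball 0 R)" for w using that R bd by (simp add: frontier_cball)
qed (use z in auto)

text \<open>A form of Jensen's inequality. Dividing out n zeros lowers the bound on |z| = 3 S by 2^n
  but does not lower the modulus at 0, so n is bounded. A factorisation of maximal length leaves an
  \<open>F\<close> without zeros in \<open>cball 0 S\<close>, since any such zero could be divided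
  out as well.\<close>

lemma factor_out_zeros:
  assumes hol: "u holomorphic_on UNIV" and S: "S > 0" and u0: "u 0 \<noteq> 0"
    and bd: "\<And>z. cmod z = 3 * S \<Longrightarrow> cmod (u z) \<le> exp T"
  obtains xs F where "set xs \<subseteq> cball 0 S" "F holomorphic_on UNIV" "\<And>z. u z = linear_factors S xs z * F z"
    "\<And>z. cmod z \<le> S \<Longrightarrow> F z \<noteq> 0" "\<And>z. cmod z \<le> 3 * S \<Longrightarrow> cmod (F z) \<le> exp T"
    "cmod (u 0) \<le> cmod (F 0)" "2 ^ length xs \<le> exp T / cmod (u 0)"
proof -
  define Fac where "Fac xs F \<longleftrightarrow> set xs \<subseteq> cball 0 S \<and> F holomorphic_on UNIV \<and> (\<forall>z. u z = linear_factors S xs z * F z)" for xs F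
  have bounds: "cmod (F z) \<le> exp T / 2 ^ length xs" if "Fac xs F" "cmod z \<le> 3 * S" for xs F z
  proof (rule maximum_modulus_cball[of F "3 * S"])
    show "F holomorphic_on UNIV" using that by (simp add: Fac_def)
    fix w :: complex assume w: "cmod w = 3 * S"
    have "2 ^ length xs * cmod (F w) \<le> cmod (linear_factors S xs w) * cmod (F w)"
      using that w by (intro mult_right_mono linear_factors_lower[OF S]) (auto simp: Fac_def)
    also have "\<dots> = cmod (u w)" using that(1) unfolding Fac_def by (metis norm_mult)
    also have "\<dots> \<le> exp T" by (rule bd[OF w])
    finally show "cmod (F w) \<le> exp T / 2 ^ length xs" by (simp add: field_simps)
  qed (use that S in auto)
  have low: "cmod (u 0) \<le> cmod (F 0)" if "Fac xs F" for xs F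
  proof -
    have "cmod (u 0) = cmod (linear_factors S xs 0) * cmod (F 0)" using that unfolding Fac_def by (metis norm_mult)
    also have "\<dots> \<le> 1 * cmod (F 0)"
      using that by (intro mult_right_mono linear_factors_upper[OF S]) (auto simp: Fac_def)
    finally show ?thesis by simp
  qed
  have len: "2 ^ length xs \<le> exp T / cmod (u 0)" if "Fac xs F" for xs F
  proof -
    have "cmod (u 0) \<le> exp T / 2 ^ length xs" using low[OF that] bounds[OF that, of 0] S by simp
    then show ?thesis using u0 by (simp add: field_simps)
  qed
  define X where "X = {n. \<exists>xs F. Fac xs F \<and> length xs = n}"
  have "n \<le> nat \<lceil>exp T / cmod (u 0)\<rceil>" if "n \<in> X" for n
  proof -
    from that obtain xs F where "Fac xs F" "length xs = n" by (auto simp: X_def)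
    then have "2 ^ n \<le> exp T / cmod (u 0)" using len by blast
    moreover have "real n < 2 ^ n" by (rule of_nat_less_two_power)
    ultimately show ?thesis by linarith
  qed
  then have fin: "finite X" by (meson finite_nat_set_iff_bounded_le)
  have "0 \<in> X" unfolding X_def Fac_def using hol
    by (intro CollectI exI[of _ "[]"] exI[of _ u]) (simp add: linear_factors_def)
  then have "Max X \<in> X" using fin Max_in by blast
  then obtain xs F where xF: "Fac xs F" "length xs = Max X" by (auto simp: X_def)
  have "F a \<noteq> 0" if a: "cmod a \<le> S" for a
  proof
    assume Fa: "F a = 0"
    define F1 where "F1 = (\<lambda>z. of_real S * (if z = a then deriv F a else (F z - F a) / (z - a)))"
    have "F holomorphic_on UNIV" using xF by (simp add: Fac_def)
    then have "F1 holomorphic_on UNIV" unfolding F1_def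
      by (intro holomorphic_on_mult holomorphic_on_const pole_lemma_open) auto
    moreover have "F z = (z - a) / of_real S * F1 z" for z using S Fa by (simp add: F1_def)
    then have "u z = linear_factors S (a # xs) z * F1 z" for z
      using xF(1) unfolding Fac_def linear_factors_def by (simp add: mult_ac)
    ultimately have "Fac (a # xs) F1" using xF a by (auto simp: Fac_def)
    then have "Suc (Max X) \<in> X" using xF(2) unfolding X_def by force
    then show False using Max_ge[OF fin] by fastforce
  qed
  moreover have "cmod (F z) \<le> exp T" if "cmod z \<le> 3 * S" for z
  proof -
    have "cmod (F z) \<le> exp T / 2 ^ length xs" by (rule bounds[OF xF(1) that])
    also have "\<dots> \<le> exp T / 1" by (intro divide_left_mono) auto
    finally show ?thesis by simp
  qed
  ultimately show ?thesis using that[of xs F] xF(1) low len unfolding Fac_def by blast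
qed

text \<open>Factoring out zeros splits u'/u into the sum over them and F'/F. The bound exp T with T
  = O(R) and the lower bound at 0 give, by Harnack, - ln |f z| = O(R) for a multiple f of F;
  \<open>nonvanishing_deriv_le\<close> on a disc of radius R turns this into a constant bound for
  F'/F.\<close>

lemma logarithmic_derivative_bound:
  assumes hol: "u holomorphic_on UNIV" and A: "A \<ge> 0"
    and gr: "\<And>z. cmod (u z) \<le> exp (A * (1 + cmod z))" and u0: "u 0 \<noteq> 0"
  obtains C where "C \<ge> 0" "\<And>R. R \<ge> 1 \<Longrightarrow> \<exists>xs. real (length xs) \<le> C * R \<and>
    (\<forall>z. cmod z \<le> R \<longrightarrow> u z = 0 \<longrightarrow> z \<in> set xs) \<and>
    (\<forall>z. cmod z \<le> R \<longrightarrow> u z \<noteq> 0 \<longrightarrow> z \<notin> set xs \<and> cmod (deriv u z) \<le> cmod (u z) * (C + (\<Sum>a\<leftarrow>xs. 1 / cmod (z - a))))"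
proof -
  \<comment> \<open>For S = 2 R and R >= 1 one has T = A (1 + 6 R) <= 7 A R; the other summands are
    the costs of the factor 2 in \<open>f\<close> and of the value at 0.\<close>
  define E where "E = ln 2 + 7 * A + \<bar>ln (cmod (u 0))\<bar>"
  have E: "E \<ge> 0" using A by (simp add: E_def)
  show ?thesis
  proof (rule that[of "6 * E"])
    fix R :: real assume R: "R \<ge> 1"
    \<comment> \<open>The factor 2 serves twice: |z| <= S / 2 gives Harnack's constant 3, and
      \<open>ball z R\<close> lies inside the zero-free disc.\<close>
    define S where "S = 2 * R"
    define T where "T = A * (1 + 3 * S)"
    have S: "S > 0" using R by (simp add: S_def)
    have bd: "cmod (u z) \<le> exp T" if "cmod z = 3 * S" for z using gr[of z] that by (simp add: T_def)
    obtain xs F where xs: "set xs \<subseteq> cball 0 S" and F: "F holomorphic_on UNIV" "\<And>z. u z = linear_factors S xs z * F z"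
      "\<And>z. cmod z \<le> S \<Longrightarrow> F z \<noteq> 0" "\<And>z. cmod z \<le> 3 * S \<Longrightarrow> cmod (F z) \<le> exp T"
      "cmod (u 0) \<le> cmod (F 0)" and len: "2 ^ length xs \<le> exp T / cmod (u 0)"
      using factor_out_zeros[OF hol S u0 bd] by metis
    have TE: "ln 2 + T - ln (cmod (u 0)) \<le> E * R"
    proof -
      have "A * 1 \<le> A * R" using A R by (intro mult_left_mono) auto
      then have "T \<le> 7 * A * R" by (simp add: T_def S_def algebra_simps)
      moreover have "(ln 2 + \<bar>ln (cmod (u 0))\<bar>) * 1 \<le> (ln 2 + \<bar>ln (cmod (u 0))\<bar>) * R"
        using R by (intro mult_left_mono) auto
      ultimately show ?thesis by (simp add: E_def algebra_simps)
    qed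
    have ln2: "2 / 3 \<le> ln (2::real)" by (rule ln2_ge_two_thirds)
    have "real (length xs) \<le> 6 * E * R"
    proof -
      have "ln (2 ^ length xs) \<le> ln (exp T / cmod (u 0))"
        using len u0 by (subst ln_le_cancel_iff) auto
      then have "real (length xs) * ln 2 \<le> T - ln (cmod (u 0))"
        using u0 by (simp add: ln_realpow ln_div)
      moreover have "real (length xs) * (2 / 3) \<le> real (length xs) * ln 2" using ln2 by (intro mult_left_mono) auto
      ultimately have "real (length xs) * (2 / 3) \<le> E * R" using TE ln2 by linarith
      moreover have "0 \<le> E * R" using E R by simp
      ultimately show ?thesis by linarith
    qed
    moreover have fac: "u z = 0 \<longleftrightarrow> z \<in> set xs" if "cmod z \<le> R" for z
      using F(2,3)[of z] that S R by (auto simp: linear_factors_def prod_list_zero_iff S_def)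
    moreover have "cmod (deriv u z) \<le> cmod (u z) * (6 * E + (\<Sum>a\<leftarrow>xs. 1 / cmod (z - a)))"
      if z: "cmod z \<le> R" "u z \<noteq> 0" for z
    proof -
      \<comment> \<open>The factor 2 makes the modulus strictly less than 1.\<close>
      define f where "f w = F w / of_real (2 * exp T)" for w
      have nf: "cmod (f w) = cmod (F w) / (2 * exp T)" for w
        unfolding f_def norm_divide norm_of_real by simp
      have fhol: "f holomorphic_on X" for X unfolding f_def
        using holomorphic_on_subset[OF F(1), of X] by (intro holomorphic_intros) auto
      have fnz: "f w \<noteq> 0" if "cmod w \<le> S" for w using F(3)[OF that] by (simp add: f_def)
      have flt: "cmod (f w) < 1" if "cmod w \<le> S" for w
      proof -
        have "cmod w \<le> 3 * S" using that S by linarith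
        from F(4)[OF this] have "cmod (F w) < 2 * exp T" using exp_gt_zero[of T] by linarith
        then show ?thesis unfolding nf by simp
      qed
      have zS: "cmod z \<le> S / 2" using z by (simp add: S_def)
      have Fz: "F z \<noteq> 0" using z F(2)[of z] by auto
      have "(S - cmod (z - 0)) * - ln (cmod (f z)) \<le> (S + cmod (z - 0)) * - ln (cmod (f 0))"
        by (rule nonvanishing_harnack(2)) (use fhol S fnz flt zS in auto)
      moreover have L0: "- ln (cmod (f 0)) \<ge> 0" "- ln (cmod (f z)) \<ge> 0"
        using flt[of 0] flt[of z] fnz[of 0] fnz[of z] S zS by auto
      moreover have "S / 2 * - ln (cmod (f z)) \<le> (S - cmod (z - 0)) * - ln (cmod (f z))"
        using L0 zS by (intro mult_right_mono) auto
      moreover have "(S + cmod (z - 0)) * - ln (cmod (f 0)) \<le> (3 * S / 2) * - ln (cmod (f 0))"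
        using L0 zS by (intro mult_right_mono) auto
      ultimately have "S / 2 * - ln (cmod (f z)) \<le> (3 * S / 2) * - ln (cmod (f 0))" by linarith
      then have "- ln (cmod (f z)) \<le> 3 * - ln (cmod (f 0))" using S by simp
      also have "- ln (cmod (f 0)) = ln 2 + T - ln (cmod (F 0))"
        using F(3)[of 0] S by (simp add: nf ln_div ln_mult)
      also have "\<dots> \<le> ln 2 + T - ln (cmod (u 0))"
        using F(5) u0 F(3)[of 0] S by (simp add: ln_le_cancel_iff)
      also have "\<dots> \<le> E * R" by (rule TE)
      finally have lf: "- ln (cmod (f z)) \<le> 3 * (E * R)" by simp
      have "cmod (deriv f z) \<le> 2 / R * cmod (f z) * - ln (cmod (f z))"
      proof (rule nonvanishing_deriv_le)
        have *: "cmod w \<le> S" if "w \<in> ball z R" for w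
          using norm_triangle_ineq2[of w z] that z by (simp add: dist_norm norm_minus_commute S_def)
        show "f w \<noteq> 0" "cmod (f w) < 1" if "w \<in> ball z R" for w using fnz flt *[OF that] by auto
      qed (use fhol R in auto)
      also have "\<dots> \<le> 2 / R * cmod (f z) * (3 * (E * R))" using lf R by (intro mult_left_mono) auto
      also have "\<dots> = cmod (f z) * (6 * E)" using R by simp
      finally have "cmod (deriv f z) \<le> cmod (f z) * (6 * E)" .
      moreover have "deriv f z = deriv F z / of_real (2 * exp T)"
      proof -
        have "(F has_field_derivative deriv F z) (at z)" by (rule holomorphic_derivI[OF F(1)]) auto
        then show ?thesis unfolding f_def by (intro DERIV_imp_deriv DERIV_cdivide)
      qed
      ultimately have "cmod (deriv F z) / (2 * exp T) \<le> cmod (F z) * (6 * E) / (2 * exp T)"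
        unfolding nf by (simp only: norm_divide norm_of_real) simp
      then have dF: "cmod (deriv F z / F z) \<le> 6 * E" using Fz by (simp add: norm_divide field_simps)
      have "z \<notin> set xs" using fac[OF z(1)] z by simp
      from linear_factors_deriv[OF holomorphic_derivI[OF F(1) open_UNIV] Fz S this]
      have "(u has_field_derivative u z * ((\<Sum>a\<leftarrow>xs. 1 / (z - a)) + deriv F z / F z)) (at z)"
        using F(2) by (simp add: ext[of u "\<lambda>w. linear_factors S xs w * F w"])
      then have "cmod (deriv u z) = cmod (u z) * cmod ((\<Sum>a\<leftarrow>xs. 1 / (z - a)) + deriv F z / F z)"
        by (simp add: DERIV_imp_deriv norm_mult)
      also have "\<dots> \<le> cmod (u z) * (cmod (\<Sum>a\<leftarrow>xs. 1 / (z - a)) + cmod (deriv F z / F z))"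
        by (intro mult_left_mono norm_triangle_ineq) auto
      also have "cmod (\<Sum>a\<leftarrow>xs. 1 / (z - a)) \<le> (\<Sum>a\<leftarrow>xs. 1 / cmod (z - a))"
        by (induction xs) (auto simp: norm_divide intro: order_trans[OF norm_triangle_ineq])
      finally show ?thesis using dF by (simp add: mult_left_mono add.commute order_trans)
    qed
    ultimately show "\<exists>xs. real (length xs) \<le> 6 * E * R \<and>
      (\<forall>z. cmod z \<le> R \<longrightarrow> u z = 0 \<longrightarrow> z \<in> set xs) \<and>
      (\<forall>z. cmod z \<le> R \<longrightarrow> u z \<noteq> 0 \<longrightarrow> z \<notin> set xs \<and> cmod (deriv u z) \<le> cmod (u z) * (6 * E + (\<Sum>a\<leftarrow>xs. 1 / cmod (z - a))))"
      by blast
  qed (use E in simp)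
qed

section \<open>Circles that stay away from the zeros\<close>

text \<open>Pigeonhole: n + 1 candidate radii in the interval have mutual distance at least 2
  \<delta>, so each of the n points spoils at most one of them.\<close>

lemma radius_avoiding_points:
  fixes xs :: "complex list" and R :: real
  defines "\<delta> \<equiv> 1 / (2 * (real (length xs) + 1))"
  obtains r where "R \<le> r" "r \<le> R + 1" "\<And>a. a \<in> set xs \<Longrightarrow> \<delta> \<le> \<bar>r - cmod a\<bar>"
proof -
  let ?n = "length xs"
  have \<delta>: "\<delta> > 0" "(2 * real ?n + 2) * \<delta> = 1" by (auto simp: \<delta>_def field_simps add_pos_nonneg)
  define p where "p i = R + (2 * real i + 1) * \<delta>" for i :: nat
  have "\<exists>i\<le>?n. \<forall>a\<in>set xs. \<delta> \<le> \<bar>p i - cmod a\<bar>"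
  proof (rule ccontr)
    assume "\<not> ?thesis"
    then have "\<forall>i. \<exists>a. i \<le> ?n \<longrightarrow> a \<in> set xs \<and> \<bar>p i - cmod a\<bar> < \<delta>" by (meson not_le)
    then obtain c where c: "\<And>i. i \<le> ?n \<Longrightarrow> c i \<in> set xs \<and> \<bar>p i - cmod (c i)\<bar> < \<delta>" by metis
    have "inj_on c {..?n}"
    proof (rule inj_onI, rule ccontr)
      fix i j assume ij: "i \<in> {..?n}" "j \<in> {..?n}" "c i = c j" "i \<noteq> j"
      then have "\<bar>p i - p j\<bar> < 2 * \<delta>" using c[of i] c[of j] by auto
      moreover have "p i - p j = 2 * (real i - real j) * \<delta>" by (simp add: p_def algebra_simps)
      then have "\<bar>p i - p j\<bar> = \<bar>2 * (real i - real j)\<bar> * \<delta>" using \<delta> by (simp only: abs_mult abs_of_pos)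
      ultimately have "\<bar>2 * (real i - real j)\<bar> < 2" using \<delta> by (simp only: mult_less_cancel_right_pos)
      then have "real i < real (Suc j)" "real j < real (Suc i)" by (auto simp: abs_less_iff)
      then have "i < Suc j" "j < Suc i" by (simp_all only: of_nat_less_iff)
      with ij(4) show False by simp
    qed
    then have "card {..?n} \<le> card (set xs)" using c by (intro card_inj_on_le[of c]) auto
    also have "\<dots> \<le> ?n" by (rule card_length)
    finally show False by simp
  qed
  then obtain i where i: "i \<le> ?n" "\<forall>a\<in>set xs. \<delta> \<le> \<bar>p i - cmod a\<bar>" by blast
  have "(2 * real i + 1) * \<delta> \<le> (2 * real ?n + 2) * \<delta>" using i \<delta> by (intro mult_right_mono) auto
  then have "p i \<le> R + 1" using \<delta> by (simp add: p_def)
  moreover have "R \<le> p i" using \<delta> by (simp add: p_def)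
  ultimately show ?thesis using that i by blast
qed

text \<open>The listed zeros of all functions together number O(R), so some circle keeps a distance
  of order 1 / R from each. There every term 1 / |z - a| is O(R) and each sum has O(R) terms, whence
  R^2.\<close>

lemma logarithmic_derivatives_on_circles:
  fixes u :: "nat \<Rightarrow> complex \<Rightarrow> complex" and N :: nat
  assumes hol: "\<And>i. i < N \<Longrightarrow> u i holomorphic_on UNIV" and A: "A \<ge> 0"
    and gr: "\<And>i z. i < N \<Longrightarrow> cmod (u i z) \<le> exp (A * (1 + cmod z))"
    and u0: "\<And>i. i < N \<Longrightarrow> u i 0 \<noteq> 0"
  obtains C where "C \<ge> 1" "\<And>R. R \<ge> 1 \<Longrightarrow> \<exists>r. R \<le> r \<and> r \<le> R + 1 \<and>
    (\<forall>i<N. \<forall>z. cmod z = r \<longrightarrow> u i z \<noteq> 0 \<and> cmod (deriv (u i) z) \<le> C * R\<^sup>2 * cmod (u i z))"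
proof -
  define good where "good C R i xs \<longleftrightarrow> real (length xs) \<le> C * R \<and>
    (\<forall>z. cmod z \<le> R \<longrightarrow> u i z = 0 \<longrightarrow> z \<in> set xs) \<and>
    (\<forall>z. cmod z \<le> R \<longrightarrow> u i z \<noteq> 0 \<longrightarrow> z \<notin> set xs \<and>
       cmod (deriv (u i) z) \<le> cmod (u i z) * (C + (\<Sum>a\<leftarrow>xs. 1 / cmod (z - a))))" for C R i xs
  have "\<exists>C\<ge>0. \<forall>R\<ge>1. \<exists>xs. good C R i xs" if "i < N" for i
    using logarithmic_derivative_bound[OF hol[OF that] A gr[OF that] u0[OF that]] unfolding good_def by metis
  then obtain c where c: "\<And>i. i < N \<Longrightarrow> c i \<ge> 0" "\<And>i R. i < N \<Longrightarrow> R \<ge> 1 \<Longrightarrow> \<exists>xs. good (c i) R i xs"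
    by metis
  define D where "D = (\<Sum>i<N. c i)"
  have cD: "c i \<le> D" if "i < N" for i unfolding D_def using c(1) that by (intro member_le_sum) auto
  have D0: "D \<ge> 0" unfolding D_def using c by (intro sum_nonneg) auto
  define C where "C = 1 + D + 2 * D * (2 * (2 * D + 1))"
  show ?thesis
  proof (rule that[of C])
    show "C \<ge> 1" using D0 by (simp add: C_def)
    fix R :: real assume R: "R \<ge> 1"
    \<comment> \<open>Zeros are listed for \<open>R + 1\<close> because the circle may have any
      radius up to that.\<close>
    have "\<exists>xs. good (c i) (R + 1) i xs" if "i < N" for i using c(2)[OF that, of "R + 1"] R by simp
    then obtain xs where xs: "\<And>i. i < N \<Longrightarrow> good (c i) (R + 1) i (xs i)" by metis
    define ys where "ys = concat (map xs [0..<N])"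
    have "real (length ys) = (\<Sum>i<N. real (length (xs i)))"
      by (simp add: ys_def length_concat sum_list_sum_nth o_def atLeast0LessThan comp_def)
    also have "\<dots> \<le> (\<Sum>i<N. c i * (R + 1))" using xs by (intro sum_mono) (auto simp: good_def)
    also have "\<dots> = D * (R + 1)" by (simp add: D_def sum_distrib_right)
    also have "\<dots> \<le> D * (2 * R)" using D0 R by (intro mult_left_mono) auto
    finally have len: "real (length ys) \<le> 2 * D * R" by simp
    define \<delta> where "\<delta> = 1 / (2 * (real (length ys) + 1))"
    have \<delta>: "\<delta> > 0" by (simp add: \<delta>_def add_nonneg_pos)
    obtain r where r: "R \<le> r" "r \<le> R + 1" "\<And>a. a \<in> set ys \<Longrightarrow> \<delta> \<le> \<bar>r - cmod a\<bar>"
      using radius_avoiding_points[of R ys] unfolding \<delta>_def by metis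
    have "u i z \<noteq> 0 \<and> cmod (deriv (u i) z) \<le> C * R\<^sup>2 * cmod (u i z)" if i: "i < N" and z: "cmod z = r" for i z
    proof -
      have sub: "set (xs i) \<subseteq> set ys" using i by (auto simp: ys_def)
      have far: "\<delta> \<le> cmod (z - a)" if "a \<in> set (xs i)" for a
      proof -
        have "\<delta> \<le> \<bar>r - cmod a\<bar>" using r(3) sub that by blast
        also have "\<dots> \<le> cmod (z - a)" using norm_triangle_ineq3[of z a] z by simp
        finally show ?thesis .
      qed
      have zR: "cmod z \<le> R + 1" using z r by simp
      have "z \<notin> set (xs i)" using far[of z] \<delta> by auto
      then have nz: "u i z \<noteq> 0" using xs[OF i] zR unfolding good_def by blast
      then have "cmod (deriv (u i) z) \<le> cmod (u i z) * (c i + (\<Sum>a\<leftarrow>xs i. 1 / cmod (z - a)))"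
        using xs[OF i] zR unfolding good_def by blast
      also have "(\<Sum>a\<leftarrow>xs i. 1 / cmod (z - a)) \<le> (\<Sum>a\<leftarrow>xs i. 1 / \<delta>)"
      proof (rule sum_list_mono)
        fix a assume "a \<in> set (xs i)"
        from far[OF this] show "1 / cmod (z - a) \<le> 1 / \<delta>" using \<delta> by (intro divide_left_mono) (auto intro!: mult_pos_pos)
      qed
      also have "\<dots> = real (length (xs i)) * (1 / \<delta>)" by (simp add: sum_list_triv)
      also have "\<dots> \<le> (2 * D * R) * (1 / \<delta>)"
      proof (intro mult_right_mono)
        have "real (length (xs i)) \<le> c i * (R + 1)" using xs[OF i] by (simp add: good_def)
        also have "\<dots> \<le> D * (2 * R)" using cD[OF i] c(1)[OF i] D0 R by (intro mult_mono) auto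
        finally show "real (length (xs i)) \<le> 2 * D * R" by simp
      qed (use \<delta> in simp)
      also have "1 / \<delta> \<le> 2 * (2 * D * R + R)" using len R by (simp add: \<delta>_def)
      finally have dle: "cmod (deriv (u i) z) \<le> cmod (u i z) * (c i + 2 * D * R * (2 * (2 * D * R + R)))"
        using D0 R by (simp add: mult_left_mono)
      have "c i + 2 * D * R * (2 * (2 * D * R + R)) = c i + 2 * D * (2 * (2 * D + 1)) * R\<^sup>2"
        by (simp add: algebra_simps power2_eq_square)
      also have "\<dots> \<le> D * R\<^sup>2 + 2 * D * (2 * (2 * D + 1)) * R\<^sup>2"
      proof -
        have "c i * 1 \<le> D * R\<^sup>2" using cD[OF i] D0 R by (intro mult_mono) (auto simp: power2_eq_square mult_ge1_I)
        then show ?thesis by simp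
      qed
      also have "D * R\<^sup>2 + 2 * D * (2 * (2 * D + 1)) * R\<^sup>2 \<le> C * R\<^sup>2" by (simp add: C_def algebra_simps)
      finally have "cmod (u i z) * (c i + 2 * D * R * (2 * (2 * D * R + R))) \<le> cmod (u i z) * (C * R\<^sup>2)"
        by (intro mult_left_mono) auto
      with dle have "cmod (deriv (u i) z) \<le> C * R\<^sup>2 * cmod (u i z)" by (simp add: mult_ac)
      with nz show ?thesis by blast
    qed
    then show "\<exists>r. R \<le> r \<and> r \<le> R + 1 \<and>
      (\<forall>i<N. \<forall>z. cmod z = r \<longrightarrow> u i z \<noteq> 0 \<and> cmod (deriv (u i) z) \<le> C * R\<^sup>2 * cmod (u i z))"
      using r by blast
  qed
qed

subsection \<open>Entire functions with multiple zeros\<close>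

lemma entire_power_series:
  assumes "f holomorphic_on UNIV"
  shows "(\<lambda>n. (deriv ^^ n) f a / fact n * (w - a) ^ n) sums f w"
proof (rule holomorphic_power_series)
  show "f holomorphic_on ball a (cmod (w - a) + 1)" using assms holomorphic_on_subset by blast
qed (simp add: dist_norm norm_minus_commute)

text \<open>The degenerate case, with \<open>P\<close> identically 0. \<open>G\<close> is a
  polynomial of degree at most \<open>k\<close>; if it is not constant it has a zero, where the
  multiplicity kills every Taylor coefficient.\<close>

lemma higher_deriv_eq_zero_constant:
  assumes hol: "G holomorphic_on UNIV" and z: "\<And>z. (deriv ^^ (k + 1)) G z = 0"
    and van: "\<And>z. G z = 0 \<Longrightarrow> vanishes_to_order G z (k + 1)"
  shows "G constant_on UNIV"
proof -
  have high: "(deriv ^^ n) G z = 0" if "n > k" for n z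
  proof -
    have "(deriv ^^ n) G = (deriv ^^ (n - (k + 1) + (k + 1))) G" using that by simp
    also have "\<dots> = (deriv ^^ (n - (k + 1))) ((deriv ^^ (k + 1)) G)" by (simp only: funpow_add o_apply)
    also have "(deriv ^^ (k + 1)) G = (\<lambda>_. 0)" using z by (simp add: fun_eq_iff)
    finally show ?thesis by simp
  qed
  define a where "a n = (deriv ^^ n) G 0 / fact n" for n
  have Gp: "G w = (\<Sum>n\<le>k. a n * w ^ n)" for w
  proof -
    have "(\<lambda>n. a n * w ^ n) sums G w" using entire_power_series[OF hol, of 0 w] by (simp add: a_def)
    moreover have "(\<lambda>n. a n * w ^ n) sums (\<Sum>n\<le>k. a n * w ^ n)"
      by (rule sums_finite) (use high in \<open>auto simp: a_def not_le\<close>)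
    ultimately show ?thesis using sums_unique2 by blast
  qed
  show ?thesis
  proof (cases "\<exists>i\<in>{1..k}. a i \<noteq> 0")
    case True
    then obtain z0 where "(\<Sum>n\<le>k. a n * z0 ^ n) = 0" using Cauchy_Integral_Formula.fundamental_theorem_of_algebra by blast
    then have "vanishes_to_order G z0 (k + 1)" using van Gp by simp
    then have "(deriv ^^ n) G z0 = 0" for n
      using high[of n z0] by (cases "n \<le> k") (auto simp: vanishes_to_order_def)
    then have "(\<lambda>n. 0) sums G w" for w using entire_power_series[OF hol, of z0 w] by simp
    then have "G w = 0" for w using sums_0 sums_unique2 by blast
    then show ?thesis by (auto simp: constant_on_def)
  next
    case False
    have "G w = a 0" for w
    proof -
      have "G w = (\<Sum>n\<in>{0}. a n * w ^ n)" unfolding Gp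
        using False by (intro sum.mono_neutral_right) auto
      then show ?thesis by simp
    qed
    then show ?thesis by (auto simp: constant_on_def)
  qed
qed

section \<open>Comparison of zero orders and entire quotients\<close>

lemma order_factor:
  assumes hol: "u holomorphic_on UNIV" and low: "\<And>l. l < q \<Longrightarrow> (deriv ^^ l) u z = 0"
    and nz: "(deriv ^^ q) u z \<noteq> 0"
  shows "\<exists>r>0. \<exists>h. h holomorphic_on ball z r \<and> (\<forall>w\<in>ball z r. u w = (w - z) ^ q * h w \<and> h w \<noteq> 0)"
proof (cases "q = 0")
  case True
  then have "u z \<noteq> 0" using nz by simp
  moreover have "isCont u z" using holomorphic_on_imp_continuous_on[OF hol] by (simp add: continuous_on_eq_continuous_at)
  ultimately obtain r where "r > 0" "\<And>w. dist z w < r \<Longrightarrow> u w \<noteq> 0"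
    using continuous_at_avoid[of z u 0] by auto
  then show ?thesis using True holomorphic_on_subset[OF hol] by (intro exI[of _ r] conjI exI[of _ u]) auto
next
  case False
  have uz: "u z = 0" using low[of 0] False by simp
  obtain h r where hr: "0 < r" "h holomorphic_on ball z r"
    "\<And>w. w \<in> ball z r \<Longrightarrow> u w - u z = (w - z) ^ q * h w" "\<And>w. w \<in> ball z r \<Longrightarrow> h w \<noteq> 0"
    by (rule holomorphic_factor_order_of_zero[OF hol open_UNIV, of z q]) (use low nz False in auto)
  then show ?thesis using uz by (intro exI[of _ r] conjI exI[of _ h]) auto
qed

lemma least_nonvanishing_derivative:
  assumes hol: "u holomorphic_on UNIV" and nz: "u w \<noteq> 0"
  obtains q where "\<And>l. l < q \<Longrightarrow> (deriv ^^ l) u z = 0" "(deriv ^^ q) u z \<noteq> 0"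
proof -
  have "\<exists>q. (deriv ^^ q) u z \<noteq> 0"
  proof (rule ccontr)
    assume "\<not> ?thesis"
    then have "(\<lambda>n. 0) sums u w" using entire_power_series[OF hol, of z w] by simp
    then have "u w = 0" using sums_0 sums_unique2 by blast
    with nz show False ..
  qed
  then show ?thesis using that[of "LEAST q. (deriv ^^ q) u z \<noteq> 0"]
    by (metis (mono_tags, lifting) LeastI_ex not_less_Least)
qed

text \<open>The inequality of orders leaves a spare power e >= 0 of w - z. The cofactor
  \<open>p\<close> may have zeros, so any lower bound \<open>q3\<close> for the order of
  \<open>P\<close> will do, including 0 with p = P.\<close>

lemma local_quotient:
  assumes G: "G holomorphic_on UNIV" "\<And>l. l < q1 \<Longrightarrow> (deriv ^^ l) G z = 0" "(deriv ^^ q1) G z \<noteq> 0"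
    and K: "K holomorphic_on UNIV" "\<And>l. l < q2 \<Longrightarrow> (deriv ^^ l) K z = 0" "(deriv ^^ q2) K z \<noteq> 0"
    and P: "r > 0" "p holomorphic_on ball z r" "\<And>w. w \<in> ball z r \<Longrightarrow> P w = (w - z) ^ q3 * p w"
    and le: "\<alpha> * q1 + \<beta> * q2 \<le> \<nu> * q3"
  shows "\<exists>r>0. \<exists>h. h holomorphic_on ball z r \<and> (\<forall>w\<in>ball z r. P w ^ \<nu> = h w * (G w ^ \<alpha> * K w ^ \<beta>))"
proof -
  obtain r1 g where g: "r1 > 0" "g holomorphic_on ball z r1"
    "\<And>w. w \<in> ball z r1 \<Longrightarrow> G w = (w - z) ^ q1 * g w \<and> g w \<noteq> 0" using order_factor[OF G] by blast
  obtain r2 \<kappa> where \<kappa>: "r2 > 0" "\<kappa> holomorphic_on ball z r2"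
    "\<And>w. w \<in> ball z r2 \<Longrightarrow> K w = (w - z) ^ q2 * \<kappa> w \<and> \<kappa> w \<noteq> 0" using order_factor[OF K] by blast
  obtain e where e: "\<nu> * q3 = \<alpha> * q1 + \<beta> * q2 + e" using le le_iff_add by blast
  define r' where "r' = min r (min r1 r2)"
  have sub: "ball z r' \<subseteq> ball z r" "ball z r' \<subseteq> ball z r1" "ball z r' \<subseteq> ball z r2" by (auto simp: r'_def)
  define h where "h w = (w - z) ^ e * p w ^ \<nu> / (g w ^ \<alpha> * \<kappa> w ^ \<beta>)" for w
  have "h holomorphic_on ball z r'" unfolding h_def
    using holomorphic_on_subset[OF P(2) sub(1)] holomorphic_on_subset[OF g(2) sub(2)]
      holomorphic_on_subset[OF \<kappa>(2) sub(3)] g(3) \<kappa>(3) sub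
    by (intro holomorphic_intros) auto
  moreover have "P w ^ \<nu> = h w * (G w ^ \<alpha> * K w ^ \<beta>)" if w: "w \<in> ball z r'" for w
  proof -
    have w': "w \<in> ball z r" "w \<in> ball z r1" "w \<in> ball z r2" using w sub by auto
    have "P w ^ \<nu> = (w - z) ^ (\<nu> * q3) * p w ^ \<nu>"
      using P(3)[OF w'(1)] by (simp add: power_mult_distrib power_mult[symmetric] mult.commute)
    also have "(w - z) ^ (\<nu> * q3) = (w - z) ^ (q1 * \<alpha>) * (w - z) ^ (q2 * \<beta>) * (w - z) ^ e"
      unfolding e by (simp add: power_add mult.commute)
    finally show ?thesis using g(3)[OF w'(2)] \<kappa>(3)[OF w'(3)]
      by (simp add: h_def power_mult_distrib power_mult[symmetric])
  qed
  ultimately show ?thesis using P(1) g(1) \<kappa>(1) by (intro exI[of _ r'] conjI exI[of _ h]) (auto simp: r'_def)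
qed

text \<open>Two local quotients agree off the zeros of \<open>Q\<close>, which are isolated, and
  hence everywhere by continuity; so they glue.\<close>

lemma entire_quotient:
  fixes A Q :: "complex \<Rightarrow> complex"
  assumes Q: "Q holomorphic_on UNIV" "Q w0 \<noteq> 0"
    and loc: "\<And>z. \<exists>r>0. \<exists>h. h holomorphic_on ball z r \<and> (\<forall>w\<in>ball z r. A w = h w * Q w)"
  obtains H where "H holomorphic_on UNIV" "\<And>z. A z = H z * Q z"
proof -
  obtain r h where r: "\<And>z. r z > (0::real)" and h: "\<And>z. h z holomorphic_on ball z (r z)"
    and eq: "\<And>z w. w \<in> ball z (r z) \<Longrightarrow> A w = h z w * Q w"
    using loc by metis
  define H where "H z = h z z" for z
  have agree: "h z w = H w" if w: "w \<in> ball z (r z)" for z w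
  proof -
    define U where "U = ball z (r z) \<inter> ball w (r w)"
    have "open U" "w \<in> U" using w r by (auto simp: U_def)
    have cont: "isCont (h x) w" if "w \<in> ball x (r x)" for x
      using holomorphic_on_imp_continuous_on[OF h[of x]] that by (simp add: continuous_on_eq_continuous_at)
    have "((\<lambda>v. h z v - h w v) \<longlongrightarrow> h z w - h w w) (at w)"
      using cont[OF w] cont[of w] r by (intro tendsto_intros) (auto simp: isCont_def)
    moreover have "\<forall>\<^sub>F v in at w. h z v - h w v = 0"
    proof -
      have "\<forall>\<^sub>F v in at w. v \<in> U" using \<open>open U\<close> \<open>w \<in> U\<close> by (rule eventually_at_in_open')
      moreover have "\<forall>\<^sub>F v in at w. Q v \<noteq> 0"
        using non_zero_neighbour_alt[of Q UNIV w w0] Q by (auto elim: eventually_mono)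
      ultimately show ?thesis
      proof eventually_elim
        case (elim v)
        then have "h z v * Q v = h w v * Q v" using eq[of v z] eq[of v w] by (simp add: U_def)
        then show ?case using elim by simp
      qed
    qed
    then have "((\<lambda>v. h z v - h w v) \<longlongrightarrow> 0) (at w)" by (rule tendsto_eventually)
    ultimately have "h z w - h w w = 0" using tendsto_unique by (metis at_neq_bot)
    then show ?thesis by (simp add: H_def)
  qed
  have "H holomorphic_on ball z (r z)" for z
    using h[of z] by (rule holomorphic_transform) (use agree in auto)
  then have "H holomorphic_on (\<Union>z\<in>UNIV. ball z (r z))" by (intro holomorphic_on_UN_open) auto
  moreover have "(\<Union>z\<in>UNIV. ball z (r z)) = UNIV" using r by (auto intro!: exI[where x = x for x])
  ultimately have "H holomorphic_on UNIV" by simp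
  moreover have "A z = H z * Q z" for z using eq[of z z] r by (simp add: H_def)
  ultimately show ?thesis using that by blast
qed

section \<open>Polynomial growth and degrees\<close>

lemma entire_polynomial_growth:
  assumes hol: "f holomorphic_on UNIV" and B: "\<And>z. r0 \<le> cmod z \<Longrightarrow> cmod (f z) \<le> B * cmod z ^ n"
  obtains p where "f = poly p"
proof
  show "f = poly (\<Sum>k\<le>n. monom ((deriv ^^ k) f 0 / fact k) k)"
    using Liouville_polynomial[OF hol B] by (auto simp: fun_eq_iff poly_sum poly_monom)
qed

text \<open>Maximum modulus with R = |z|: the assumed bound is in terms of R, not of the larger
  radius r, so nothing is lost in moving inwards.\<close>

lemma growth_from_circles:
  assumes hol: "f holomorphic_on UNIV"
    and B: "\<And>R. R \<ge> 1 \<Longrightarrow> \<exists>r. R \<le> r \<and> (\<forall>z. cmod z = r \<longrightarrow> cmod (f z) \<le> B * R ^ n)"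
    and z: "1 \<le> cmod z"
  shows "cmod (f z) \<le> B * cmod z ^ n"
proof -
  obtain r where r: "cmod z \<le> r" "\<And>w. cmod w = r \<Longrightarrow> cmod (f w) \<le> B * cmod z ^ n"
    using B[OF z] by blast
  show ?thesis by (rule maximum_modulus_cball[OF hol r(2,1)]) (use r(1) z in auto)
qed

lemma poly_bounded_below:
  fixes h :: "complex poly"
  assumes "h \<noteq> 0"
  obtains b r where "b > 0" "\<And>z. r \<le> cmod z \<Longrightarrow> b \<le> cmod (poly h z)"
proof (cases h)
  case (pCons a p)
  show ?thesis
  proof (cases "p = 0")
    case True
    then show ?thesis using that[of "cmod a"] pCons assms by auto
  next
    case False
    obtain r where "\<forall>z. r \<le> cmod z \<longrightarrow> 1 \<le> cmod (poly (pCons a p) z)" using poly_infinity[OF False] by blast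
    then show ?thesis using that[of 1 r] pCons by auto
  qed
qed

lemma higher_deriv_poly:
  fixes p :: "complex poly"
  shows "(deriv ^^ n) (poly p) = poly ((pderiv ^^ n) p)"
proof (induction n)
  case (Suc n)
  have "deriv (poly q) = poly (pderiv q)" for q :: "complex poly"
    by (auto simp: fun_eq_iff intro!: DERIV_imp_deriv poly_DERIV)
  with Suc show ?case by simp
qed simp

lemma degree_higher_pderiv':
  fixes p :: "complex poly"
  shows "degree ((pderiv ^^ n) p) = degree p - n"
  by (induction n) (auto simp: degree_pderiv)

text \<open>Put w = g^(k), of degree at least 1. The left side has degree \<nu> (deg w - 1) <=
  (\<alpha> + \<beta>) (deg w - 1), which is less than \<alpha> deg g + \<beta> deg w, a lower bound
  for the degree of the right side.\<close>

lemma polynomial_degree_contradiction: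
  fixes g h :: "complex poly"
  assumes eq: "((pderiv ^^ (k + 1)) g) ^ \<nu> = h * (g ^ \<alpha> * ((pderiv ^^ k) g - [:c:]) ^ \<beta>)"
    and nz: "(pderiv ^^ (k + 1)) g \<noteq> 0" and \<alpha>: "\<alpha> \<ge> 1" and le: "\<nu> \<le> \<alpha> + \<beta>"
  shows False
proof -
  define w where "w = (pderiv ^^ k) g"
  have "pderiv w \<noteq> 0" using nz by (simp add: w_def)
  then have dw: "degree w > 0" using pderiv_eq_0_iff by blast
  have dwn: "degree w = degree g - k" by (simp add: w_def degree_higher_pderiv')
  have dc: "degree (w - [:c:]) = degree w"
    using degree_add_eq_left[of "- [:c:]" w] dw by (simp only: diff_conv_add_uminus) simp
  have "h * (g ^ \<alpha> * (w - [:c:]) ^ \<beta>) \<noteq> 0" using eq nz unfolding w_def by (metis power_not_zero)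
  then have nz': "h \<noteq> 0" "g ^ \<alpha> \<noteq> 0" "(w - [:c:]) ^ \<beta> \<noteq> 0" "g \<noteq> 0" "w - [:c:] \<noteq> 0"
    using dw dc dwn by auto
  have "\<nu> * (degree w - 1) = degree (pderiv w ^ \<nu>)"
    using \<open>pderiv w \<noteq> 0\<close> by (simp add: degree_power_eq degree_pderiv)
  also have "\<dots> = degree h + (\<alpha> * degree g + \<beta> * degree w)"
    using eq nz' dc by (simp add: w_def[symmetric] degree_mult_eq degree_power_eq)
  finally have e: "\<nu> * (degree w - 1) = degree h + (\<alpha> * degree g + \<beta> * degree w)" .
  have "\<nu> * (degree w - 1) \<le> (\<alpha> + \<beta>) * (degree w - 1)" using le by (intro mult_right_mono) auto
  also have "\<dots> = \<alpha> * (degree w - 1) + \<beta> * (degree w - 1)" by (rule add_mult_distrib)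
  also have "\<dots> < \<alpha> * degree g + \<beta> * degree w"
  proof (rule add_less_le_mono)
    show "\<alpha> * (degree w - 1) < \<alpha> * degree g" using \<alpha> dw dwn by auto
  qed auto
  finally show False using e by linarith
qed

text \<open>Used with \<open>x\<close>, \<open>y\<close>, \<open>\<kappa>\<close>, \<open>p\<close> the moduli of \<open>G\<close>, its \<open>k\<close>-th derivative, \<open>K\<close>, \<open>K'\<close>.
  If \<open>y \<le> e/2\<close> then \<open>\<kappa> \<ge> e/2\<close>; otherwise \<open>x\<close> is bounded below by a negative power of \<open>L\<close>.\<close>
lemma quotient_estimate:
  fixes e :: real and k \<alpha> \<beta> \<nu> :: nat
  assumes e: "e > 0" and ab: "1 \<le> \<alpha>" "\<alpha> \<le> \<nu>" "\<beta> \<le> \<nu>" "\<nu> < \<alpha> + \<beta>"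
  obtains C where "C > 0"
    "\<And>L x y \<kappa> p. 1 \<le> L \<Longrightarrow> 0 < x \<Longrightarrow> 0 \<le> y \<Longrightarrow> 0 < \<kappa> \<Longrightarrow> 0 \<le> p \<Longrightarrow> y \<le> L ^ k * x \<Longrightarrow> p \<le> L * y \<Longrightarrow>
      p \<le> L * \<kappa> \<Longrightarrow> e - y \<le> \<kappa> \<Longrightarrow> p ^ \<nu> * max 1 x \<le> C * L ^ (2 * (k + 1) * \<nu>) * (x ^ \<alpha> * \<kappa> ^ \<beta>)"
proof -
  define \<eta> where "\<eta> = e / 2"
  have \<eta>: "\<eta> > 0" using e by (simp add: \<eta>_def)
  \<comment> \<open>The surplus of exponents; for the values used later it is m (d - k - 1) -
    d.\<close>
  define s where "s = \<alpha> + \<beta> - \<nu>"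
  have s: "s \<ge> 1" "s \<le> \<nu>" "s + (\<nu> - \<beta>) = \<alpha>" using ab by (auto simp: s_def)
  \<comment> \<open>One summand for each combination of the two cases for y with the two cases for
    x; in the last combination the summand 1 is used.\<close>
  define C where "C = 1 + \<eta> ^ (\<nu> - \<alpha>) / \<eta> ^ \<beta> + \<eta> ^ \<nu> / \<eta> ^ \<beta> + (1 / \<eta>) ^ s"
  have Cge: "C \<ge> 1" "C \<ge> \<eta> ^ (\<nu> - \<alpha>) / \<eta> ^ \<beta>" "C \<ge> \<eta> ^ \<nu> / \<eta> ^ \<beta>" "C \<ge> (1 / \<eta>) ^ s"
    using \<eta> by (auto simp: C_def)
  show ?thesis
  proof (rule that[of C])
    fix L x y \<kappa> p :: real
    assume L: "1 \<le> L" and x: "0 < x" and y: "0 \<le> y" and \<kappa>: "0 < \<kappa>" and p: "0 \<le> p"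
      and yx: "y \<le> L ^ k * x" and py: "p \<le> L * y" and p\<kappa>: "p \<le> L * \<kappa>" and e\<kappa>: "e - y \<le> \<kappa>"
    \<comment> \<open>A generous common bound for all powers of L below.\<close>
    define W where "W = L ^ (2 * (k + 1) * \<nu>)"
    have LW: "L ^ j \<le> W" if "j \<le> 2 * (k + 1) * \<nu>" for j unfolding W_def using L that by (intro power_increasing)
    have W: "W \<ge> 1" using LW[of 0] by simp
    have px: "p \<le> L ^ (k + 1) * x"
    proof -
      have "p \<le> L * (L ^ k * x)" using py yx L by (meson mult_left_mono order_trans zero_le_one)
      then show ?thesis by (simp add: mult_ac)
    qed
    have fin: "p ^ \<nu> * max 1 x \<le> C * W * (x ^ \<alpha> * \<kappa> ^ \<beta>)"
      if "p ^ \<nu> \<le> C * W * (x ^ \<alpha> * \<kappa> ^ \<beta>)" "x \<ge> 1 \<Longrightarrow> p ^ \<nu> * x \<le> C * W * (x ^ \<alpha> * \<kappa> ^ \<beta>)"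
      using that by (cases "x \<ge> 1") auto
    have "p ^ \<nu> * max 1 x \<le> C * W * (x ^ \<alpha> * \<kappa> ^ \<beta>)"
    proof (cases "y \<le> \<eta>")
      case True
      then have \<kappa>\<eta>: "\<eta> \<le> \<kappa>" using e\<kappa> by (simp add: \<eta>_def)
      have p\<eta>: "p \<le> L * \<eta>" using py True L by (meson mult_left_mono order_trans zero_le_one)
      have \<kappa>b: "1 \<le> \<kappa> ^ \<beta> / \<eta> ^ \<beta>" using \<kappa>\<eta> \<eta> by (simp add: power_mono)
      show ?thesis
      proof (rule fin)
        \<comment> \<open>Of the \<nu> factors p, \<alpha> are paid for by x and the rest by the
          constant bound p <= L \<eta>; the powers of \<kappa> come free because \<kappa> >=
          \<eta>.\<close>
        have "p ^ \<nu> = p ^ \<alpha> * p ^ (\<nu> - \<alpha>)" using ab by (simp flip: power_add)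
        also have "\<dots> \<le> (L ^ (k + 1) * x) ^ \<alpha> * (L * \<eta>) ^ (\<nu> - \<alpha>)"
          using p px p\<eta> L x by (intro mult_mono power_mono) auto
        also have "\<dots> = L ^ ((k + 1) * \<alpha> + (\<nu> - \<alpha>)) * x ^ \<alpha> * \<eta> ^ (\<nu> - \<alpha>)"
          by (simp only: power_mult_distrib power_mult power_add[of L "(k + 1) * \<alpha>"]) (simp only: mult_ac)
        also have "\<dots> \<le> W * x ^ \<alpha> * \<eta> ^ (\<nu> - \<alpha>)"
        proof (intro mult_right_mono LW)
          have "(k + 1) * \<alpha> \<le> (k + 1) * \<nu>" using ab by (intro mult_left_mono) auto
          then show "(k + 1) * \<alpha> + (\<nu> - \<alpha>) \<le> 2 * (k + 1) * \<nu>" by (simp add: algebra_simps)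
        qed (use x \<eta> in auto)
        also have "\<dots> * 1 \<le> W * x ^ \<alpha> * \<eta> ^ (\<nu> - \<alpha>) * (\<kappa> ^ \<beta> / \<eta> ^ \<beta>)"
          using \<kappa>b W x \<eta> by (intro mult_left_mono) auto
        also have "\<dots> = (\<eta> ^ (\<nu> - \<alpha>) / \<eta> ^ \<beta>) * (W * (x ^ \<alpha> * \<kappa> ^ \<beta>))" by simp
        also have "\<dots> \<le> C * (W * (x ^ \<alpha> * \<kappa> ^ \<beta>))" using Cge W x \<kappa> by (intro mult_right_mono) auto
        finally show "p ^ \<nu> \<le> C * W * (x ^ \<alpha> * \<kappa> ^ \<beta>)" by (simp add: mult_ac)
      next
        assume x1: "x \<ge> 1"
        have "p ^ \<nu> * x \<le> (L * \<eta>) ^ \<nu> * x ^ \<alpha>"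
          using p p\<eta> L \<eta> x1 ab power_increasing[of 1 \<alpha> x] by (intro mult_mono power_mono) auto
        also have "\<dots> = L ^ \<nu> * (\<eta> ^ \<nu> * x ^ \<alpha>)" by (simp add: power_mult_distrib)
        also have "\<dots> \<le> W * (\<eta> ^ \<nu> * x ^ \<alpha>)" using x \<eta> by (intro mult_right_mono LW) auto
        also have "\<dots> * 1 \<le> W * (\<eta> ^ \<nu> * x ^ \<alpha>) * (\<kappa> ^ \<beta> / \<eta> ^ \<beta>)"
          using \<kappa>b W x \<eta> by (intro mult_left_mono) auto
        also have "\<dots> = (\<eta> ^ \<nu> / \<eta> ^ \<beta>) * (W * (x ^ \<alpha> * \<kappa> ^ \<beta>))" by simp
        also have "\<dots> \<le> C * (W * (x ^ \<alpha> * \<kappa> ^ \<beta>))" using Cge W x \<kappa> by (intro mult_right_mono) auto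
        finally show "p ^ \<nu> * x \<le> C * W * (x ^ \<alpha> * \<kappa> ^ \<beta>)" by (simp add: mult_ac)
      qed
    next
      case False
      \<comment> \<open>Here \<beta> factors are paid for by \<kappa> and the rest by x. The missing
        x^s is supplied by x >= \<eta> / L^k; in the estimate with the extra factor x >= 1, that
        factor is itself at most x^s.\<close>
      have "p ^ \<nu> = p ^ \<beta> * p ^ (\<nu> - \<beta>)" using ab by (simp flip: power_add)
      also have "\<dots> \<le> (L * \<kappa>) ^ \<beta> * (L ^ (k + 1) * x) ^ (\<nu> - \<beta>)"
        using p px p\<kappa> L x \<kappa> by (intro mult_mono power_mono) auto
      also have "\<dots> = L ^ (\<beta> + (k + 1) * (\<nu> - \<beta>)) * (\<kappa> ^ \<beta> * x ^ (\<nu> - \<beta>))"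
        by (simp only: power_mult_distrib power_mult power_add[of L \<beta>]) (simp only: mult_ac)
      finally have pb: "p ^ \<nu> \<le> L ^ (\<beta> + (k + 1) * (\<nu> - \<beta>)) * (\<kappa> ^ \<beta> * x ^ (\<nu> - \<beta>))" .
      have ex: "\<beta> + (k + 1) * (\<nu> - \<beta>) \<le> (k + 1) * \<nu>"
      proof -
        have "\<beta> + (k + 1) * (\<nu> - \<beta>) \<le> (k + 1) * \<beta> + (k + 1) * (\<nu> - \<beta>)" by simp
        also have "\<dots> = (k + 1) * \<nu>" using ab by (simp flip: distrib_left)
        finally show ?thesis .
      qed
      have \<eta>x: "\<eta> \<le> L ^ k * x" using False yx by simp
      show ?thesis
      proof (rule fin)
        have "1 \<le> (L ^ k * x / \<eta>) ^ s" using \<eta>x \<eta> by (intro one_le_power) simp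
        then have "L ^ (\<beta> + (k + 1) * (\<nu> - \<beta>)) * (\<kappa> ^ \<beta> * x ^ (\<nu> - \<beta>)) * 1
          \<le> L ^ (\<beta> + (k + 1) * (\<nu> - \<beta>)) * (\<kappa> ^ \<beta> * x ^ (\<nu> - \<beta>)) * (L ^ k * x / \<eta>) ^ s"
          using L x \<kappa> by (intro mult_left_mono) auto
        also have "\<dots> = L ^ (\<beta> + (k + 1) * (\<nu> - \<beta>) + k * s) * (\<kappa> ^ \<beta> * x ^ (s + (\<nu> - \<beta>))) * (1 / \<eta>) ^ s"
          by (simp add: power_mult_distrib power_mult[symmetric] power_add power_divide mult_ac)
        also have "\<dots> \<le> W * (\<kappa> ^ \<beta> * x ^ (s + (\<nu> - \<beta>))) * (1 / \<eta>) ^ s"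
        proof (intro mult_right_mono LW)
          have "k * s \<le> (k + 1) * \<nu>" using s by (intro mult_mono) auto
          then show "\<beta> + (k + 1) * (\<nu> - \<beta>) + k * s \<le> 2 * (k + 1) * \<nu>" using ex by linarith
        qed (use x \<kappa> \<eta> in auto)
        also have "\<dots> = (1 / \<eta>) ^ s * (W * (x ^ \<alpha> * \<kappa> ^ \<beta>))" using s by (simp add: mult_ac)
        also have "\<dots> \<le> C * (W * (x ^ \<alpha> * \<kappa> ^ \<beta>))" using Cge W x \<kappa> by (intro mult_right_mono) auto
        finally show "p ^ \<nu> \<le> C * W * (x ^ \<alpha> * \<kappa> ^ \<beta>)" using pb by (simp add: mult_ac)
      next
        assume x1: "x \<ge> 1"
        have "p ^ \<nu> * x \<le> L ^ (\<beta> + (k + 1) * (\<nu> - \<beta>)) * (\<kappa> ^ \<beta> * x ^ (\<nu> - \<beta>)) * x ^ s"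
          using pb p L \<kappa> x1 s power_increasing[of 1 s x] by (intro mult_mono) auto
        also have "\<dots> = L ^ (\<beta> + (k + 1) * (\<nu> - \<beta>)) * (x ^ (s + (\<nu> - \<beta>)) * \<kappa> ^ \<beta>)"
          by (simp add: power_add mult_ac)
        also have "\<dots> \<le> W * (x ^ (s + (\<nu> - \<beta>)) * \<kappa> ^ \<beta>)"
          using ex x \<kappa> by (intro mult_right_mono LW) auto
        also have "\<dots> \<le> C * (W * (x ^ (s + (\<nu> - \<beta>)) * \<kappa> ^ \<beta>))" 
          using mult_right_mono[OF Cge(1), of "W * (x ^ (s + (\<nu> - \<beta>)) * \<kappa> ^ \<beta>)"] W x \<kappa> by simp
        finally show "p ^ \<nu> * x \<le> C * W * (x ^ \<alpha> * \<kappa> ^ \<beta>)" using s by (simp add: mult_ac)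
      qed
    qed
    then show "p ^ \<nu> * max 1 x \<le> C * L ^ (2 * (k + 1) * \<nu>) * (x ^ \<alpha> * \<kappa> ^ \<beta>)" by (simp add: W_def)
  qed (use Cge in simp)
qed

lemma higher_deriv_growth:
  assumes hol: "G holomorphic_on UNIV" and B: "B \<ge> 0"
    and gr: "\<And>z. cmod (G z) \<le> exp (B * (1 + cmod z))"
  shows "cmod ((deriv ^^ l) G z) \<le> fact l * exp (2 * B * (1 + cmod z))"
proof -
  have "cmod ((deriv ^^ l) G z) \<le> fact l * exp (2 * B * (1 + cmod z)) / 1 ^ l"
  proof (rule Cauchy_inequality)
    show "G holomorphic_on ball z 1" using hol holomorphic_on_subset by blast
    show "continuous_on (cball z 1) G"
      using holomorphic_on_imp_continuous_on[OF hol] continuous_on_subset by blast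
    fix x assume x: "cmod (z - x) = 1"
    have "cmod x \<le> cmod z + 1" using norm_triangle_ineq2[of x z] x by (simp add: norm_minus_commute)
    then have "1 + cmod x \<le> 2 * (1 + cmod z)" using norm_ge_zero[of z] by argo
    then have "B * (1 + cmod x) \<le> B * (2 * (1 + cmod z))" using B by (intro mult_left_mono)
    then have "exp (B * (1 + cmod x)) \<le> exp (2 * B * (1 + cmod z))" by (simp add: mult_ac)
    then show "cmod (G x) \<le> exp (2 * B * (1 + cmod z))" using gr[of x] by linarith
  qed simp
  then show ?thesis by simp
qed

text \<open>Non-vanishing at 0 is assumed because the counting of zeros compares values on circles
  with the value at the origin; a translation provides it later.\<close>

lemma entire_zeros_contradiction:
  fixes G :: "complex \<Rightarrow> complex" and d k m :: nat and c :: complex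
  defines "K \<equiv> \<lambda>z. (deriv ^^ k) G z - c"
  assumes hol: "G holomorphic_on UNIV" and B: "B \<ge> 0"
    and gr: "\<And>z. cmod (G z) \<le> exp (B * (1 + cmod z))"
    and c: "c \<noteq> 0" and dm: "m * (k + 1) + d < d * m"
    and vG: "\<And>z. G z = 0 \<Longrightarrow> vanishes_to_order G z d"
    and vK: "\<And>z. K z = 0 \<Longrightarrow> vanishes_to_order K z m"
    and G0: "\<And>l. l \<le> k \<Longrightarrow> (deriv ^^ l) G 0 \<noteq> 0" and K0: "K 0 \<noteq> 0"
    and P0: "(deriv ^^ (k + 1)) G w0 \<noteq> 0"
  shows False
proof -
  define P where "P = (deriv ^^ (k + 1)) G"
  have "m > 0" using dm by (cases m) auto
  then obtain m' where m': "m = Suc m'" by (cases m) auto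
  have "m * (k + 1) < m * d" using dm by (simp add: mult.commute)
  then have kd: "k + 1 < d" by (simp only: mult_less_cancel1)
  then obtain e where e: "d = k + 1 + e" using less_imp_add_positive by (metis less_imp_le le_iff_add)
  \<comment> \<open>With e = d - k - 1 and m' = m - 1 these are the exponents of H, free of
    truncated subtraction; the hypothesis \<open>dm\<close> becomes d < m e, that is \<nu> <
    \<alpha> + \<beta>.\<close>
  define \<alpha> \<beta> \<nu> where "\<alpha> = m * e" and "\<beta> = d * m'" and "\<nu> = d * m"
  have "d < m * e" using dm by (simp add: e algebra_simps)
  moreover have "m * e \<le> d * m" by (subst mult.commute[of d], rule mult_le_mono2) (simp add: e)
  moreover have "d * m = d + d * m'" by (simp add: m')
  ultimately have ab: "1 \<le> \<alpha>" "\<alpha> \<le> \<nu>" "\<beta> \<le> \<nu>" "\<nu> < \<alpha> + \<beta>"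
    unfolding \<alpha>_def \<beta>_def \<nu>_def by linarith+
  have hold: "(deriv ^^ l) G holomorphic_on UNIV" for l by (rule holomorphic_higher_deriv[OF hol open_UNIV])
  have holK: "K holomorphic_on UNIV" unfolding K_def by (intro holomorphic_intros hold)
  have dK: "deriv K = P"
  proof
    fix z
    have "((deriv ^^ k) G has_field_derivative deriv ((deriv ^^ k) G) z) (at z)"
      by (rule holomorphic_derivI[OF hold open_UNIV]) simp
    then have "(K has_field_derivative deriv ((deriv ^^ k) G) z - 0) (at z)"
      unfolding K_def by (intro DERIV_diff DERIV_const)
    then show "deriv K z = P z" by (simp add: P_def DERIV_imp_deriv)
  qed
  have dPG: "(deriv ^^ l) P = (deriv ^^ (l + (k + 1))) G" for l unfolding P_def by (simp only: funpow_add o_apply)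
  have dPK: "(deriv ^^ l) P = (deriv ^^ Suc l) K" for l by (simp only: funpow_Suc_right o_apply dK)
  have holP: "P holomorphic_on UNIV" unfolding P_def by (rule hold)

  have loc: "\<exists>r>0. \<exists>h. h holomorphic_on ball z r \<and> (\<forall>w\<in>ball z r. P w ^ \<nu> = h w * (G w ^ \<alpha> * K w ^ \<beta>))" for z
  proof (cases "G z = 0")
    case True
    obtain q where q: "\<And>l. l < q \<Longrightarrow> (deriv ^^ l) G z = 0" "(deriv ^^ q) G z \<noteq> 0"
      using least_nonvanishing_derivative[OF hol, of 0] G0[of 0] by auto
    have "d \<le> q" using vG[OF True] q(2) unfolding vanishes_to_order_def by (meson not_le)
    then obtain j where j: "q = d + j" using le_iff_add by blast
    \<comment> \<open>Since k < d the \<open>k\<close>-th derivative vanishes too, so K z = - c is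
      not 0 and \<open>K\<close> contributes order 0.\<close>
    have "(deriv ^^ k) G z = 0" using vG[OF True] kd by (simp add: vanishes_to_order_def)
    then have Kz: "(deriv ^^ 0) K z \<noteq> 0" using c by (simp add: K_def)
    have qs: "e + j + (k + 1) = q" by (simp add: j e)
    have Plow: "(deriv ^^ l) P z = 0" if "l < e + j" for l
      unfolding dPG using that qs by (intro q(1)) linarith
    have Pnz: "(deriv ^^ (e + j)) P z \<noteq> 0" unfolding dPG qs by (rule q(2))
    obtain r p where p: "r > 0" "p holomorphic_on ball z r" "\<And>w. w \<in> ball z r \<Longrightarrow> P w = (w - z) ^ (e + j) * p w"
      using order_factor[OF holP Plow Pnz] by blast
    \<comment> \<open>With q = d + j this is m e (d + j) <= d m (e + j), which reduces to e <=
      d.\<close>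
    have le: "\<alpha> * q + \<beta> * 0 \<le> \<nu> * (e + j)"
    proof -
      have "e * j \<le> d * j" by (rule mult_le_mono1) (simp add: e)
      then have "e * (d + j) \<le> d * (e + j)" by (simp add: algebra_simps)
      then have "m * (e * (d + j)) \<le> m * (d * (e + j))" by (rule mult_le_mono2)
      then show ?thesis by (simp add: \<alpha>_def \<nu>_def j mult_ac)
    qed
    show ?thesis by (rule local_quotient[OF hol q holK _ Kz p le]) simp_all
  next
    case Gz: False
    show ?thesis
    proof (cases "K z = 0")
      case True
      obtain q where q: "\<And>l. l < q \<Longrightarrow> (deriv ^^ l) K z = 0" "(deriv ^^ q) K z \<noteq> 0"
        using least_nonvanishing_derivative[OF holK K0] by auto
      have "m \<le> q" using vK[OF True] q(2) unfolding vanishes_to_order_def by (meson not_le)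
      then obtain j where j: "q = m + j" using le_iff_add by blast
      have qs: "Suc (m' + j) = q" by (simp add: j m')
      have Plow: "(deriv ^^ l) P z = 0" if "l < m' + j" for l
        unfolding dPK using that qs by (intro q(1)) linarith
      have Pnz: "(deriv ^^ (m' + j)) P z \<noteq> 0" unfolding dPK qs by (rule q(2))
      obtain r p where p: "r > 0" "p holomorphic_on ball z r" "\<And>w. w \<in> ball z r \<Longrightarrow> P w = (w - z) ^ (m' + j) * p w"
        using order_factor[OF holP Plow Pnz] by blast
      have le: "\<alpha> * 0 + \<beta> * q \<le> \<nu> * (m' + j)"
      proof -
        have "m' * (m + j) \<le> m * (m' + j)" by (simp add: m' algebra_simps)
        then have "d * (m' * (m + j)) \<le> d * (m * (m' + j))" by (rule mult_le_mono2)
        then show ?thesis by (simp add: \<beta>_def \<nu>_def j mult_ac)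
      qed
      have Gz0: "(deriv ^^ 0) G z \<noteq> 0" using Gz by simp
      show ?thesis by (rule local_quotient[OF hol _ Gz0 holK q p le]) simp_all
    next
      case False
      have nz: "(deriv ^^ 0) G z \<noteq> 0" "(deriv ^^ 0) K z \<noteq> 0" using Gz False by auto
      have p: "(1::real) > 0" "P holomorphic_on ball z 1" "\<And>w. w \<in> ball z 1 \<Longrightarrow> P w = (w - z) ^ 0 * P w"
        using holomorphic_on_subset[OF holP] by auto
      have le: "\<alpha> * 0 + \<beta> * 0 \<le> \<nu> * 0" by simp
      show ?thesis by (rule local_quotient[OF hol _ nz(1) holK _ nz(2) p le]) simp_all
    qed
  qed
  have holQ: "(\<lambda>z. G z ^ \<alpha> * K z ^ \<beta>) holomorphic_on UNIV" by (intro holomorphic_intros hol holK)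
  have Q0: "G 0 ^ \<alpha> * K 0 ^ \<beta> \<noteq> 0" using G0[of 0] K0 by simp
  obtain H where H: "H holomorphic_on UNIV" "\<And>z. P z ^ \<nu> = H z * (G z ^ \<alpha> * K z ^ \<beta>)"
    using entire_quotient[OF holQ Q0 loc] by metis

  \<comment> \<open>By x <= exp x the constant factor fact k + |c| is absorbed into the
    exponent.\<close>
  define A where "A = 2 * B + (fact k + cmod c)"
  have A: "A \<ge> 0" using B by (simp add: A_def)
  have growA: "X \<le> exp (A * (1 + cmod z))" if "X \<le> (fact k + cmod c) * exp (2 * B * (1 + cmod z))" for X z
  proof -
    have "fact k + cmod c \<le> exp (fact k + cmod c)" using exp_ge_add_one_self[of "fact k + cmod c"] by linarith
    moreover have "(fact k + cmod c) * 1 \<le> (fact k + cmod c) * (1 + cmod z)" by (intro mult_left_mono) auto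
    ultimately have "fact k + cmod c \<le> exp ((fact k + cmod c) * (1 + cmod z))"
      by (simp del: exp_le_cancel_iff) (meson exp_le_cancel_iff order_trans)
    then have "(fact k + cmod c) * exp (2 * B * (1 + cmod z)) \<le>
      exp ((fact k + cmod c) * (1 + cmod z)) * exp (2 * B * (1 + cmod z))" by (intro mult_right_mono) auto
    also have "\<dots> = exp (A * (1 + cmod z))" by (simp add: A_def exp_add[symmetric] algebra_simps)
    finally show ?thesis using that by linarith
  qed
  have growG: "cmod ((deriv ^^ l) G z) \<le> fact k * exp (2 * B * (1 + cmod z))" if "l \<le> k" for l z
  proof -
    have "cmod ((deriv ^^ l) G z) \<le> fact l * exp (2 * B * (1 + cmod z))"
      by (rule higher_deriv_growth[OF hol B gr])
    also have "\<dots> \<le> fact k * exp (2 * B * (1 + cmod z))"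
      using that by (intro mult_right_mono fact_mono) auto
    finally show ?thesis .
  qed
  \<comment> \<open>The chain G, G', ..., G^(k) links |G^(k)| and |P| to |G| one derivative at a
    time; \<open>K\<close> is appended because K' = P. All \<open>k + 2\<close> functions must share
    one circle.\<close>
  define u where "u i = (if i \<le> k then (deriv ^^ i) G else K)" for i
  have hu: "u i holomorphic_on UNIV" for i using hold holK by (simp add: u_def)
  have gu: "cmod (u i z) \<le> exp (A * (1 + cmod z))" for i z
  proof (cases "i \<le> k")
    case True
    have "cmod (u i z) \<le> fact k * exp (2 * B * (1 + cmod z))" using growG[OF True] True by (simp add: u_def)
    also have "\<dots> \<le> (fact k + cmod c) * exp (2 * B * (1 + cmod z))" by (intro mult_right_mono) auto
    finally show ?thesis by (rule growA)
  next
    case False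
    have "cmod (u i z) \<le> cmod ((deriv ^^ k) G z) + cmod c" using False norm_triangle_ineq4 by (simp add: u_def K_def)
    also have "\<dots> \<le> fact k * exp (2 * B * (1 + cmod z)) + cmod c * exp (2 * B * (1 + cmod z))"
      using growG[of k z] B mult_left_mono[of 1 "exp (2 * B * (1 + cmod z))" "cmod c"] by (intro add_mono) auto
    finally show ?thesis by (intro growA) (simp add: algebra_simps)
  qed
  have u0: "u i 0 \<noteq> 0" for i using G0 K0 by (simp add: u_def)
  obtain C where C: "C \<ge> 1" and circ: "\<And>R. R \<ge> 1 \<Longrightarrow> \<exists>r. R \<le> r \<and> r \<le> R + 1 \<and>
    (\<forall>i<k + 2. \<forall>z. cmod z = r \<longrightarrow> u i z \<noteq> 0 \<and> cmod (deriv (u i) z) \<le> C * R\<^sup>2 * cmod (u i z))"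
    using logarithmic_derivatives_on_circles[of "k + 2" u A] hu A gu u0 by metis
  obtain E where E: "E > 0"
    "\<And>L x y \<kappa> p. 1 \<le> L \<Longrightarrow> 0 < x \<Longrightarrow> 0 \<le> y \<Longrightarrow> 0 < \<kappa> \<Longrightarrow> 0 \<le> p \<Longrightarrow> y \<le> L ^ k * x \<Longrightarrow> p \<le> L * y \<Longrightarrow>
      p \<le> L * \<kappa> \<Longrightarrow> cmod c - y \<le> \<kappa> \<Longrightarrow> p ^ \<nu> * max 1 x \<le> E * L ^ (2 * (k + 1) * \<nu>) * (x ^ \<alpha> * \<kappa> ^ \<beta>)"
    using quotient_estimate[of "cmod c" \<alpha> \<nu> \<beta> k] c ab by (metis zero_less_norm_iff)
  define M where "M = 2 * (k + 1) * \<nu>"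
  \<comment> \<open>The factor \<open>max 1 (cmod (G z))\<close> lets one estimate serve both H and
    H G.\<close>
  have Hb: "\<exists>r. R \<le> r \<and> (\<forall>z. cmod z = r \<longrightarrow> cmod (H z) * max 1 (cmod (G z)) \<le> (E * C ^ M) * R ^ (2 * M))" if R: "R \<ge> 1" for R
  proof -
    obtain r where r: "R \<le> r" and ld: "\<And>i z. i < k + 2 \<Longrightarrow> cmod z = r \<Longrightarrow> u i z \<noteq> 0 \<and> cmod (deriv (u i) z) \<le> C * R\<^sup>2 * cmod (u i z)"
      using circ[OF R] by blast
    define L where "L = C * R\<^sup>2"
    have "1 * 1 \<le> C * R\<^sup>2" using C R by (intro mult_mono) auto
    then have L: "1 \<le> L" by (simp add: L_def)
    have "cmod (H z) * max 1 (cmod (G z)) \<le> (E * C ^ M) * R ^ (2 * M)" if z: "cmod z = r" for z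
    proof -
      have dG: "cmod ((deriv ^^ Suc i) G z) \<le> L * cmod ((deriv ^^ i) G z)" if "i \<le> k" for i
        using ld[of i z] z that by (simp add: u_def L_def)
      have pw: "cmod ((deriv ^^ i) G z) \<le> L ^ i * cmod (G z)" if "i \<le> k" for i
        using that
      proof (induction i)
        case (Suc i)
        have "cmod ((deriv ^^ Suc i) G z) \<le> L * cmod ((deriv ^^ i) G z)" using dG[of i] Suc.prems by simp
        also have "\<dots> \<le> L * (L ^ i * cmod (G z))" using Suc L by (intro mult_left_mono) auto
        finally show ?case by (simp add: mult_ac)
      qed simp
      have Gz: "G z \<noteq> 0" using ld[of 0 z] z by (simp add: u_def)
      have Kz: "K z \<noteq> 0" "cmod (P z) \<le> L * cmod (K z)" using ld[of "k + 1" z] z by (auto simp: u_def dK L_def)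
      have Py: "cmod (P z) \<le> L * cmod ((deriv ^^ k) G z)" using dG[of k] by (simp add: P_def)
      have tri: "cmod c - cmod ((deriv ^^ k) G z) \<le> cmod (K z)"
        unfolding K_def using norm_triangle_ineq2[of c "(deriv ^^ k) G z"] by (simp add: norm_minus_commute)
      have "cmod (P z) ^ \<nu> * max 1 (cmod (G z)) \<le> E * L ^ M * (cmod (G z) ^ \<alpha> * cmod (K z) ^ \<beta>)"
        unfolding M_def by (rule E(2)) (use L Gz Kz Py tri pw[of k] in auto)
      moreover have "cmod (P z) ^ \<nu> = cmod (H z) * (cmod (G z) ^ \<alpha> * cmod (K z) ^ \<beta>)"
        using H(2)[of z] by (metis norm_mult norm_power)
      ultimately have "cmod (H z) * max 1 (cmod (G z)) * (cmod (G z) ^ \<alpha> * cmod (K z) ^ \<beta>)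
        \<le> E * L ^ M * (cmod (G z) ^ \<alpha> * cmod (K z) ^ \<beta>)" by (simp add: mult_ac)
      moreover have "cmod (G z) ^ \<alpha> * cmod (K z) ^ \<beta> > 0" using Gz Kz by simp
      ultimately have "cmod (H z) * max 1 (cmod (G z)) \<le> E * L ^ M" using mult_le_cancel_right_pos by blast
      also have "L ^ M = C ^ M * R ^ (2 * M)" by (simp add: L_def power_mult_distrib power_mult)
      finally show ?thesis by (simp add: mult_ac)
    qed
    then show ?thesis using r by blast
  qed
  have H1: "cmod (H z) \<le> (E * C ^ M) * cmod z ^ (2 * M)" if "1 \<le> cmod z" for z
  proof (rule growth_from_circles[OF H(1) _ that])
    fix R :: real assume "R \<ge> 1"
    then obtain r where r: "R \<le> r" "\<And>z. cmod z = r \<Longrightarrow> cmod (H z) * max 1 (cmod (G z)) \<le> (E * C ^ M) * R ^ (2 * M)"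
      using Hb by blast
    have "cmod (H z) * 1 \<le> cmod (H z) * max 1 (cmod (G z))" for z by (intro mult_left_mono) auto
    then show "\<exists>r. R \<le> r \<and> (\<forall>z. cmod z = r \<longrightarrow> cmod (H z) \<le> (E * C ^ M) * R ^ (2 * M))"
      using r by (intro exI[of _ r]) (auto intro: order_trans)
  qed
  have H2: "cmod (H z * G z) \<le> (E * C ^ M) * cmod z ^ (2 * M)" if "1 \<le> cmod z" for z
  proof (rule growth_from_circles[OF _ _ that])
    show "(\<lambda>z. H z * G z) holomorphic_on UNIV" by (intro holomorphic_intros H(1) hol)
    fix R :: real assume "R \<ge> 1"
    then obtain r where r: "R \<le> r" "\<And>z. cmod z = r \<Longrightarrow> cmod (H z) * max 1 (cmod (G z)) \<le> (E * C ^ M) * R ^ (2 * M)"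
      using Hb by blast
    have "cmod (H z * G z) \<le> cmod (H z) * max 1 (cmod (G z))" for z unfolding norm_mult by (intro mult_left_mono) auto
    then show "\<exists>r. R \<le> r \<and> (\<forall>z. cmod z = r \<longrightarrow> cmod (H z * G z) \<le> (E * C ^ M) * R ^ (2 * M))"
      using r by (intro exI[of _ r]) (auto intro: order_trans)
  qed
  obtain h where h: "H = poly h" using entire_polynomial_growth[OF H(1) H1] by blast
  have "H w0 \<noteq> 0" using H(2)[of w0] P0 by (auto simp: P_def)
  then have "h \<noteq> 0" by (auto simp: h)
  \<comment> \<open>A non-zero polynomial is bounded below near infinity, so the polynomial bound
    for H G becomes one for \<open>G\<close>.\<close>
  then obtain b r where b: "b > 0" "\<And>z. r \<le> cmod z \<Longrightarrow> b \<le> cmod (H z)" unfolding h using poly_bounded_below by blast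
  have "cmod (G z) \<le> (E * C ^ M / b) * cmod z ^ (2 * M)" if z: "max 1 r \<le> cmod z" for z
  proof -
    have "b * cmod (G z) \<le> cmod (H z) * cmod (G z)" using b z by (intro mult_right_mono) auto
    also have "\<dots> \<le> (E * C ^ M) * cmod z ^ (2 * M)" using H2[of z] z by (simp add: norm_mult)
    finally show ?thesis using b by (simp add: field_simps)
  qed
  then obtain g where g: "G = poly g" using entire_polynomial_growth[OF hol] by blast
  have "poly (((pderiv ^^ (k + 1)) g) ^ \<nu>) = poly (h * (g ^ \<alpha> * ((pderiv ^^ k) g - [:c:]) ^ \<beta>))"
  proof
    fix z
    show "poly (((pderiv ^^ (k + 1)) g) ^ \<nu>) z = poly (h * (g ^ \<alpha> * ((pderiv ^^ k) g - [:c:]) ^ \<beta>)) z"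
      using H(2)[of z] unfolding P_def K_def g h higher_deriv_poly by simp
  qed
  then have "((pderiv ^^ (k + 1)) g) ^ \<nu> = h * (g ^ \<alpha> * ((pderiv ^^ k) g - [:c:]) ^ \<beta>)"
    by (simp only: poly_eq_poly_eq_iff)
  moreover have "(pderiv ^^ (k + 1)) g \<noteq> 0" using P0 unfolding g higher_deriv_poly by auto
  ultimately show False by (rule polynomial_degree_contradiction) (use ab in auto)
qed

text \<open>Zeros of each function are isolated, so a punctured neighbourhood of 0 avoids all of
  them at once. This supplies the new origin for the translation.\<close>

lemma entire_common_nonzero:
  fixes u :: "nat \<Rightarrow> complex \<Rightarrow> complex"
  assumes hol: "\<And>i. i < N \<Longrightarrow> u i holomorphic_on UNIV" and nz: "\<And>i. i < N \<Longrightarrow> \<exists>z. u i z \<noteq> 0"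
  shows "\<exists>z. \<forall>i<N. u i z \<noteq> 0"
proof -
  have "\<forall>\<^sub>F z in at 0. u i z \<noteq> 0" if "i < N" for i
  proof -
    obtain w where "u i w \<noteq> 0" using nz \<open>i < N\<close> by blast
    then show ?thesis using non_zero_neighbour_alt[of "u i" UNIV 0 w] hol[OF that] by (auto elim: eventually_mono)
  qed
  then have "\<forall>\<^sub>F z in at 0. \<forall>i\<in>{..<N}. u i z \<noteq> 0" by (intro eventually_ball_finite) auto
  then have "\<exists>z. \<forall>i\<in>{..<N}. u i z \<noteq> 0" using eventually_happens[of _ "at (0::complex)"] by auto
  then show ?thesis by auto
qed

text \<open>If G^(k+1) is not identically 0, then none of G, ..., G^(k), K is, and a translation to
  a common non-zero point reaches \<open>entire_zeros_contradiction\<close>. Otherwise G is a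
  polynomial of degree at most \<open>k\<close>.\<close>

lemma entire_constant_from_multiplicities:
  fixes G :: "complex \<Rightarrow> complex" and d k m :: nat and c :: complex
  assumes hol: "G holomorphic_on UNIV" and gr: "\<And>z. cmod (G z) \<le> exp (B * (1 + cmod z))"
    and c: "c \<noteq> 0" and dm: "m * (k + 1) + d < d * m"
    and vG: "\<And>z. G z = 0 \<Longrightarrow> vanishes_to_order G z d"
    and vK: "\<And>z. (deriv ^^ k) G z - c = 0 \<Longrightarrow> vanishes_to_order (\<lambda>z. (deriv ^^ k) G z - c) z m"
  shows "G constant_on UNIV"
proof (cases "\<forall>z. (deriv ^^ (k + 1)) G z = 0")
  case True
  have "m * (k + 1) < m * d" using dm by (simp add: mult.commute)
  then have kd: "k + 1 < d" by (simp only: mult_less_cancel1)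
  show ?thesis
  proof (rule higher_deriv_eq_zero_constant[OF hol])
    show "(deriv ^^ (k + 1)) G z = 0" for z using True by blast
    show "vanishes_to_order G z (k + 1)" if "G z = 0" for z
      using vG[OF that] kd by (auto simp: vanishes_to_order_def)
  qed
next
  case False
  then obtain w0 where w0: "(deriv ^^ (k + 1)) G w0 \<noteq> 0" by blast
  have hold: "(deriv ^^ l) G holomorphic_on UNIV" for l by (rule holomorphic_higher_deriv[OF hol open_UNIV])
  have der0: "(deriv ^^ n) (\<lambda>z. b) = (\<lambda>z. if n = 0 then b else 0)" for n and b :: complex
    by (induction n) auto
  define u where "u i = (if i \<le> k then (deriv ^^ i) G else (\<lambda>z. (deriv ^^ k) G z - c))" for i
  have "\<exists>z. u i z \<noteq> 0" for i
  proof (rule ccontr)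
    assume "\<not> ?thesis"
    then have z: "u i = (\<lambda>_. 0)" by auto
    show False
    proof (cases "i \<le> k")
      case True
      have "(deriv ^^ (k + 1)) G = (deriv ^^ ((k + 1 - i) + i)) G" using True by simp
      also have "\<dots> = (deriv ^^ (k + 1 - i)) ((deriv ^^ i) G)" by (simp only: funpow_add o_apply)
      also have "(deriv ^^ i) G = (\<lambda>_. 0)" using z True by (simp add: u_def)
      finally show False using w0 by (simp add: der0)
    next
      case False
      then have "(deriv ^^ k) G = (\<lambda>_. c)" using z by (auto simp: u_def fun_eq_iff)
      then show False using w0 by simp
    qed
  qed
  moreover have "u i holomorphic_on UNIV" for i unfolding u_def using hold[of i] hold[of k] by (auto intro!: holomorphic_on_diff)
  ultimately obtain p where p: "\<And>i. i < k + 2 \<Longrightarrow> u i p \<noteq> 0"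
    using entire_common_nonzero[of "k + 2" u] by blast
  \<comment> \<open>Translation by \<open>p\<close>; the factors 1 match the shape of
    \<open>higher_deriv_rescale\<close>.\<close>
  define G' where "G' = (\<lambda>z. 1 * G (1 * z + p))"
  have dG': "(deriv ^^ n) G' z = (deriv ^^ n) G (z + p)" for n z
    unfolding G'_def using higher_deriv_rescale[OF hol open_UNIV, of 1 z p n 1] by simp
  have dK': "(deriv ^^ n) (\<lambda>z. (deriv ^^ k) G' z - c) z = (deriv ^^ n) (\<lambda>z. (deriv ^^ k) G z - c) (z + p)" for n z
  proof -
    have "(\<lambda>z. (deriv ^^ k) G z - c) holomorphic_on UNIV" by (intro holomorphic_intros hold)
    from higher_deriv_rescale[OF this open_UNIV, of 1 z p n 1] show ?thesis by (simp add: dG')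
  qed
  have "False"
  \<comment> \<open>The sign of \<open>B\<close> is unknown, hence |B|; the factor 1 + |p| comes
    from 1 + |z + p| <= (1 + |p|) (1 + |z|).\<close>
  proof (rule entire_zeros_contradiction[of G' "\<bar>B\<bar> * (1 + cmod p)" c m k d "w0 - p"])
    show "G' holomorphic_on UNIV" unfolding G'_def
      by (intro holomorphic_intros holomorphic_on_compose_gen[OF _ hol, unfolded o_def]) auto
    show "cmod (G' z) \<le> exp (\<bar>B\<bar> * (1 + cmod p) * (1 + cmod z))" for z
    proof -
      have "B * (1 + cmod (z + p)) \<le> \<bar>B\<bar> * (1 + cmod (z + p))" by (intro mult_right_mono) auto
      also have "\<dots> \<le> \<bar>B\<bar> * ((1 + cmod p) * (1 + cmod z))"
      proof (intro mult_left_mono)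
        have "1 + cmod (z + p) \<le> 1 + cmod z + cmod p" using norm_triangle_ineq[of z p] by simp
        also have "\<dots> \<le> (1 + cmod p) * (1 + cmod z)" by (simp add: algebra_simps)
        finally show "1 + cmod (z + p) \<le> (1 + cmod p) * (1 + cmod z)" .
      qed simp
      finally have "exp (B * (1 + cmod (z + p))) \<le> exp (\<bar>B\<bar> * (1 + cmod p) * (1 + cmod z))" by (simp add: mult_ac)
      with gr[of "z + p"] have "cmod (G (z + p)) \<le> exp (\<bar>B\<bar> * (1 + cmod p) * (1 + cmod z))" by (rule order_trans)
      then show ?thesis by (simp add: G'_def)
    qed
    show "vanishes_to_order G' z d" if "G' z = 0" for z
      using vG[of "z + p"] that dG'[of 0 z] by (simp add: vanishes_to_order_def dG')
    show "vanishes_to_order (\<lambda>z. (deriv ^^ k) G' z - c) z m" if "(deriv ^^ k) G' z - c = 0" for z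
      using vK[of "z + p"] that unfolding vanishes_to_order_def dK' by (simp add: dG')
    show "(deriv ^^ l) G' 0 \<noteq> 0" if "l \<le> k" for l using p[of l] that by (simp add: dG' u_def)
    show "(deriv ^^ k) G' 0 - c \<noteq> 0" using p[of "k + 1"] by (simp add: dG' u_def)
    show "(deriv ^^ (k + 1)) G' (w0 - p) \<noteq> 0" unfolding dG' using w0 by simp
  qed (use c dm in auto)
  then show ?thesis ..
qed

subsection \<open>Normality\<close>

lemma chordal_dist_le: "chordal_dist (Some z) (Some w) \<le> 2 * dist z w"
proof -
  have "1 \<le> sqrt (1 + (cmod z)\<^sup>2) * sqrt (1 + (cmod w)\<^sup>2)"
    using mult_mono[of 1 "sqrt (1 + (cmod z)\<^sup>2)" 1 "sqrt (1 + (cmod w)\<^sup>2)"] by simp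
  then have "2 * cmod (z - w) / (sqrt (1 + (cmod z)\<^sup>2) * sqrt (1 + (cmod w)\<^sup>2)) \<le> 2 * cmod (z - w) / 1"
    by (intro divide_left_mono) auto
  then show ?thesis by (simp add: dist_norm)
qed

lemma chordal_dist_infinity:
  assumes "\<epsilon> > 0" "cmod z > 2 / \<epsilon>"
  shows "chordal_dist (Some z) None < \<epsilon>"
proof -
  have "2 / \<epsilon> < sqrt (1 + (cmod z)\<^sup>2)"
    using assms(2) real_le_rsqrt[of "cmod z" "1 + (cmod z)\<^sup>2"] by simp
  moreover have "0 < sqrt (1 + (cmod z)\<^sup>2)" by (simp add: add_pos_nonneg)
  ultimately show ?thesis using assms(1) by (simp add: field_simps)
qed

lemma locally_spherical_imp_subsequence:
  fixes h :: "nat \<Rightarrow> complex \<Rightarrow> complex"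
  assumes D: "complex_domain D" and hol: "\<And>j. h j holomorphic_on D"
    and sph: "\<And>z0. z0 \<in> D \<Longrightarrow> \<exists>r C. r > 0 \<and> ball z0 r \<subseteq> D \<and>
       (\<forall>j. \<forall>z\<in>ball z0 r. cmod (deriv (h j) z) \<le> C * (1 + (cmod (h j z))\<^sup>2))"
  shows "\<exists>r. strict_mono r \<and>
           ((\<exists>g. g holomorphic_on D \<and>
               spherically_converges_on_compacts D (h \<circ> r) (\<lambda>z. Some (g z))) \<or>
            spherically_converges_on_compacts D (h \<circ> r) (\<lambda>z. None))"
proof -
  have D': "open D" "connected D" "D \<noteq> {}" using D by (auto simp: complex_domain_def)
  obtain r where r: "strict_mono r" and alt: "(\<exists>g. g holomorphic_on D \<and>
        (\<forall>K. compact K \<longrightarrow> K \<subseteq> D \<longrightarrow> uniform_limit K (h \<circ> r) g sequentially)) \<or>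
      (\<forall>K B. compact K \<longrightarrow> K \<subseteq> D \<longrightarrow> (\<forall>\<^sub>F j in sequentially. \<forall>z\<in>K. cmod (h (r j) z) > B))"
    using spherical_normal[OF D' hol sph] by blast
  from alt show ?thesis
  proof (elim disjE exE conjE)
    fix g assume g: "g holomorphic_on D"
      and ul: "\<forall>K. compact K \<longrightarrow> K \<subseteq> D \<longrightarrow> uniform_limit K (h \<circ> r) g sequentially"
    have "spherically_converges_on_compacts D (h \<circ> r) (\<lambda>z. Some (g z))"
      unfolding spherically_converges_on_compacts_def
    proof (intro allI impI)
      fix K and \<epsilon> :: real assume K: "compact K \<and> K \<subseteq> D" and \<epsilon>: "\<epsilon> > 0"
      have "uniform_limit K (h \<circ> r) g sequentially" using ul K by blast
      from uniform_limitD[OF this half_gt_zero[OF \<epsilon>]]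
      obtain N where "\<And>j z. j \<ge> N \<Longrightarrow> z \<in> K \<Longrightarrow> dist ((h \<circ> r) j z) (g z) < \<epsilon> / 2"
        unfolding eventually_sequentially by blast
      then show "\<exists>N. \<forall>j\<ge>N. \<forall>z\<in>K. chordal_dist (Some ((h \<circ> r) j z)) (Some (g z)) < \<epsilon>"
        using chordal_dist_le by (intro exI[of _ N]) (fastforce intro: le_less_trans)
    qed
    with r g show ?thesis by blast
  next
    assume inf: "\<forall>K B. compact K \<longrightarrow> K \<subseteq> D \<longrightarrow> (\<forall>\<^sub>F j in sequentially. \<forall>z\<in>K. cmod (h (r j) z) > B)"
    have "spherically_converges_on_compacts D (h \<circ> r) (\<lambda>z. None)"
      unfolding spherically_converges_on_compacts_def
    proof (intro allI impI)
      fix K and \<epsilon> :: real assume K: "compact K \<and> K \<subseteq> D" and \<epsilon>: "\<epsilon> > 0"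
      then obtain N where N: "\<And>j z. j \<ge> N \<Longrightarrow> z \<in> K \<Longrightarrow> cmod (h (r j) z) > 2 / \<epsilon>"
        using inf unfolding eventually_sequentially by meson
      show "\<exists>N. \<forall>j\<ge>N. \<forall>z\<in>K. chordal_dist (Some ((h \<circ> r) j z)) None < \<epsilon>"
        unfolding o_def by (intro exI[of _ N] allI impI ballI chordal_dist_infinity[OF \<epsilon>] N)
    qed
    with r show ?thesis by blast
  qed
qed

section \<open>Limit of the rescaled expression and conclusion\<close>

text \<open>Because the limit is constant, continuity at the one point \<open>c\<close> already
  gives uniformity.\<close>

lemma uniform_limit_compose_const:
  fixes Y :: "nat \<Rightarrow> 'a \<Rightarrow> complex" and \<phi> :: "complex \<Rightarrow> complex"
  assumes Y: "uniform_limit X Y (\<lambda>_. c) sequentially" and \<phi>: "isCont \<phi> c"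
  shows "uniform_limit X (\<lambda>n x. \<phi> (Y n x)) (\<lambda>_. \<phi> c) sequentially"
proof (rule uniform_limitI)
  fix e :: real assume "e > 0"
  then obtain \<delta> where \<delta>: "\<delta> > 0" "\<And>y. dist y c < \<delta> \<Longrightarrow> dist (\<phi> y) (\<phi> c) < e"
    using \<phi> unfolding continuous_at_eps_delta by blast
  have "\<forall>\<^sub>F n in sequentially. \<forall>x\<in>X. dist (Y n x) c < \<delta>" using Y \<delta>(1) by (rule uniform_limitD)
  then show "\<forall>\<^sub>F n in sequentially. \<forall>x\<in>X. dist (\<phi> (Y n x)) (\<phi> c) < e"
    by eventually_elim (use \<delta>(2) in blast)
qed

lemma uniform_limit_affine:
  fixes \<rho> :: "nat \<Rightarrow> real" and z :: "nat \<Rightarrow> complex"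
  assumes \<rho>: "\<rho> \<longlonglongrightarrow> 0" and z: "z \<longlonglongrightarrow> c"
  shows "uniform_limit (ball 0 S) (\<lambda>n \<zeta>. of_real (\<rho> n) * \<zeta> + z n) (\<lambda>_. c) sequentially"
proof (rule uniform_limitI)
  fix e :: real assume e: "e > 0"
  have "(\<lambda>n. \<bar>\<rho> n\<bar> * S + cmod (z n - c)) \<longlonglongrightarrow> \<bar>0\<bar> * S + cmod (c - c)" by (intro tendsto_intros \<rho> z)
  then have "\<forall>\<^sub>F n in sequentially. \<bar>\<rho> n\<bar> * S + cmod (z n - c) < e"
    using e by (intro order_tendstoD) auto
  then show "\<forall>\<^sub>F n in sequentially. \<forall>\<zeta>\<in>ball 0 S. dist (of_real (\<rho> n) * \<zeta> + z n) c < e"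
  proof eventually_elim
    case (elim n)
    show ?case
    proof
      fix \<zeta> :: complex assume \<zeta>: "\<zeta> \<in> ball 0 S"
      have "dist (of_real (\<rho> n) * \<zeta> + z n) c \<le> cmod (of_real (\<rho> n) * \<zeta>) + cmod (z n - c)"
        unfolding dist_norm by (metis add_diff_eq norm_triangle_ineq)
      also have "cmod (of_real (\<rho> n) * \<zeta>) \<le> \<bar>\<rho> n\<bar> * S"
        unfolding norm_mult norm_of_real using \<zeta> by (intro mult_left_mono) auto
      finally show "dist (of_real (\<rho> n) * \<zeta> + z n) c < e" using elim by linarith
    qed
  qed
qed

text \<open>In the rescaled variable the term \<open>a f ^ n\<close> carries the factor \<open>\<rho> ^ (k * n)\<close> and disappears in the limit.\<close>
lemma rescaled_expression_limit:
  fixes f :: "nat \<Rightarrow> complex \<Rightarrow> complex"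
  assumes \<rho>: "\<And>i. \<rho> i > 0" "\<rho> \<longlonglongrightarrow> 0" and z: "z \<longlonglongrightarrow> c"
    and k: "k > 0" and n: "n > 0" and a: "isCont a c" and \<psi>: "isCont \<psi> c"
    and D: "open D" and hol: "\<And>i. f i holomorphic_on D"
    and inD: "\<And>i \<zeta>. \<zeta> \<in> ball 0 (S + 1) \<Longrightarrow> of_real (\<rho> i) * \<zeta> + z i \<in> D"
    and G: "G holomorphic_on UNIV"
    and ul: "uniform_limit (ball 0 (S + 1)) (\<lambda>i. rescale k (f i) (z i) (\<rho> i)) G sequentially"
  shows "uniform_limit (ball 0 S)
    (\<lambda>i \<zeta>. let w = of_real (\<rho> i) * \<zeta> + z i in (deriv ^^ k) (f i) w - a w * f i w ^ n - \<psi> w)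
    (\<lambda>\<zeta>. (deriv ^^ k) G \<zeta> - \<psi> c) sequentially"
proof -
  define g where "g i = rescale k (f i) (z i) (\<rho> i)" for i
  define W where "W i \<zeta> = of_real (\<rho> i) * \<zeta> + z i" for i \<zeta>
  have holg: "g i holomorphic_on ball 0 (S + 1)" for i
    unfolding g_def rescale_def
    by (intro holomorphic_intros holomorphic_on_compose_gen[OF _ hol, unfolded o_def])
       (use inD in auto)
  have d: "(deriv ^^ k) (g i) \<zeta> = (deriv ^^ k) (f i) (W i \<zeta>)" if "\<zeta> \<in> ball 0 S" for i \<zeta>
  proof -
    have "W i \<zeta> \<in> D" using inD[of \<zeta> i] that by (simp add: W_def)
    then show ?thesis
      using higher_deriv_rescale[OF hol[of i] D, of "of_real (\<rho> i)" \<zeta> "z i" k "of_real (1 / \<rho> i ^ k)"] \<rho>(1)[of i]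
      by (simp add: g_def rescale_def W_def)
  qed
  have fg: "of_real (\<rho> i ^ k) * g i \<zeta> = f i (W i \<zeta>)" for i \<zeta>
    using \<rho>(1)[of i] by (simp add: g_def rescale_def W_def)
  have sub: "ball 0 S \<subseteq> ball (0::complex) (S + 1)" by (intro subset_ball) simp
  have bG: "bounded (G ` ball 0 S)"
  proof -
    have "compact (G ` cball 0 S)"
      using holomorphic_on_imp_continuous_on[OF G] continuous_on_subset by (intro compact_continuous_image) auto
    then show ?thesis by (rule bounded_subset[OF compact_imp_bounded]) auto
  qed
  have ulW: "uniform_limit (ball 0 S) W (\<lambda>_. c) sequentially"
    unfolding W_def[abs_def] by (rule uniform_limit_affine[OF \<rho>(2) z])
  \<comment> \<open>Convergence on radius S + 1 leaves room for the Cauchy estimates on radius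
    S.\<close>
  have l1: "uniform_limit (ball 0 S) (\<lambda>i. (deriv ^^ k) (g i)) ((deriv ^^ k) G) sequentially"
    by (rule uniform_limit_higher_deriv[OF ul[folded g_def] holg]) simp
  have l2: "uniform_limit (ball 0 S) (\<lambda>i \<zeta>. \<psi> (W i \<zeta>)) (\<lambda>_. \<psi> c) sequentially"
    by (rule uniform_limit_compose_const[OF ulW \<psi>])
  have l3: "uniform_limit (ball 0 S) (\<lambda>i \<zeta>. a (W i \<zeta>)) (\<lambda>_. a c) sequentially"
    by (rule uniform_limit_compose_const[OF ulW a])
  have "(\<lambda>i. complex_of_real (\<rho> i ^ k)) \<longlonglongrightarrow> of_real (0 ^ k)" by (intro tendsto_intros \<rho>)
  then have "(\<lambda>i. complex_of_real (\<rho> i ^ k)) \<longlonglongrightarrow> 0" using k by (simp add: power_0_left)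
  then have "uniform_limit (ball 0 S) (\<lambda>i (\<zeta>::complex). complex_of_real (\<rho> i ^ k)) (\<lambda>_. 0) sequentially"
    by (auto simp: uniform_limit_iff tendsto_iff elim: eventually_mono)
  from uniform_lim_mult[OF this uniform_limit_on_subset[OF ul[folded g_def] sub] _ bG]
  have "uniform_limit (ball 0 S) (\<lambda>i \<zeta>. of_real (\<rho> i ^ k) * g i \<zeta>) (\<lambda>\<zeta>. 0 * G \<zeta>) sequentially"
    by (simp add: image_constant_conv)
  then have "uniform_limit (ball 0 S) (\<lambda>i \<zeta>. f i (W i \<zeta>)) (\<lambda>_. 0) sequentially" by (simp only: fg mult_zero_left)
  from uniform_limit_compose_const[OF this, of "\<lambda>y. y ^ n"] n
  have l4: "uniform_limit (ball 0 S) (\<lambda>i \<zeta>. f i (W i \<zeta>) ^ n) (\<lambda>_. 0) sequentially" by (simp add: power_0_left)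
  from uniform_lim_mult[OF l3 l4]
  have l5: "uniform_limit (ball 0 S) (\<lambda>i \<zeta>. a (W i \<zeta>) * f i (W i \<zeta>) ^ n) (\<lambda>_. a c * 0) sequentially"
    by (simp add: image_constant_conv)
  have "uniform_limit (ball 0 S) (\<lambda>i \<zeta>. (deriv ^^ k) (g i) \<zeta> - a (W i \<zeta>) * f i (W i \<zeta>) ^ n - \<psi> (W i \<zeta>))
    (\<lambda>\<zeta>. (deriv ^^ k) G \<zeta> - a c * 0 - \<psi> c) sequentially"
    by (intro uniform_limit_minus l1 l5 l2)
  then show ?thesis
    using uniform_limit_cong'[of "ball 0 S" "\<lambda>i \<zeta>. (deriv ^^ k) (g i) \<zeta> - a (W i \<zeta>) * f i (W i \<zeta>) ^ n - \<psi> (W i \<zeta>)"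
      "\<lambda>i \<zeta>. let w = of_real (\<rho> i) * \<zeta> + z i in (deriv ^^ k) (f i) w - a w * f i w ^ n - \<psi> w"
      "\<lambda>\<zeta>. (deriv ^^ k) G \<zeta> - a c * 0 - \<psi> c" "\<lambda>\<zeta>. (deriv ^^ k) G \<zeta> - \<psi> c" sequentially] d
    by (simp add: Let_def W_def)
qed

theorem theorem1p2:
  fixes D :: "complex set"
    and F :: "(complex \<Rightarrow> complex) set"
    and a \<psi> :: "complex \<Rightarrow> complex"
    and d k m n :: nat
  assumes "complex_domain D"
    and "\<And>f. f \<in> F \<Longrightarrow> f holomorphic_on D"
    and "d > 0" and "k > 0" and "m > 0" and "n > 0"
    and "(real k + 1) / real d + 1 / real m < 1"
    and "a holomorphic_on D"
    and "\<psi> holomorphic_on D"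
    and "\<And>z. z \<in> D \<Longrightarrow> \<psi> z \<noteq> 0"
    and "\<And>f. f \<in> F \<Longrightarrow> zeros_mult_ge D f d"
    and "\<And>f. f \<in> F \<Longrightarrow>
           zeros_mult_ge D (\<lambda>z. (deriv ^^ k) f z - a z * f z ^ n - \<psi> z) m"
  shows "normal_family D F"
  unfolding normal_family_def
proof (intro allI impI)
  fix h :: "nat \<Rightarrow> complex \<Rightarrow> complex" assume hF: "\<forall>j. h j \<in> F"
  have D: "open D" using assms(1) by (simp add: complex_domain_def)
  have holh: "h j holomorphic_on D" for j using assms(2) hF by blast
  \<comment> \<open>The hypothesis multiplied by d m; it also yields d > k + 1, so the density is
    available.\<close>
  have "(real k + 1) * real m + real d < real d * real m"
    using assms(3,5,7) by (simp add: field_simps)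
  then have "real (m * (k + 1) + d) < real (d * m)" by (simp add: algebra_simps)
  then have dm: "m * (k + 1) + d < d * m" by (simp only: of_nat_less_iff)
  have "m * (k + 1) < m * d" using dm by (simp add: mult.commute)
  then have "k + 1 < d" by (simp only: mult_less_cancel1)
  then have kd: "k < d" by simp
  have vanh: "vanishes_to_order (h j) z d" if "z \<in> D" "h j z = 0" for j z
    using zeros_mult_ge_imp_vanishes[OF assms(11) D holh that] hF by blast
  \<comment> \<open>A bound uniform in \<open>j\<close> is wanted, so the rescaling is applied to
    the family \<open>range h\<close>; an unbounded density would produce a non-constant
    \<open>G\<close> that the multiplicities force to be constant.\<close>
  have sdb: "\<exists>r C. r > 0 \<and> ball z0 r \<subseteq> D \<and> (\<forall>j. \<forall>z\<in>ball z0 r. scale_density k (h j) z \<le> C)" if z0: "z0 \<in> D" for z0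
  proof (rule ccontr)
    assume neg: "\<not> ?thesis"
    have unb: "\<exists>f\<in>range h. \<exists>z\<in>ball z0 r. scale_density k f z > C" if "r > 0" "ball z0 r \<subseteq> D" for r C
      using neg that by (simp add: not_le)
    have holr: "f holomorphic_on D" if "f \<in> range h" for f using that holh by blast
    have vanr: "vanishes_to_order f w d" if "f \<in> range h" "w \<in> D" "f w = 0" for f w using that vanh by blast
    obtain f z c \<rho> where fh: "\<forall>i. f i \<in> range h" and z: "z \<longlonglongrightarrow> c" and c: "c \<in> D"
      and \<rho>: "\<forall>i. \<rho> i > 0" "\<rho> \<longlonglongrightarrow> 0"
      and disc: "\<forall>i. \<forall>\<zeta>\<in>ball 0 (real i). of_real (\<rho> i) * \<zeta> + z i \<in> D \<and>
        scale_density k (rescale k (f i) (z i) (\<rho> i)) \<zeta> \<le> 2 ^ (k * (k + 1))"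
      and one: "\<forall>i. scale_density k (rescale k (f i) (z i) (\<rho> i)) 0 = 1"
      using zalcman_rescaling[OF D holr assms(4) kd vanr z0 unb] by blast
    have inD: "of_real (\<rho> i) * \<zeta> + z i \<in> D"
      and sd: "scale_density k (rescale k (f i) (z i) (\<rho> i)) \<zeta> \<le> 2 ^ (k * (k + 1))"
      if "\<zeta> \<in> ball 0 (real i)" for i \<zeta>
      using disc that by auto
    have holf: "f i holomorphic_on D" for i using holr fh by blast
    define g where "g i = rescale k (f i) (z i) (\<rho> i)" for i
    have holg: "g i holomorphic_on ball 0 (real i)" for i
      unfolding g_def rescale_def
      by (intro holomorphic_intros holomorphic_on_compose_gen[OF _ holf, unfolded o_def])
         (use inD in auto)
    have vang: "vanishes_to_order (g i) \<zeta> d" if "\<zeta> \<in> ball 0 (real i)" "g i \<zeta> = 0" for i \<zeta>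
    proof -
      have "f i (of_real (\<rho> i) * \<zeta> + z i) = 0" using that(2) \<rho>(1)[rule_format, of i] by (simp add: g_def rescale_def)
      then have "vanishes_to_order (f i) (of_real (\<rho> i) * \<zeta> + z i) d" using vanr fh inD[OF that(1)] by blast
      then show ?thesis
        unfolding vanishes_to_order_def g_def rescale_def
        by (simp only: higher_deriv_rescale[OF holf D inD[OF that(1)]]) simp
    qed
    obtain r G B where r: "strict_mono (r :: nat \<Rightarrow> nat)" and G: "G holomorphic_on UNIV"
      and ul: "\<forall>R. uniform_limit (ball 0 R) (g \<circ> r) G sequentially"
      and gr: "\<forall>\<zeta>. cmod (G \<zeta>) \<le> exp (B * (1 + cmod \<zeta>))" and nc: "\<not> G constant_on UNIV"
      and vG: "\<forall>\<zeta>. G \<zeta> = 0 \<longrightarrow> vanishes_to_order G \<zeta> d"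
      using rescaled_limit[of g, OF holg assms(4) kd vang sd[folded g_def] one[rule_format, folded g_def]] by blast
    have isc: "isCont a c" "isCont \<psi> c"
      using assms(8,9) D c by (auto simp: continuous_on_eq_continuous_at dest!: holomorphic_on_imp_continuous_on)
    have "vanishes_to_order (\<lambda>\<zeta>. (deriv ^^ k) G \<zeta> - \<psi> c) \<zeta>0 m" if zero: "(deriv ^^ k) G \<zeta>0 - \<psi> c = 0" for \<zeta>0
    proof -
      \<comment> \<open>Radius S contains the unit disc about \<open>\<zeta>0\<close>, and S + 1 is
        what \<open>rescaled_expression_limit\<close> asks for; dropping \<open>N\<close> terms
        makes every remaining disc that large.\<close>
      define S where "S = cmod \<zeta>0 + 1"
      obtain N :: nat where N: "S + 1 \<le> real N" using real_arch_simple by blast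
      define s where "s i = r (i + N)" for i
      have s: "strict_mono s" using r by (simp add: s_def strict_mono_def)
      have sN: "ball 0 (S + 1) \<subseteq> ball (0::complex) (real (s i))" for i
      proof -
        have "N \<le> s i" using seq_suble[OF r, of "i + N"] by (simp add: s_def)
        then show ?thesis using N by (intro subset_ball) linarith
      qed
      define E where "E i w = (deriv ^^ k) (f (s i)) w - a w * f (s i) w ^ n - \<psi> w" for i w
      define u where "u i = (\<lambda>\<zeta>. 1 * E i (of_real (\<rho> (s i)) * \<zeta> + z (s i)))" for i
      have holE: "E i holomorphic_on D" for i
        unfolding E_def by (intro holomorphic_intros holomorphic_higher_deriv holf D assms(8,9))
      have inS: "of_real (\<rho> (s i)) * \<zeta> + z (s i) \<in> D" if "\<zeta> \<in> ball 0 (S + 1)" for i \<zeta>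
        using inD sN that by blast
      have "uniform_limit (ball 0 S)
        (\<lambda>i \<zeta>. let w = of_real (\<rho> (s i)) * \<zeta> + z (s i) in (deriv ^^ k) (f (s i)) w - a w * f (s i) w ^ n - \<psi> w)
        (\<lambda>\<zeta>. (deriv ^^ k) G \<zeta> - \<psi> c) sequentially"
      proof (rule rescaled_expression_limit[where \<rho> = "\<lambda>i. \<rho> (s i)" and z = "\<lambda>i. z (s i)" and f = "\<lambda>i. f (s i)",
            OF \<rho>(1)[rule_format] _ _ assms(4,6) isc D holf inS G])
        show "(\<lambda>i. \<rho> (s i)) \<longlonglongrightarrow> 0" using LIMSEQ_subseq_LIMSEQ[OF \<rho>(2) s] by (simp add: o_def)
        show "(\<lambda>i. z (s i)) \<longlonglongrightarrow> c" using LIMSEQ_subseq_LIMSEQ[OF z s] by (simp add: o_def)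
        have "uniform_limit (ball 0 (S + 1)) (\<lambda>i. (g \<circ> r) (i + N)) G sequentially"
          by (rule filterlim_compose[OF ul[rule_format] filterlim_add_const_nat_at_top])
        then show "uniform_limit (ball 0 (S + 1)) (\<lambda>i. rescale k (f (s i)) (z (s i)) (\<rho> (s i))) G sequentially"
          by (simp add: g_def s_def)
      qed
      then have ulu: "uniform_limit (ball 0 S) u (\<lambda>\<zeta>. (deriv ^^ k) G \<zeta> - \<psi> c) sequentially"
        by (simp add: u_def[abs_def] E_def Let_def)
      have sub: "ball \<zeta>0 1 \<subseteq> ball 0 S"
      proof
        fix w assume "w \<in> ball \<zeta>0 1"
        then show "w \<in> ball 0 S" using dist_triangle[of 0 w \<zeta>0] by (simp add: S_def)
      qed
      have inS': "of_real (\<rho> (s i)) * \<zeta> + z (s i) \<in> D" if "\<zeta> \<in> ball \<zeta>0 1" for i \<zeta>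
        using inS[of \<zeta> i] sub that by auto
      show ?thesis
      proof (rule vanishes_to_order_limit[OF uniform_limit_on_subset[OF ulu sub]])
        fix i
        show "u i holomorphic_on ball \<zeta>0 1" unfolding u_def
          by (intro holomorphic_intros holomorphic_on_compose_gen[OF _ holE, unfolded o_def])
             (use inS' in auto)
        fix \<zeta> assume \<zeta>: "\<zeta> \<in> ball \<zeta>0 1" "u i \<zeta> = 0"
        let ?w = "of_real (\<rho> (s i)) * \<zeta> + z (s i)"
        have "range h \<subseteq> F" using hF by blast
        then have "f (s i) \<in> F" using fh by blast
        then have "zeros_mult_ge D (E i) m" unfolding E_def by (rule assms(12))
        then have "vanishes_to_order (E i) ?w m"
          by (rule zeros_mult_ge_imp_vanishes[OF _ D holE inS'[OF \<zeta>(1)]]) (use \<zeta>(2) in \<open>simp add: u_def\<close>)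
        then show "vanishes_to_order (u i) \<zeta> m"
          unfolding vanishes_to_order_def u_def
          by (simp only: higher_deriv_rescale[OF holE D inS'[OF \<zeta>(1)]]) simp
      qed (use zero in auto)
    qed
    then have "G constant_on UNIV"
      using entire_constant_from_multiplicities[OF G gr[rule_format] assms(10)[OF c] dm vG[rule_format]] by blast
    with nc show False ..
  qed
  have "\<exists>r C. r > 0 \<and> ball z0 r \<subseteq> D \<and>
      (\<forall>j. \<forall>z\<in>ball z0 r. cmod (deriv (h j) z) \<le> C * (1 + (cmod (h j z))\<^sup>2))" if z0: "z0 \<in> D" for z0
  proof -
    obtain r C where r: "r > 0" "ball z0 r \<subseteq> D" and C: "\<And>j z. z \<in> ball z0 r \<Longrightarrow> scale_density k (h j) z \<le> C"
      using sdb[OF z0] by blast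
    have "cmod (deriv (h j) z) \<le> (1 + C) * (1 + (cmod (h j z))\<^sup>2)" if z: "z \<in> ball z0 r" for j z
    proof (rule scale_density_bound[OF C[OF z] assms(4)])
      assume "h j z = 0"
      then have "\<forall>l<d. (deriv ^^ l) (h j) z = 0" using vanh z r unfolding vanishes_to_order_def by blast
      moreover have "1 < d" using kd assms(4) by simp
      ultimately have "(deriv ^^ 1) (h j) z = 0" by blast
      then show "deriv (h j) z = 0" by simp
    qed
    with r show ?thesis by blast
  qed
  then show "\<exists>r. strict_mono r \<and>
           ((\<exists>g. g holomorphic_on D \<and>
               spherically_converges_on_compacts D (h \<circ> r) (\<lambda>z. Some (g z))) \<or>
            spherically_converges_on_compacts D (h \<circ> r) (\<lambda>z. None))"
    by (rule locally_spherical_imp_subsequence[OF assms(1) holh])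
qed

end
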